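(* (i) The free right action of $P_+(\mathbb R)$ on the (open) space $V$ endows the orbits with a unique Riemannian metric such that the vector fields $X,Y$ form an orthonormal basis (at each point) and a unique complex structure such that $$\bar\partial(f)=0\iff(X+iY)f=0.$$ (ii) Each orbit as in (i) is isomorphic to the complex upper half-plane $\mathbb H=\{x+iy\mid y>0\}$ with the Poincaré metric. (iii) The Laplacian $\Delta=-\bar\partial^*\bar\partial$, for this Riemannian metric, is equal to $X^2+(Y-\frac12)^2-\frac14$.
   Context: $\mathbb A_{\mathbb Q}=\mathbb A_{\mathbb Q,f}\times\mathbb R$ denotes the adeles of $\mathbb Q$. For a commutative ring $R$, $\overline{P(R)}=\left\{\begin{pmatrix} a&b\\0&1\end{pmatrix}: a,b\in R\right\}$ and $P(R)$ is the group of those matrices with $a$ invertible; $P_+(\mathbb R)=\left\{\begin{pmatrix} a&b\\0&1\end{pmatrix}:a>0,\ b\in\mathbb R\right\}$. $P(\mathbb Q)$ acts on $\overline{P(\mathbb A_{\mathbb Q})}$ by left multiplication. $V\subset P(\mathbb Q)\backslash\overline{P(\mathbb A_{\mathbb Q})}$ is the open subset of classes of $\begin{pmatrix} y&x\\0&1\end{pmatrix}$ with $y_f\neq0$ and $y_\infty\ne0$ (finite and archimedean components of $y$); $P_+(\mathbb R)$ acts freely on $V$ by right multiplication at the archimedean place. $X$ and $Y$ are the vector fields along the orbits corresponding to the generators $X=\begin{pmatrix}0&1\\0&0\end{pmatrix}$, $Y=\begin{pmatrix}1&0\\0&0\end{pmatrix}$ of the Lie algebra of $P_+(\mathbb R)$;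 $[Y,X]=X$. The Poincaré metric is $(dx^2+dy^2)/y^2$. In (iii), $\bar\partial$ is normalized as the operator $X+iY$ on functions, adjoints being taken in $L^2$ of the Riemannian volume, so that $\Delta$ is the Laplace–Beltrami operator ($y^2(\partial_x^2+\partial_y^2)$ on $\mathbb H$). *)

theory Defs
  imports
    "HOL-Analysis.Analysis"
    "HOL-Computational_Algebra.Primes"
begin

section \<open>The adeles of the rationals\<close>

definition pabs :: "nat \<Rightarrow> rat \<Rightarrow> real" where
  "pabs p x =
    (if x = 0 then 0
     else real p powi (int (multiplicity (int p) (snd (quotient_of x)))
                     - int (multiplicity (int p) (fst (quotient_of x)))))"

definition padic_Cauchy :: "nat \<Rightarrow> (nat \<Rightarrow> rat) \<Rightarrow> bool" where
  "padic_Cauchy p s \<longleftrightarrow> (\<forall>e>0. \<exists>N. \<forall>m\<ge>N. \<forall>n\<ge>N. pabs p (s m - s n) < e)"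

definition padic_null :: "nat \<Rightarrow> (nat \<Rightarrow> rat) \<Rightarrow> bool" where
  "padic_null p s \<longleftrightarrow> (\<lambda>n. pabs p (s n)) \<longlonglongrightarrow> 0"

definition padic_integral :: "nat \<Rightarrow> (nat \<Rightarrow> rat) \<Rightarrow> bool" where
  "padic_integral p s \<longleftrightarrow> (\<forall>\<^sub>F n in sequentially. pabs p (s n) \<le> 1)"

text \<open>Elements of the restricted product of the fields \<open>\<rat>\<^sub>p\<close> relative to the rings \<open>\<int>\<^sub>p\<close> are
  represented by families of Cauchy sequences; the values at indices that are not prime are
  irrelevant.\<close>

definition finite_adele_rep :: "(nat \<Rightarrow> nat \<Rightarrow> rat) \<Rightarrow> bool" where
  "finite_adele_rep a \<longleftrightarrow>
     (\<forall>p. prime p \<longrightarrow> padic_Cauchy p (a p)) \<and> finite {p. prime p \<and> \<not> padic_integral p (a p)}"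

definition finite_adele_rel :: "(nat \<Rightarrow> nat \<Rightarrow> rat) \<Rightarrow> (nat \<Rightarrow> nat \<Rightarrow> rat) \<Rightarrow> bool" where
  "finite_adele_rel a b \<longleftrightarrow>
     finite_adele_rep a \<and> finite_adele_rep b \<and>
     (\<forall>p. prime p \<longrightarrow> padic_null p (\<lambda>n. a p n - b p n))"

lemma pabs_0 [simp]: "pabs p 0 = 0"
  by (simp add: pabs_def)

lemma pabs_frac:
  fixes a b :: int
  assumes p: "prime p" and ab: "a \<noteq> 0" "b \<noteq> 0"
  shows "pabs p (of_int a / of_int b)
         = real p powi (int (multiplicity (int p) b) - int (multiplicity (int p) a))"
proof -
  obtain n d where q: "quotient_of (of_int a / of_int b) = (n, d)"
    by (meson surj_pair)
  have d: "d > 0" using q quotient_of_denom_pos by blast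
  have e: "(of_int a / of_int b :: rat) = of_int n / of_int d"
    using q quotient_of_div by blast
  have n: "n \<noteq> 0" using e ab d by auto
  have "of_int a * of_int d = (of_int n * of_int b :: rat)"
    using e ab d by (simp add: field_simps)
  hence eq: "a * d = n * b" by (metis of_int_eq_iff of_int_mult)
  have pe: "prime_elem (int p)" using p by simp
  have "multiplicity (int p) a + multiplicity (int p) d
      = multiplicity (int p) n + multiplicity (int p) b"
    using prime_elem_multiplicity_mult_distrib[OF pe, of a d]
      prime_elem_multiplicity_mult_distrib[OF pe, of n b] eq ab d n by simp
  hence "int (multiplicity (int p) d) - int (multiplicity (int p) n)
       = int (multiplicity (int p) b) - int (multiplicity (int p) a)" by linarith
  thus ?thesis using ab q by (simp add: pabs_def)
qed

lemma rat_frac_cases: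
  fixes x :: rat
  assumes "x \<noteq> 0"
  obtains a b :: int where "a \<noteq> 0" "b \<noteq> 0" "x = of_int a / of_int b"
proof -
  obtain n d where q: "quotient_of x = (n, d)" by (meson surj_pair)
  have d: "d > 0" using q quotient_of_denom_pos by blast
  have e: "x = of_int n / of_int d" using q quotient_of_div by blast
  show ?thesis using that[of n d] d e assms by auto
qed

lemma pabs_nonneg [simp]: "0 \<le> pabs p x"
  by (simp add: pabs_def)

lemma pabs_mult:
  assumes p: "prime p"
  shows "pabs p (x * y) = pabs p x * pabs p y"
proof (cases "x = 0 \<or> y = 0")
  case False
  obtain a b :: int where 1: "a \<noteq> 0" "b \<noteq> 0" "x = of_int a / of_int b"
    using False rat_frac_cases by blast
  obtain c d :: int where 2: "c \<noteq> 0" "d \<noteq> 0" "y = of_int c / of_int d"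
    using False rat_frac_cases by blast
  have pe: "prime_elem (int p)" using p by simp
  have p0: "real p \<noteq> 0" using p by auto
  have "x * y = of_int (a * c) / of_int (b * d)" using 1 2 by simp
  hence "pabs p (x * y)
    = real p powi (int (multiplicity (int p) (b * d)) - int (multiplicity (int p) (a * c)))"
    using pabs_frac[OF p, of "a * c" "b * d"] 1 2 by simp
  thus ?thesis
    using 1 2 pabs_frac[OF p] prime_elem_multiplicity_mult_distrib[OF pe] p0
    by (simp add: power_int_add[symmetric] algebra_simps)
qed auto

lemma pabs_1 [simp]: "pabs p 1 = 1"
  by (simp add: pabs_def)

lemma pabs_minus [simp]: "pabs p (- x) = pabs p x"
proof (cases "x = 0")
  case False
  have "quotient_of (- x) = (- fst (quotient_of x), snd (quotient_of x))"
    by (simp add: rat_uminus_code case_prod_beta Let_def)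
  moreover have "multiplicity (int p) (- k) = multiplicity (int p) k" for k
    by (simp add: multiplicity_def)
  ultimately show ?thesis using False by (simp add: pabs_def)
qed auto

lemma pabs_add_le_max:
  assumes p: "prime p"
  shows "pabs p (x + y) \<le> max (pabs p x) (pabs p y)"
proof (cases "x = 0 \<or> y = 0 \<or> x + y = 0")
  case False
  obtain a b :: int where 1: "a \<noteq> 0" "b \<noteq> 0" "x = of_int a / of_int b"
    using False rat_frac_cases by blast
  obtain c d :: int where 2: "c \<noteq> 0" "d \<noteq> 0" "y = of_int c / of_int d"
    using False rat_frac_cases by blast
  define A B D where "A = a * d" and "B = c * b" and "D = b * d"
  have x: "x = of_int A / of_int D" and y: "y = of_int B / of_int D"
    using 1 2 by (simp_all add: A_def B_def D_def)
  have nz: "A \<noteq> 0" "B \<noteq> 0" "D \<noteq> 0" using 1 2 by (auto simp: A_def B_def D_def)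
  have xy: "x + y = of_int (A + B) / of_int D" using x y by (simp add: add_divide_distrib)
  have AB: "A + B \<noteq> 0" using False xy by auto
  have p1: "\<not> is_unit (int p)" using p by (simp add: prime_nat_iff)
  let ?m = "multiplicity (int p)"
  have "int p ^ min (?m A) (?m B) dvd A + B"
    by (intro dvd_add multiplicity_dvd') auto
  hence "min (?m A) (?m B) \<le> ?m (A + B)"
    using AB p1 by (intro multiplicity_geI) auto
  hence "real p powi (int (?m D) - int (?m (A + B)))
      \<le> real p powi (int (?m D) - int (min (?m A) (?m B)))"
    using p by (intro power_int_increasing) (auto simp: prime_nat_iff)
  also have "\<dots> \<le> max (real p powi (int (?m D) - int (?m A))) (real p powi (int (?m D) - int (?m B)))"
    by (auto simp: min_def)
  finally show ?thesis
    unfolding xy unfolding x y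
    by (simp only: pabs_frac[OF p nz(1) nz(3)] pabs_frac[OF p nz(2) nz(3)] pabs_frac[OF p AB nz(3)])
qed (auto simp: le_max_iff_disj)

lemma pabs_diff_le_max:
  assumes p: "prime p"
  shows "pabs p (x - y) \<le> max (pabs p x) (pabs p y)"
  using pabs_add_le_max[OF p, of x "- y"] by simp

lemma pabs_add_le:
  assumes p: "prime p"
  shows "pabs p (x + y) \<le> pabs p x + pabs p y"
  using pabs_add_le_max[OF p, of x y] pabs_nonneg[of p x] pabs_nonneg[of p y] by linarith

lemma padic_Cauchy_const: "padic_Cauchy p (\<lambda>n. c)"
  by (simp add: padic_Cauchy_def)

lemma padic_Cauchy_add:
  assumes p: "prime p" and s: "padic_Cauchy p s" and t: "padic_Cauchy p t"
  shows "padic_Cauchy p (\<lambda>n. s n + t n)"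
  unfolding padic_Cauchy_def
proof (intro allI impI)
  fix e :: real assume e: "e > 0"
  obtain N where N: "\<forall>m\<ge>N. \<forall>n\<ge>N. pabs p (s m - s n) < e"
    using s e unfolding padic_Cauchy_def by blast
  obtain M where M: "\<forall>m\<ge>M. \<forall>n\<ge>M. pabs p (t m - t n) < e"
    using t e unfolding padic_Cauchy_def by blast
  have "pabs p (s m + t m - (s n + t n)) < e" if "m \<ge> max N M" "n \<ge> max N M" for m n
  proof -
    have "pabs p ((s m - s n) + (t m - t n)) \<le> max (pabs p (s m - s n)) (pabs p (t m - t n))"
      using pabs_add_le_max[OF p] .
    also have "\<dots> < e" using N M that by simp
    finally show ?thesis by (simp add: algebra_simps)
  qed
  thus "\<exists>N. \<forall>m\<ge>N. \<forall>n\<ge>N. pabs p (s m + t m - (s n + t n)) < e" by blast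
qed

lemma padic_Cauchy_minus: "padic_Cauchy p s \<Longrightarrow> padic_Cauchy p (\<lambda>n. - s n)"
  unfolding padic_Cauchy_def
  by (metis minus_diff_eq minus_diff_minus pabs_minus)

lemma padic_Cauchy_bounded:
  assumes p: "prime p" and s: "padic_Cauchy p s"
  obtains B where "B > 0" "\<And>n. pabs p (s n) \<le> B"
proof -
  obtain N where N: "\<forall>m\<ge>N. \<forall>n\<ge>N. pabs p (s m - s n) < 1"
    using s zero_less_one unfolding padic_Cauchy_def by blast
  define B where "B = 1 + (\<Sum>i\<le>N. pabs p (s i))"
  have le: "pabs p (s i) \<le> (\<Sum>i\<le>N. pabs p (s i))" if "i \<le> N" for i
    using that by (intro member_le_sum) auto
  have "pabs p (s n) \<le> B" for n
  proof (cases "n \<le> N")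
    case True thus ?thesis using le[of n] by (simp add: B_def)
  next
    case False
    have "pabs p ((s n - s N) + s N) \<le> pabs p (s n - s N) + pabs p (s N)"
      using pabs_add_le[OF p] .
    also have "\<dots> \<le> B" using N False le[of N] unfolding B_def
      by (intro add_mono) (auto intro: less_imp_le)
    finally show ?thesis by simp
  qed
  moreover have "B > 0" unfolding B_def by (intro add_pos_nonneg sum_nonneg) auto
  ultimately show ?thesis using that by blast
qed

lemma padic_Cauchy_mult:
  assumes p: "prime p" and s: "padic_Cauchy p s" and t: "padic_Cauchy p t"
  shows "padic_Cauchy p (\<lambda>n. s n * t n)"
  unfolding padic_Cauchy_def
proof (intro allI impI)
  fix e :: real assume e: "e > 0"
  obtain B where B: "B > 0" "\<And>n. pabs p (s n) \<le> B" using padic_Cauchy_bounded[OF p s] by blast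
  obtain C where C: "C > 0" "\<And>n. pabs p (t n) \<le> C" using padic_Cauchy_bounded[OF p t] by blast
  obtain N where N: "\<forall>m\<ge>N. \<forall>n\<ge>N. pabs p (s m - s n) < e / C"
    using s e C unfolding padic_Cauchy_def by (meson divide_pos_pos)
  obtain M where M: "\<forall>m\<ge>M. \<forall>n\<ge>M. pabs p (t m - t n) < e / B"
    using t e B unfolding padic_Cauchy_def by (meson divide_pos_pos)
  have "pabs p (s m * t m - s n * t n) < e" if "m \<ge> max N M" "n \<ge> max N M" for m n
  proof -
    have "pabs p (s m * (t m - t n) + (s m - s n) * t n)
        \<le> max (pabs p (s m * (t m - t n))) (pabs p ((s m - s n) * t n))"
      using pabs_add_le_max[OF p] .
    also have "\<dots> \<le> max (B * pabs p (t m - t n)) (pabs p (s m - s n) * C)"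
      unfolding pabs_mult[OF p] using B C by (intro max.mono mult_mono) auto
    also have "\<dots> < e"
      using N M that B(1) C(1) by (simp add: field_simps)
    finally show ?thesis by (simp add: algebra_simps)
  qed
  thus "\<exists>N. \<forall>m\<ge>N. \<forall>n\<ge>N. pabs p (s m * t m - s n * t n) < e" by blast
qed

lemma padic_null_0: "padic_null p (\<lambda>n. 0)"
  by (simp add: padic_null_def)

lemma padic_null_add:
  assumes p: "prime p" and "padic_null p s" "padic_null p t"
  shows "padic_null p (\<lambda>n. s n + t n)"
proof -
  have "(\<lambda>n. pabs p (s n) + pabs p (t n)) \<longlonglongrightarrow> 0"
    using tendsto_add[OF assms(2,3)[unfolded padic_null_def]] by simp
  thus ?thesis unfolding padic_null_def
    by (rule Lim_null_comparison[rotated]) (simp add: pabs_add_le[OF p])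
qed

lemma padic_null_minus: "padic_null p (\<lambda>n. - s n) \<longleftrightarrow> padic_null p s"
  by (simp add: padic_null_def)

lemma padic_null_mult:
  assumes p: "prime p" and "padic_Cauchy p s" "padic_null p t"
  shows "padic_null p (\<lambda>n. s n * t n)"
proof -
  obtain B where B: "B > 0" "\<And>n. pabs p (s n) \<le> B"
    using padic_Cauchy_bounded[OF p assms(2)] by blast
  have "(\<lambda>n. B * pabs p (t n)) \<longlonglongrightarrow> 0"
    using tendsto_mult[OF tendsto_const assms(3)[unfolded padic_null_def]] by simp
  thus ?thesis unfolding padic_null_def
    by (rule Lim_null_comparison[rotated])
       (use B in \<open>auto simp: pabs_mult[OF p] intro!: always_eventually mult_right_mono\<close>)
qed

lemma finite_adele_rep_rat: "finite_adele_rep (\<lambda>p n. q)"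
proof -
  obtain k d where q: "quotient_of q = (k, d)" by (meson surj_pair)
  have d: "d > 0" using q quotient_of_denom_pos by blast
  have e: "q = of_int k / of_int d" using q quotient_of_div by blast
  have "{p. prime p \<and> \<not> padic_integral p (\<lambda>n. q)} \<subseteq> {p. p dvd nat d}"
  proof
    fix p assume "p \<in> {p. prime p \<and> \<not> padic_integral p (\<lambda>n. q)}"
    hence p: "prime p" and n: "\<not> pabs p q \<le> 1" by (auto simp: padic_integral_def)
    have k: "k \<noteq> 0" using n e by auto
    have "\<not> real p powi (int (multiplicity (int p) d) - int (multiplicity (int p) k)) \<le> 1"
      using n pabs_frac[OF p k, of d] d e by simp
    moreover have "real p powi (- int (multiplicity (int p) k)) \<le> 1"
      using prime_ge_1_nat[OF p] by (simp add: power_int_minus inverse_le_1_iff one_le_power)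
    ultimately have "multiplicity (int p) d \<noteq> 0" by (metis diff_0 of_nat_0)
    hence "int p dvd d" by (metis not_dvd_imp_multiplicity_0)
    thus "p \<in> {p. p dvd nat d}" using d by (simp add: int_dvd_int_iff[symmetric])
  qed
  moreover have "finite {p. p dvd nat d}" using d by simp
  ultimately show ?thesis
    unfolding finite_adele_rep_def using finite_subset by (auto simp: padic_Cauchy_const)
qed

lemma finite_adele_rep_add:
  assumes "finite_adele_rep a" "finite_adele_rep b"
  shows "finite_adele_rep (\<lambda>p n. a p n + b p n)"
proof -
  have "padic_integral p (\<lambda>n. a p n + b p n)"
    if p: "prime p" and "padic_integral p (a p)" "padic_integral p (b p)" for p
    using that(2,3) unfolding padic_integral_def
    by eventually_elim (use pabs_add_le_max[OF p] order_trans in fastforce)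
  hence "{p. prime p \<and> \<not> padic_integral p (\<lambda>n. a p n + b p n)}
     \<subseteq> {p. prime p \<and> \<not> padic_integral p (a p)} \<union> {p. prime p \<and> \<not> padic_integral p (b p)}"
    by auto
  thus ?thesis using assms unfolding finite_adele_rep_def
    by (auto intro: padic_Cauchy_add finite_subset)
qed

lemma finite_adele_rep_mult:
  assumes "finite_adele_rep a" "finite_adele_rep b"
  shows "finite_adele_rep (\<lambda>p n. a p n * b p n)"
proof -
  have "padic_integral p (\<lambda>n. a p n * b p n)"
    if p: "prime p" and "padic_integral p (a p)" "padic_integral p (b p)" for p
    using that(2,3) unfolding padic_integral_def
    by eventually_elim (simp add: pabs_mult[OF p] mult_le_one)
  hence "{p. prime p \<and> \<not> padic_integral p (\<lambda>n. a p n * b p n)}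
     \<subseteq> {p. prime p \<and> \<not> padic_integral p (a p)} \<union> {p. prime p \<and> \<not> padic_integral p (b p)}"
    by auto
  thus ?thesis using assms unfolding finite_adele_rep_def
    by (auto intro: padic_Cauchy_mult finite_subset)
qed

lemma finite_adele_rep_minus:
  "finite_adele_rep a \<Longrightarrow> finite_adele_rep (\<lambda>p n. - a p n)"
  unfolding finite_adele_rep_def padic_integral_def by (auto intro: padic_Cauchy_minus)

lemma finite_adele_rel_refl: "finite_adele_rep a \<Longrightarrow> finite_adele_rel a a"
  by (simp add: finite_adele_rel_def padic_null_0)

quotient_type finite_adele = "nat \<Rightarrow> nat \<Rightarrow> rat" / partial: finite_adele_rel
proof (rule part_equivpI)
  show "\<exists>x. finite_adele_rel x x"
    using finite_adele_rel_refl[OF finite_adele_rep_rat] by blast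
  show "symp finite_adele_rel"
  proof (rule sympI)
    fix a b assume "finite_adele_rel a b"
    moreover have "padic_null p (\<lambda>n. b p n - a p n)" if "padic_null p (\<lambda>n. a p n - b p n)" for p
      using that padic_null_minus[of p "\<lambda>n. a p n - b p n"] by simp
    ultimately show "finite_adele_rel b a" by (auto simp: finite_adele_rel_def)
  qed
  show "transp finite_adele_rel"
  proof (rule transpI)
    fix a b c assume "finite_adele_rel a b" "finite_adele_rel b c"
    moreover have "padic_null p (\<lambda>n. a p n - c p n)"
      if "prime p" "padic_null p (\<lambda>n. a p n - b p n)" "padic_null p (\<lambda>n. b p n - c p n)" for p
      using padic_null_add[OF that] by simp
    ultimately show "finite_adele_rel a c" by (auto simp: finite_adele_rel_def)
  qed
qed

instantiation finite_adele :: comm_ring_1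
begin

lift_definition zero_finite_adele :: finite_adele is "\<lambda>p n. 0"
  by (intro finite_adele_rel_refl finite_adele_rep_rat)

lift_definition one_finite_adele :: finite_adele is "\<lambda>p n. 1"
  by (intro finite_adele_rel_refl finite_adele_rep_rat)

lift_definition plus_finite_adele :: "finite_adele \<Rightarrow> finite_adele \<Rightarrow> finite_adele"
  is "\<lambda>a b p n. a p n + b p n"
proof -
  fix a a' b b' assume *: "finite_adele_rel a a'" "finite_adele_rel b b'"
  have "padic_null p (\<lambda>n. a p n + b p n - (a' p n + b' p n))" if p: "prime p" for p
    using padic_null_add[OF p, of "\<lambda>n. a p n - a' p n" "\<lambda>n. b p n - b' p n"] * p
    by (simp add: finite_adele_rel_def algebra_simps)
  thus "finite_adele_rel (\<lambda>p n. a p n + b p n) (\<lambda>p n. a' p n + b' p n)"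
    using * by (simp add: finite_adele_rel_def finite_adele_rep_add)
qed

lift_definition times_finite_adele :: "finite_adele \<Rightarrow> finite_adele \<Rightarrow> finite_adele"
  is "\<lambda>a b p n. a p n * b p n"
proof -
  fix a a' b b' assume *: "finite_adele_rel a a'" "finite_adele_rel b b'"
  have "padic_null p (\<lambda>n. a p n * b p n - a' p n * b' p n)" if p: "prime p" for p
  proof -
    have "padic_null p (\<lambda>n. a p n * (b p n - b' p n) + b' p n * (a p n - a' p n))"
      using * p by (intro padic_null_add padic_null_mult)
        (auto simp: finite_adele_rel_def finite_adele_rep_def)
    thus ?thesis by (simp add: algebra_simps)
  qed
  thus "finite_adele_rel (\<lambda>p n. a p n * b p n) (\<lambda>p n. a' p n * b' p n)"
    using * by (simp add: finite_adele_rel_def finite_adele_rep_mult)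
qed

lift_definition uminus_finite_adele :: "finite_adele \<Rightarrow> finite_adele" is "\<lambda>a p n. - a p n"
proof -
  fix a a' assume *: "finite_adele_rel a a'"
  have "padic_null p (\<lambda>n. - a p n - - a' p n)" if p: "prime p" for p
    using padic_null_minus[of p "\<lambda>n. a p n - a' p n"] * p by (simp add: finite_adele_rel_def)
  thus "finite_adele_rel (\<lambda>p n. - a p n) (\<lambda>p n. - a' p n)"
    using * by (simp add: finite_adele_rel_def finite_adele_rep_minus)
qed

definition minus_finite_adele :: "finite_adele \<Rightarrow> finite_adele \<Rightarrow> finite_adele" where
  "minus_finite_adele a b = a + - b"

instance
proof
  fix a b c :: finite_adele
  note simps = finite_adele_rel_def padic_null_0 finite_adele_rep_add finite_adele_rep_mult
    finite_adele_rep_minus finite_adele_rep_rat algebra_simps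
  show "a + b + c = a + (b + c)" by transfer (simp add: simps)
  show "a + b = b + a" by transfer (simp add: simps)
  show "0 + a = a" by transfer (simp add: simps)
  show "- a + a = 0" by transfer (simp add: simps)
  show "a - b = a + - b" by (simp add: minus_finite_adele_def)
  show "a * b * c = a * (b * c)" by transfer (simp add: simps)
  show "a * b = b * a" by transfer (simp add: simps)
  show "1 * a = a" by transfer (simp add: simps)
  show "(a + b) * c = a * c + b * c" by transfer (simp add: simps)
  show "(0::finite_adele) \<noteq> 1"
  proof (transfer, rule notI)
    assume "finite_adele_rel (\<lambda>p n. 0) (\<lambda>p n. 1)"
    hence "padic_null 2 (\<lambda>n. - 1)" unfolding finite_adele_rel_def using two_is_prime_nat by auto
    thus False by (simp add: padic_null_def LIMSEQ_const_iff)
  qed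
qed

end

lift_definition local_norm :: "nat \<Rightarrow> finite_adele \<Rightarrow> real"
  is "\<lambda>p a. if prime p then lim (\<lambda>n. pabs p (a p n)) else 0"
proof -
  fix p a b assume *: "finite_adele_rel a b"
  show "(if prime p then lim (\<lambda>n. pabs p (a p n)) else 0)
      = (if prime p then lim (\<lambda>n. pabs p (b p n)) else 0)"
  proof (cases "prime p")
    case True
    have 0: "(\<lambda>n. pabs p (a p n - b p n)) \<longlonglongrightarrow> 0"
      using * True by (simp add: finite_adele_rel_def padic_null_def)
    have le: "\<bar>pabs p (a p n) - pabs p (b p n)\<bar> \<le> pabs p (a p n - b p n)" for n
      using pabs_add_le[OF True, of "a p n - b p n" "b p n"]
        pabs_add_le[OF True, of "b p n - a p n" "a p n"] pabs_minus[of p "a p n - b p n"] by simp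
    have d: "(\<lambda>n. pabs p (a p n) - pabs p (b p n)) \<longlonglongrightarrow> 0"
      by (rule Lim_null_comparison[OF _ 0]) (simp add: le)
    have "(\<lambda>n. pabs p (a p n)) \<longlonglongrightarrow> L \<longleftrightarrow> (\<lambda>n. pabs p (b p n)) \<longlonglongrightarrow> L" for L
      using tendsto_diff[of "\<lambda>n. pabs p (a p n)" L sequentially, OF _ d]
        tendsto_add[of "\<lambda>n. pabs p (b p n)" L sequentially, OF _ d] by auto
    thus ?thesis by (simp add: lim_def)
  qed simp
qed

text \<open>The restricted product topology: the sets
  \<open>a + (\<Prod>p\<in>S. {z. \<bar>z\<bar>\<^sub>p < e} \<inter> \<int>\<^sub>p) \<times> (\<Prod>p\<notin>S. \<int>\<^sub>p)\<close> with \<open>S\<close> a finite set of primes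
  and \<open>e > 0\<close> form a basis of neighbourhoods of \<open>a\<close>.\<close>

instantiation finite_adele :: topological_space
begin

definition open_finite_adele :: "finite_adele set \<Rightarrow> bool" where
  "open_finite_adele U \<longleftrightarrow>
     (\<forall>a\<in>U. \<exists>S e. finite S \<and> e > 0 \<and>
        {b. (\<forall>p. prime p \<longrightarrow> local_norm p (b - a) \<le> 1) \<and>
            (\<forall>p\<in>S. prime p \<longrightarrow> local_norm p (b - a) < e)} \<subseteq> U)"

instance
proof
  show "open (UNIV :: finite_adele set)"
    unfolding open_finite_adele_def by (auto intro: exI[of _ "{}"] exI[of _ 1])
  show "open (U \<inter> V)" if UV: "open U" "open V" for U V :: "finite_adele set"
    unfolding open_finite_adele_def
  proof
    fix a assume a: "a \<in> U \<inter> V"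
    obtain S e where 1: "finite S" "e > 0"
      "{b. (\<forall>p. prime p \<longrightarrow> local_norm p (b - a) \<le> 1) \<and>
            (\<forall>p\<in>S. prime p \<longrightarrow> local_norm p (b - a) < e)} \<subseteq> U"
      using UV(1) a unfolding open_finite_adele_def by blast
    obtain T d where 2: "finite T" "d > 0"
      "{b. (\<forall>p. prime p \<longrightarrow> local_norm p (b - a) \<le> 1) \<and>
            (\<forall>p\<in>T. prime p \<longrightarrow> local_norm p (b - a) < d)} \<subseteq> V"
      using UV(2) a unfolding open_finite_adele_def by blast
    show "\<exists>S e. finite S \<and> e > 0 \<and>
        {b. (\<forall>p. prime p \<longrightarrow> local_norm p (b - a) \<le> 1) \<and>
            (\<forall>p\<in>S. prime p \<longrightarrow> local_norm p (b - a) < e)} \<subseteq> U \<inter> V"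
      by (rule exI[of _ "S \<union> T"], rule exI[of _ "min e d"]) (use 1 2 in auto)
  qed
  show "open (\<Union>K)" if K: "\<forall>U\<in>K. open U" for K :: "finite_adele set set"
    unfolding open_finite_adele_def
  proof
    fix a assume "a \<in> \<Union>K"
    then obtain U where U: "U \<in> K" "a \<in> U" by blast
    obtain S e where "finite S" "e > 0"
      "{b. (\<forall>p. prime p \<longrightarrow> local_norm p (b - a) \<le> 1) \<and>
            (\<forall>p\<in>S. prime p \<longrightarrow> local_norm p (b - a) < e)} \<subseteq> U"
      using K U unfolding open_finite_adele_def by meson
    moreover have "U \<subseteq> \<Union>K" using U by blast
    ultimately show "\<exists>S e. finite S \<and> e > 0 \<and>
        {b. (\<forall>p. prime p \<longrightarrow> local_norm p (b - a) \<le> 1) \<and>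
            (\<forall>p\<in>S. prime p \<longrightarrow> local_norm p (b - a) < e)} \<subseteq> \<Union>K"
      by (meson subset_trans)
  qed
qed

end

lift_definition finite_adele_of_rat :: "rat \<Rightarrow> finite_adele" is "\<lambda>q p n. q"
  by (intro finite_adele_rel_refl finite_adele_rep_rat)

instantiation prod :: (one, one) one
begin
definition one_prod :: "'a \<times> 'b" where "one_prod = (1, 1)"
instance ..
end

instantiation prod :: (times, times) times
begin
definition times_prod :: "'a \<times> 'b \<Rightarrow> 'a \<times> 'b \<Rightarrow> 'a \<times> 'b" where
  "times_prod x y = (fst x * fst y, snd x * snd y)"
instance ..
end

instance prod :: (comm_ring_1, comm_ring_1) comm_ring_1
  by standard (auto simp: times_prod_def one_prod_def prod_eq_iff algebra_simps)

type_synonym adele = "finite_adele \<times> real"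

definition adele_of_rat :: "rat \<Rightarrow> adele" where
  "adele_of_rat q = (finite_adele_of_rat q, of_rat q)"


section \<open>The space \<open>V\<close> and the action of \<open>P\<^sub>+(\<real>)\<close>\<close>

definition aff :: "'a \<Rightarrow> 'a \<Rightarrow> 'a::comm_ring_1^2^2" where
  "aff a b = vector [vector [a, b], vector [0, 1]]"

definition P_bar :: "('a::comm_ring_1^2^2) set" where
  "P_bar = {aff a b | a b. True}"

definition P_group :: "('a::comm_ring_1^2^2) set" where
  "P_group = {aff a b | a b. a dvd 1}"

definition P_plus :: "(real^2^2) set" where
  "P_plus = {aff a b | a b. a > 0}"

definition rational_mat :: "rat^2^2 \<Rightarrow> adele^2^2" where
  "rational_mat g = (\<chi> i j. adele_of_rat (g $ i $ j))"

text \<open>A real matrix placed at the archimedean place, with the identity at the finite places.\<close>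

definition arch_mat :: "real^2^2 \<Rightarrow> adele^2^2" where
  "arch_mat h = (\<chi> i j. ((mat 1 :: finite_adele^2^2) $ i $ j, h $ i $ j))"

type_synonym adele_class = "(adele^2^2) set"

definition class_of :: "adele^2^2 \<Rightarrow> adele_class" where
  "class_of m = {rational_mat g ** m | g. g \<in> P_group}"

definition class_topology :: "adele_class topology" where
  "class_topology = topology (\<lambda>U. U \<subseteq> class_of ` P_bar \<and>
     openin (top_of_set P_bar) {m \<in> P_bar. class_of m \<in> U})"

definition V_space :: "adele_class set" where
  "V_space = {class_of (aff y x) | y x. fst y \<noteq> 0 \<and> snd y \<noteq> 0}"

definition right_act :: "adele_class \<Rightarrow> real^2^2 \<Rightarrow> adele_class" where
  "right_act c h = (\<lambda>m. m ** arch_mat h) ` c"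

definition free_right_action :: "(real^2^2) set \<Rightarrow> 'm set \<Rightarrow> ('m \<Rightarrow> real^2^2 \<Rightarrow> 'm) \<Rightarrow> bool" where
  "free_right_action G S act \<longleftrightarrow>
     (\<forall>c\<in>S. \<forall>h\<in>G. act c h \<in> S) \<and>
     (\<forall>c\<in>S. act c (mat 1) = c) \<and>
     (\<forall>c\<in>S. \<forall>h\<in>G. \<forall>k\<in>G. act (act c h) k = act c (h ** k)) \<and>
     (\<forall>c\<in>S. \<forall>h\<in>G. act c h = c \<longrightarrow> h = mat 1)"

definition orbit_of :: "adele_class \<Rightarrow> adele_class set" where
  "orbit_of c = right_act c ` P_plus"

definition matrix_exp :: "real^2^2 \<Rightarrow> real^2^2" where
  "matrix_exp M = (\<Sum>n. (1 / fact n) *\<^sub>R (((\<lambda>B. M ** B) ^^ n) (mat 1)))"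

definition gen_X :: "real^2^2" where
  "gen_X = vector [vector [0, 1], vector [0, 0]]"

definition gen_Y :: "real^2^2" where
  "gen_Y = vector [vector [1, 0], vector [0, 0]]"

definition flow :: "real^2^2 \<Rightarrow> adele_class \<Rightarrow> real \<Rightarrow> adele_class" where
  "flow \<xi> c t = right_act c (matrix_exp (t *\<^sub>R \<xi>))"

definition along :: "real^2^2 \<Rightarrow> (adele_class \<Rightarrow> 'b::real_normed_vector) \<Rightarrow> adele_class \<Rightarrow> 'b" where
  "along \<xi> f c = vector_derivative (\<lambda>t. f (flow \<xi> c t)) (at 0)"

abbreviation X_op :: "(adele_class \<Rightarrow> complex) \<Rightarrow> adele_class \<Rightarrow> complex" where
  "X_op \<equiv> along gen_X"

abbreviation Y_op :: "(adele_class \<Rightarrow> complex) \<Rightarrow> adele_class \<Rightarrow> complex" where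
  "Y_op \<equiv> along gen_Y"


section \<open>Surfaces\<close>

primrec times_differentiable_on ::
  "nat \<Rightarrow> ('a::real_normed_vector \<Rightarrow> 'b::real_normed_vector) \<Rightarrow> 'a set \<Rightarrow> bool" where
  "times_differentiable_on 0 f S \<longleftrightarrow> continuous_on S f"
| "times_differentiable_on (Suc n) f S \<longleftrightarrow>
     (\<forall>x\<in>S. f differentiable (at x)) \<and>
     (\<forall>v. times_differentiable_on n (\<lambda>x. frechet_derivative f (at x) v) S)"

text \<open>Only meant for open \<open>S\<close>.\<close>

definition smooth_on ::
  "('a::real_normed_vector \<Rightarrow> 'b::real_normed_vector) \<Rightarrow> 'a set \<Rightarrow> bool" where
  "smooth_on f S \<longleftrightarrow> (\<forall>n. times_differentiable_on n f S)"

text \<open>The model plane \<open>\<real>\<^sup>2\<close> is taken to be \<^typ>\<open>complex\<close>. The parameter \<open>R\<close> of an atlas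
  (\<^const>\<open>smooth_on\<close> or \<^const>\<open>holomorphic_on\<close>) says which transition maps are admitted.
  Chart maps are \<^const>\<open>undefined\<close> outside their domains, so that a maximal atlas can be unique.\<close>

type_synonym 'm chart = "'m set \<times> ('m \<Rightarrow> complex)"

definition points :: "'m chart set \<Rightarrow> 'm set" where
  "points A = (\<Union>(U, \<phi>)\<in>A. U)"

definition is_atlas ::
  "((complex \<Rightarrow> complex) \<Rightarrow> complex set \<Rightarrow> bool) \<Rightarrow> 'm chart set \<Rightarrow> bool" where
  "is_atlas R A \<longleftrightarrow>
     (\<forall>(U, \<phi>)\<in>A. inj_on \<phi> U \<and> \<phi> \<in> extensional U) \<and>
     (\<forall>(U, \<phi>)\<in>A. \<forall>(W, \<psi>)\<in>A.
        open (\<phi> ` (U \<inter> W)) \<and> R (\<psi> \<circ> inv_into U \<phi>) (\<phi> ` (U \<inter> W)))"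

definition surface_topology :: "'m chart set \<Rightarrow> 'm topology" where
  "surface_topology A =
     topology (\<lambda>W. W \<subseteq> points A \<and> (\<forall>(U, \<phi>)\<in>A. open (\<phi> ` (U \<inter> W))))"

definition smooth_surface :: "'m chart set \<Rightarrow> bool" where
  "smooth_surface A \<longleftrightarrow> is_atlas smooth_on A \<and>
     Hausdorff_space (surface_topology A) \<and> second_countable (surface_topology A)"

definition smooth_fun :: "'m chart set \<Rightarrow> 'm set \<Rightarrow> ('m \<Rightarrow> 'b::real_normed_vector) \<Rightarrow> bool" where
  "smooth_fun A W f \<longleftrightarrow> (\<forall>(U, \<phi>)\<in>A. smooth_on (f \<circ> inv_into U \<phi>) (\<phi> ` (U \<inter> W)))"

definition surface_iso ::
  "((complex \<Rightarrow> complex) \<Rightarrow> complex set \<Rightarrow> bool) \<Rightarrow> 'm chart set \<Rightarrow> 'n chart set \<Rightarrow> ('m \<Rightarrow> 'n) \<Rightarrow> bool"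
  where
  "surface_iso R A B F \<longleftrightarrow> bij_betw F (points A) (points B) \<and>
     (\<forall>(U, \<phi>)\<in>A. \<forall>(W, \<psi>)\<in>B.
        open (\<phi> ` {c \<in> U. F c \<in> W}) \<and> open (\<psi> ` (F ` U \<inter> W)) \<and>
        R (\<psi> \<circ> F \<circ> inv_into U \<phi>) (\<phi> ` {c \<in> U. F c \<in> W}) \<and>
        R (\<phi> \<circ> inv_into (points A) F \<circ> inv_into W \<psi>) (\<psi> ` (F ` U \<inter> W)))"

text \<open>Tangent vectors at \<open>c\<close> are velocities of smooth curves through \<open>c\<close>, viewed as functionals on
  the real functions that are smooth near \<open>c\<close> (with value 0 on all other functions).\<close>

type_synonym 'm tangent = "('m \<Rightarrow> real) \<Rightarrow> real"

definition smooth_curve :: "'m chart set \<Rightarrow> (real \<Rightarrow> 'm) \<Rightarrow> bool" where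
  "smooth_curve A \<gamma> \<longleftrightarrow>
     (\<exists>(U, \<phi>)\<in>A. \<exists>e>0. \<gamma> ` {-e<..<e} \<subseteq> U \<and> smooth_on (\<phi> \<circ> \<gamma>) {-e<..<e})"

definition velocity :: "'m chart set \<Rightarrow> (real \<Rightarrow> 'm) \<Rightarrow> 'm tangent" where
  "velocity A \<gamma> f =
     (if \<exists>W. openin (surface_topology A) W \<and> \<gamma> 0 \<in> W \<and> smooth_fun A W f
      then vector_derivative (f \<circ> \<gamma>) (at 0) else 0)"

definition tangent_space :: "'m chart set \<Rightarrow> 'm \<Rightarrow> 'm tangent set" where
  "tangent_space A c = {velocity A \<gamma> | \<gamma>. smooth_curve A \<gamma> \<and> \<gamma> 0 = c}"

definition lincomb :: "real \<Rightarrow> 'm tangent \<Rightarrow> real \<Rightarrow> 'm tangent \<Rightarrow> 'm tangent" where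
  "lincomb a u b v = (\<lambda>f. a * u f + b * v f)"

definition pushforward :: "('m \<Rightarrow> 'n) \<Rightarrow> 'm tangent \<Rightarrow> 'n tangent" where
  "pushforward F u = (\<lambda>f. u (f \<circ> F))"

text \<open>The coordinate vector in the direction \<open>v\<close>: \<open>\<partial>\<^sub>x\<close> for \<open>v = 1\<close> and \<open>\<partial>\<^sub>y\<close> for \<open>v = \<i>\<close>.\<close>

definition coord_vec :: "'m chart set \<Rightarrow> 'm chart \<Rightarrow> complex \<Rightarrow> 'm \<Rightarrow> 'm tangent" where
  "coord_vec A ch v c =
     velocity A (\<lambda>t. inv_into (fst ch) (snd ch) (snd ch c + of_real t * v))"

type_synonym 'm metric = "'m \<Rightarrow> 'm tangent \<Rightarrow> 'm tangent \<Rightarrow> real"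

text \<open>A metric is made 0 on junk arguments, so that it can be unique.\<close>

definition riemannian_metric :: "'m chart set \<Rightarrow> 'm metric \<Rightarrow> bool" where
  "riemannian_metric A g \<longleftrightarrow>
     (\<forall>c u v. \<not> (c \<in> points A \<and> u \<in> tangent_space A c \<and> v \<in> tangent_space A c) \<longrightarrow> g c u v = 0) \<and>
     (\<forall>c\<in>points A. \<forall>u\<in>tangent_space A c. \<forall>v\<in>tangent_space A c. g c u v = g c v u) \<and>
     (\<forall>c\<in>points A. \<forall>u\<in>tangent_space A c. \<forall>v\<in>tangent_space A c. \<forall>w\<in>tangent_space A c. \<forall>a b.
        g c (lincomb a u b v) w = a * g c u w + b * g c v w) \<and>
     (\<forall>c\<in>points A. \<forall>u\<in>tangent_space A c. u \<noteq> (\<lambda>f. 0) \<longrightarrow> g c u u > 0) \<and>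
     (\<forall>(U, \<phi>)\<in>A. \<forall>v w.
        smooth_on ((\<lambda>c. g c (coord_vec A (U, \<phi>) v c) (coord_vec A (U, \<phi>) w c)) \<circ> inv_into U \<phi>)
          (\<phi> ` U))"

definition orthonormal_basis ::
  "'m tangent set \<Rightarrow> ('m tangent \<Rightarrow> 'm tangent \<Rightarrow> real) \<Rightarrow> 'm tangent \<Rightarrow> 'm tangent \<Rightarrow> bool" where
  "orthonormal_basis T b u v \<longleftrightarrow>
     u \<in> T \<and> v \<in> T \<and> b u u = 1 \<and> b v v = 1 \<and> b u v = 0 \<and> (\<forall>w\<in>T. \<exists>r s. w = lincomb r u s v)"

definition complex_structure :: "'m chart set \<Rightarrow> 'm chart set \<Rightarrow> bool" where
  "complex_structure A C \<longleftrightarrow>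
     is_atlas (holomorphic_on) C \<and> points C = points A \<and> is_atlas smooth_on (A \<union> C) \<and>
     (\<forall>U \<phi>. U \<subseteq> points A \<longrightarrow> is_atlas (holomorphic_on) (insert (U, \<phi>) C) \<longrightarrow> (U, \<phi>) \<in> C)"

definition partial :: "complex \<Rightarrow> (complex \<Rightarrow> 'b::real_normed_vector) \<Rightarrow> complex \<Rightarrow> 'b" where
  "partial v h z = vector_derivative (\<lambda>t. h (z + of_real t * v)) (at 0)"

text \<open>The \<open>(0,1)\<close>-part of \<open>df\<close> vanishes on \<open>W\<close>: in each holomorphic coordinate \<open>x + \<i> y\<close> the
  derivative \<open>(\<partial>\<^sub>x + \<i> \<partial>\<^sub>y) f / 2\<close> is 0.\<close>

definition dbar_vanishes :: "'m chart set \<Rightarrow> 'm set \<Rightarrow> ('m \<Rightarrow> complex) \<Rightarrow> bool" where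
  "dbar_vanishes C W f \<longleftrightarrow>
     (\<forall>(U, \<phi>)\<in>C. \<forall>z\<in>\<phi> ` (U \<inter> W).
        (partial 1 (f \<circ> inv_into U \<phi>) z + \<i> * partial \<i> (f \<circ> inv_into U \<phi>) z) / 2 = 0)"

definition gram :: "'m chart set \<Rightarrow> 'm metric \<Rightarrow> 'm chart \<Rightarrow> complex \<Rightarrow> complex \<Rightarrow> complex \<Rightarrow> real" where
  "gram A g ch v w z =
     (let c = inv_into (fst ch) (snd ch) z in g c (coord_vec A ch v c) (coord_vec A ch w c))"

definition vol_density :: "'m chart set \<Rightarrow> 'm metric \<Rightarrow> 'm chart \<Rightarrow> complex \<Rightarrow> real" where
  "vol_density A g ch z =
     sqrt (gram A g ch 1 1 z * gram A g ch \<i> \<i> z - (gram A g ch 1 \<i> z)\<^sup>2)"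

definition riemannian_volume :: "'m chart set \<Rightarrow> 'm metric \<Rightarrow> 'm measure \<Rightarrow> bool" where
  "riemannian_volume A g \<mu> \<longleftrightarrow>
     space \<mu> = points A \<and>
     sets \<mu> = sigma_sets (points A) {W. openin (surface_topology A) W} \<and>
     (\<forall>(U, \<phi>)\<in>A. \<forall>B\<in>sets \<mu>. B \<subseteq> U \<longrightarrow>
        emeasure \<mu> B = (\<integral>\<^sup>+z\<in>\<phi> ` B. ennreal (vol_density A g (U, \<phi>) z) \<partial>lborel))"

text \<open>In local coordinates \<open>\<Delta>f = det(g)\<^sup>-\<^sup>1\<^sup>/\<^sup>2 \<Sum> \<partial>\<^sub>i (det(g)\<^sup>1\<^sup>/\<^sup>2 g\<^sup>i\<^sup>j \<partial>\<^sub>j f)\<close>, with the inverse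
  matrix \<open>g\<^sup>i\<^sup>j\<close> written out by cofactors.\<close>

definition laplace_beltrami ::
  "'m chart set \<Rightarrow> 'm metric \<Rightarrow> 'm chart \<Rightarrow> ('m \<Rightarrow> complex) \<Rightarrow> 'm \<Rightarrow> complex" where
  "laplace_beltrami A g ch f c =
     (let h = f \<circ> inv_into (fst ch) (snd ch);
          E = gram A g ch 1 1; F = gram A g ch 1 \<i>; G = gram A g ch \<i> \<i>;
          r = vol_density A g ch
      in (1 / r (snd ch c)) *\<^sub>R
         (partial 1 (\<lambda>z. (G z / r z) *\<^sub>R partial 1 h z - (F z / r z) *\<^sub>R partial \<i> h z) (snd ch c)
        + partial \<i> (\<lambda>z. (E z / r z) *\<^sub>R partial \<i> h z - (F z / r z) *\<^sub>R partial 1 h z) (snd ch c)))"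

definition compact_support :: "'m chart set \<Rightarrow> ('m \<Rightarrow> complex) \<Rightarrow> bool" where
  "compact_support A f \<longleftrightarrow>
     (\<exists>K. compactin (surface_topology A) K \<and> (\<forall>c\<in>points A - K. f c = 0))"

text \<open>The formal adjoint in \<open>L\<^sup>2(\<mu>)\<close> of an operator on smooth functions.\<close>

definition formal_adjoint ::
  "'m chart set \<Rightarrow> 'm measure \<Rightarrow>
   (('m \<Rightarrow> complex) \<Rightarrow> 'm \<Rightarrow> complex) \<Rightarrow> (('m \<Rightarrow> complex) \<Rightarrow> 'm \<Rightarrow> complex) \<Rightarrow> bool" where
  "formal_adjoint A \<mu> D D' \<longleftrightarrow>
     (\<forall>h. smooth_fun A (points A) h \<longrightarrow> smooth_fun A (points A) (D' h)) \<and>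
     (\<forall>f h. smooth_fun A (points A) f \<and> compact_support A f \<and> smooth_fun A (points A) h \<longrightarrow>
        (\<integral>c. D f c * cnj (h c) \<partial>\<mu>) = (\<integral>c. f c * cnj (D' h c) \<partial>\<mu>))"

definition upper_half_plane :: "complex set" where
  "upper_half_plane = {z. Im z > 0}"

definition half_plane_atlas :: "complex chart set" where
  "half_plane_atlas = {(upper_half_plane, restrict id upper_half_plane)}"

definition poincare_metric :: "complex metric" where
  "poincare_metric z u v = (u Re * v Re + u Im * v Im) / (Im z)\<^sup>2"


section \<open>The geometry of an orbit\<close>

text \<open>The smooth structure of an orbit is the one that makes the orbit maps \<open>h \<mapsto> c h\<close>
  diffeomorphisms from the open set \<open>P\<^sub>+(\<real>)\<close> of pairs \<open>(a, b)\<close>, \<open>a > 0\<close>; its topology need not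
  be the subspace topology from \<open>V\<close>. The pair \<open>(a, b)\<close> is recorded as \<open>b + \<i> a\<close>, which here only serves as a point
  of the model plane.\<close>

definition orbit_atlas :: "adele_class set \<Rightarrow> adele_class chart set" where
  "orbit_atlas Q =
     {(Q, restrict (inv_into upper_half_plane (\<lambda>z. right_act c (aff (Im z) (Re z)))) Q) | c. c \<in> Q}"

definition X_vec :: "adele_class set \<Rightarrow> adele_class \<Rightarrow> adele_class tangent" where
  "X_vec Q c = velocity (orbit_atlas Q) (flow gen_X c)"

definition Y_vec :: "adele_class set \<Rightarrow> adele_class \<Rightarrow> adele_class tangent" where
  "Y_vec Q c = velocity (orbit_atlas Q) (flow gen_Y c)"

definition orbit_metric :: "adele_class set \<Rightarrow> adele_class metric \<Rightarrow> bool" where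
  "orbit_metric Q g \<longleftrightarrow> riemannian_metric (orbit_atlas Q) g \<and>
     (\<forall>c\<in>Q. orthonormal_basis (tangent_space (orbit_atlas Q) c) (g c) (X_vec Q c) (Y_vec Q c))"

definition dbar_op :: "(adele_class \<Rightarrow> complex) \<Rightarrow> adele_class \<Rightarrow> complex" where
  "dbar_op f c = X_op f c + \<i> * Y_op f c"

definition orbit_complex_structure :: "adele_class set \<Rightarrow> adele_class chart set \<Rightarrow> bool" where
  "orbit_complex_structure Q C \<longleftrightarrow> complex_structure (orbit_atlas Q) C \<and>
     (\<forall>W f. openin (surface_topology (orbit_atlas Q)) W \<and> smooth_fun (orbit_atlas Q) W f \<longrightarrow>
        (dbar_vanishes C W f \<longleftrightarrow> (\<forall>c\<in>W. dbar_op f c = 0)))"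

definition Y_half :: "(adele_class \<Rightarrow> complex) \<Rightarrow> adele_class \<Rightarrow> complex" where
  "Y_half f c = Y_op f c - f c / 2"

end

theory Submission
  imports Defs "HOL-Complex_Analysis.Conformal_Mappings"
begin

text \<open>
  An element of \<open>P\<^sub>+(\<real>)\<close> that fixes a class of \<open>V\<close> acts like a rational matrix acting from the left. At the finite
  places it acts trivially, and this forces the rational matrix to be 1, because a nonzero rational number
  is a unit of the finite adeles and \<open>y\<^sub>f\<close> is not 0. Hence the action is free
  (\<open>right_act_fixed_imp_trivial\<close>). The space \<open>V\<close> is open because a nonzero finite adele has a component of positive
  absolute value (\<open>ex_local_norm_pos\<close>). By freeness an orbit with a chosen base point is a copy of the upper half plane, the
  group element \<open>(a, b)\<close> being the point \<open>z = b + \<i> a\<close>. Another base point changes \<open>z\<close> by a real affine map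
  \<open>z \<mapsto> a z + b\<close>, \<open>a > 0\<close> (\<open>parametrized_orbit_orbit_map\<close>). So every statement about an orbit becomes a computation in
  one coordinate \<open>z = x + \<i> y\<close>, in which the flows of the generators are \<open>x + t y\<close> and \<open>e\<^sup>t y\<close>, that is,
  \<open>X = y \<partial>\<^sub>x\<close> and \<open>Y = y \<partial>\<^sub>y\<close> (\<open>X_Y_op_eq\<close>).

  The metric with orthonormal fields \<open>X, Y\<close> is therefore \<open>(dx\<^sup>2 + dy\<^sup>2) / y\<^sup>2\<close>, and \<open>X + \<i> Y = y (\<partial>\<^sub>x + \<i> \<partial>\<^sub>y)\<close> is the
  Cauchy-Riemann operator up to the factor \<open>y\<close>. This gives existence of both structures. The metric is unique
  by bilinearity (\<open>orbit_metric_unique\<close>). The complex structure is unique because its charts are annihilated by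
  its own \<open>\<partial>\<close>-bar, hence by \<open>X + \<i> Y\<close>, hence are holomorphic in \<open>z\<close> (\<open>orbit_complex_structure_unique\<close>).

  Integration by parts against \<open>dx dy / y\<^sup>2\<close> shows that \<open>h \<mapsto> - X h + \<i> Y h - \<i> h\<close> is a formal adjoint of \<open>X + \<i> Y\<close>
  (\<open>dbar_integration_by_parts\<close>), and testing with bump functions shows that it is the only one on smooth functions
  (\<open>formal_adjoint_unique\<close>). By \<open>[Y, X] = X\<close>, a consequence of the symmetry of second derivatives, minus its
  composition with \<open>X + \<i> Y\<close> is \<open>X\<^sup>2 + Y\<^sup>2 - Y = X\<^sup>2 + (Y - 1/2)\<^sup>2 - 1/4 = y\<^sup>2 (\<partial>\<^sub>x\<^sup>2 + \<partial>\<^sub>y\<^sup>2)\<close>.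
\<close>


section \<open>Calculus of smooth maps\<close>

lemma times_differentiable_on_cong:
  assumes "open S" "times_differentiable_on n f S" "\<And>x. x \<in> S \<Longrightarrow> f x = g x"
  shows "times_differentiable_on n g S"
  using assms(2,3)
proof (induction n arbitrary: f g)
  case 0
  then show ?case by (auto cong: continuous_on_cong)
next
  case (Suc n)
  have "g differentiable (at x) \<and> frechet_derivative f (at x) = frechet_derivative g (at x)"
    if "x \<in> S" for x
  proof -
    have "(f has_derivative frechet_derivative f (at x)) (at x)"
      using Suc.prems(1) that frechet_derivative_works by auto
    hence "(g has_derivative frechet_derivative f (at x)) (at x)"
      using has_derivative_transform_within_open[OF _ assms(1) that] Suc.prems(2) by blast
    thus ?thesis using frechet_derivative_at differentiableI by blast
  qed
  moreover have "times_differentiable_on n (\<lambda>x. frechet_derivative g (at x) v) S" for v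
    by (rule Suc.IH[of "\<lambda>x. frechet_derivative f (at x) v"]) (use Suc.prems(1) calculation in auto)
  ultimately show ?case by simp
qed

lemma times_differentiable_on_subset:
  "times_differentiable_on n f S \<Longrightarrow> T \<subseteq> S \<Longrightarrow> times_differentiable_on n f T"
  by (induction n arbitrary: f) (auto intro: continuous_on_subset)

text \<open>A function that is differentiable \<open>n + 1\<close> times loses nothing at order \<open>n\<close>; the product and chain
rules need this because their right hand sides mix a function with its derivative.\<close>

lemma times_differentiable_on_SucD:
  "times_differentiable_on (Suc n) f S \<Longrightarrow> times_differentiable_on n f S"
proof (induction n arbitrary: f)
  case 0
  then show ?case
    by (auto intro!: continuous_at_imp_continuous_on differentiable_imp_continuous_within)
next
  case (Suc n)
  show ?case
    unfolding times_differentiable_on.simps(2)[of n]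
    using Suc.prems Suc.IH unfolding times_differentiable_on.simps(2)[of "Suc n"] by blast
qed

lemma times_differentiable_on_SucI:
  assumes "open S" "\<And>x. x \<in> S \<Longrightarrow> (f has_derivative f' x) (at x)"
    "\<And>v. times_differentiable_on n (\<lambda>x. f' x v) S"
  shows "times_differentiable_on (Suc n) f S"
proof -
  have "f' x = frechet_derivative f (at x)" if "x \<in> S" for x
    using assms(2)[OF that] by (rule frechet_derivative_at)
  hence "times_differentiable_on n (\<lambda>x. frechet_derivative f (at x) v) S" for v
    by (intro times_differentiable_on_cong[OF assms(1) assms(3)[of v]]) simp
  thus ?thesis using assms(2) by (auto intro: differentiableI)
qed

lemma times_differentiable_on_Suc_derivative:
  assumes "times_differentiable_on (Suc n) f S" "x \<in> S"
  shows "(f has_derivative frechet_derivative f (at x)) (at x)"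
  using assms frechet_derivative_works by auto

lemma times_differentiable_on_const: "open S \<Longrightarrow> times_differentiable_on n (\<lambda>x. c) S"
proof (induction n arbitrary: c)
  case (Suc n)
  show ?case
    by (rule times_differentiable_on_SucI[where f' = "\<lambda>x v. 0"]) (use Suc in auto)
qed simp

lemma times_differentiable_on_bounded_linear:
  assumes "bounded_linear L" "open S" "times_differentiable_on n f S"
  shows "times_differentiable_on n (\<lambda>x. L (f x)) S"
  using assms(3)
proof (induction n arbitrary: f)
  case 0
  then show ?case by (simp add: bounded_linear.continuous_on[OF assms(1)])
next
  case (Suc n)
  show ?case
  proof (rule times_differentiable_on_SucI[OF assms(2)])
    show "((\<lambda>x. L (f x)) has_derivative (\<lambda>v. L (frechet_derivative f (at x) v))) (at x)"
      if "x \<in> S" for x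
      by (rule bounded_linear.has_derivative[OF assms(1)
            times_differentiable_on_Suc_derivative[OF Suc.prems that]])
    show "times_differentiable_on n (\<lambda>x. L (frechet_derivative f (at x) v)) S" for v
      using Suc by simp
  qed
qed

lemma times_differentiable_on_id: "open S \<Longrightarrow> times_differentiable_on n (\<lambda>x. x) S"
proof (cases n)
  case (Suc m)
  assume "open S"
  then show ?thesis unfolding Suc
    by (intro times_differentiable_on_SucI[where f' = "\<lambda>x v. v"])
       (auto simp: times_differentiable_on_const)
qed simp

lemma times_differentiable_on_add:
  assumes "open S" "times_differentiable_on n f S" "times_differentiable_on n g S"
  shows "times_differentiable_on n (\<lambda>x. f x + g x) S"
  using assms(2,3)
proof (induction n arbitrary: f g)
  case 0
  then show ?case by (simp add: continuous_on_add)
next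
  case (Suc n)
  show ?case
  proof (rule times_differentiable_on_SucI[OF assms(1)])
    show "((\<lambda>x. f x + g x) has_derivative
        (\<lambda>v. frechet_derivative f (at x) v + frechet_derivative g (at x) v)) (at x)"
      if "x \<in> S" for x
      using that Suc.prems by (intro has_derivative_add times_differentiable_on_Suc_derivative)
    show "times_differentiable_on n
        (\<lambda>x. frechet_derivative f (at x) v + frechet_derivative g (at x) v) S" for v
      using Suc by simp
  qed
qed

lemma times_differentiable_on_sum:
  assumes "open S" "\<And>i. i \<in> I \<Longrightarrow> times_differentiable_on n (f i) S"
  shows "times_differentiable_on n (\<lambda>x. \<Sum>i\<in>I. f i x) S"
  using assms(2)
proof (induction I rule: infinite_finite_induct)
  case (insert i I)
  then show ?case
    by (simp add: times_differentiable_on_add[OF assms(1)])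
qed (simp_all add: times_differentiable_on_const assms(1))

lemma times_differentiable_on_bilinear:
  assumes B: "bounded_bilinear B" and "open S"
    and "times_differentiable_on n f S" "times_differentiable_on n g S"
  shows "times_differentiable_on n (\<lambda>x. B (f x) (g x)) S"
  using assms(3,4)
proof (induction n arbitrary: f g)
  case 0
  then show ?case by (simp add: bounded_bilinear.continuous_on[OF B])
next
  case (Suc n)
  let ?Df = "\<lambda>x. frechet_derivative f (at x)" and ?Dg = "\<lambda>x. frechet_derivative g (at x)"
  show ?case
  proof (rule times_differentiable_on_SucI[OF assms(2)])
    show "((\<lambda>x. B (f x) (g x)) has_derivative (\<lambda>v. B (f x) (?Dg x v) + B (?Df x v) (g x))) (at x)"
      if "x \<in> S" for x
      by (rule bounded_bilinear.FDERIV[OF B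
            times_differentiable_on_Suc_derivative[OF Suc.prems(1) that]
            times_differentiable_on_Suc_derivative[OF Suc.prems(2) that]])
    show "times_differentiable_on n (\<lambda>x. B (f x) (?Dg x v) + B (?Df x v) (g x)) S" for v
      using Suc.prems
      by (intro times_differentiable_on_add[OF assms(2)] Suc.IH
          times_differentiable_on_SucD[of n f] times_differentiable_on_SucD[of n g]) auto
  qed
qed

text \<open>The chain rule writes \<open>D(f \<circ> g) v\<close> as a sum of products of coordinates of \<open>Dg v\<close> with
  partial derivatives of \<open>f\<close> composed with \<open>g\<close>; a basis of the intermediate space keeps the
  induction inside functions rather than spaces of linear maps.\<close>

lemma times_differentiable_on_compose:
  fixes g :: "'a::real_normed_vector \<Rightarrow> 'b::euclidean_space" and f :: "'b \<Rightarrow> 'c::real_normed_vector"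
  assumes "open S" and "times_differentiable_on n f T" "times_differentiable_on n g S"
    and "g ` S \<subseteq> T"
  shows "times_differentiable_on n (\<lambda>x. f (g x)) S"
  using assms(2,3)
proof (induction n arbitrary: f)
  case 0
  then show ?case using assms(4) by (auto intro: continuous_on_compose2)
next
  case (Suc n)
  let ?Df = "\<lambda>x. frechet_derivative f (at x)" and ?Dg = "\<lambda>x. frechet_derivative g (at x)"
  show ?case
  proof (rule times_differentiable_on_SucI[OF assms(1)])
    fix x assume x: "x \<in> S"
    have Df: "(f has_derivative ?Df (g x)) (at (g x))"
      using times_differentiable_on_Suc_derivative[OF Suc.prems(1)] x assms(4) by blast
    have "((\<lambda>x. f (g x)) has_derivative (\<lambda>v. ?Df (g x) (?Dg x v))) (at x)"
      using has_derivative_compose[OF times_differentiable_on_Suc_derivative[OF Suc.prems(2) x] Df] .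
    moreover have "?Df (g x) (?Dg x v) = (\<Sum>b\<in>Basis. (?Dg x v \<bullet> b) *\<^sub>R ?Df (g x) b)" for v
    proof -
      have L: "linear (?Df (g x))" using Df has_derivative_linear by blast
      have "?Df (g x) (\<Sum>b\<in>Basis. (?Dg x v \<bullet> b) *\<^sub>R b) = (\<Sum>b\<in>Basis. (?Dg x v \<bullet> b) *\<^sub>R ?Df (g x) b)"
        by (simp add: linear_sum[OF L] linear_cmul[OF L])
      thus ?thesis by (simp add: euclidean_representation)
    qed
    ultimately show "((\<lambda>x. f (g x)) has_derivative
        (\<lambda>v. \<Sum>b\<in>Basis. (?Dg x v \<bullet> b) *\<^sub>R ?Df (g x) b)) (at x)"
      by simp
  next
    fix v
    show "times_differentiable_on n (\<lambda>x. \<Sum>b\<in>Basis. (?Dg x v \<bullet> b) *\<^sub>R ?Df (g x) b) S"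
      using Suc.prems
      by (intro times_differentiable_on_sum times_differentiable_on_bilinear[OF bounded_bilinear_scaleR]
          times_differentiable_on_bounded_linear[OF bounded_linear_inner_left] assms(1) Suc.IH
          times_differentiable_on_SucD[of n g]) auto
  qed
qed

lemma smooth_on_cong:
  assumes "open S" "smooth_on f S" "\<And>x. x \<in> S \<Longrightarrow> f x = g x"
  shows "smooth_on g S"
  unfolding smooth_on_def
proof
  fix n
  show "times_differentiable_on n g S"
    by (rule times_differentiable_on_cong[OF assms(1) _ assms(3)])
       (use assms(2) in \<open>simp_all add: smooth_on_def\<close>)
qed

lemma smooth_on_subset: "smooth_on f S \<Longrightarrow> T \<subseteq> S \<Longrightarrow> smooth_on f T"
  by (simp add: smooth_on_def times_differentiable_on_subset[of _ f S T])

lemma smooth_on_const: "open S \<Longrightarrow> smooth_on (\<lambda>x. c) S"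
  by (simp add: smooth_on_def times_differentiable_on_const)

lemma smooth_on_id: "open S \<Longrightarrow> smooth_on (\<lambda>x. x) S"
  by (simp add: smooth_on_def times_differentiable_on_id)

lemma smooth_on_bounded_linear:
  "bounded_linear L \<Longrightarrow> open S \<Longrightarrow> smooth_on f S \<Longrightarrow> smooth_on (\<lambda>x. L (f x)) S"
  by (simp add: smooth_on_def times_differentiable_on_bounded_linear)

lemma smooth_on_add:
  "open S \<Longrightarrow> smooth_on f S \<Longrightarrow> smooth_on g S \<Longrightarrow> smooth_on (\<lambda>x. f x + g x) S"
  by (simp add: smooth_on_def times_differentiable_on_add)

lemma smooth_on_minus:
  "open S \<Longrightarrow> smooth_on f S \<Longrightarrow> smooth_on (\<lambda>x. - f x) S"
  by (rule smooth_on_bounded_linear) (simp add: bounded_linear_minus)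

lemma smooth_on_diff:
  "open S \<Longrightarrow> smooth_on f S \<Longrightarrow> smooth_on g S \<Longrightarrow> smooth_on (\<lambda>x. f x - g x) S"
  using smooth_on_add[of S f "\<lambda>x. - g x"] smooth_on_minus[of S g] by simp

lemma smooth_on_bilinear:
  "bounded_bilinear B \<Longrightarrow> open S \<Longrightarrow> smooth_on f S \<Longrightarrow> smooth_on g S \<Longrightarrow>
   smooth_on (\<lambda>x. B (f x) (g x)) S"
  by (simp add: smooth_on_def times_differentiable_on_bilinear)

lemmas smooth_on_mult = smooth_on_bilinear[OF bounded_bilinear_mult]
lemmas smooth_on_scaleR = smooth_on_bilinear[OF bounded_bilinear_scaleR]

lemma smooth_on_compose:
  fixes g :: "'a::real_normed_vector \<Rightarrow> 'b::euclidean_space"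
  shows "open S \<Longrightarrow> smooth_on f T \<Longrightarrow> smooth_on g S \<Longrightarrow> g ` S \<subseteq> T \<Longrightarrow> smooth_on (\<lambda>x. f (g x)) S"
  by (simp add: smooth_on_def times_differentiable_on_compose[of S _ f T g])

lemma smooth_on_has_derivative:
  assumes "smooth_on f S" "x \<in> S"
  shows "(f has_derivative frechet_derivative f (at x)) (at x)"
  by (rule times_differentiable_on_Suc_derivative[where n = 0, OF _ assms(2)])
     (use assms(1) in \<open>simp only: smooth_on_def\<close>)

lemma smooth_on_frechet_derivative:
  "smooth_on f S \<Longrightarrow> smooth_on (\<lambda>x. frechet_derivative f (at x) v) S"
  proof -
  assume "smooth_on f S"
  hence "times_differentiable_on (Suc n) f S" for n unfolding smooth_on_def ..
  thus ?thesis by (simp add: smooth_on_def)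
qed

lemma smooth_on_imp_continuous_on: "smooth_on f S \<Longrightarrow> continuous_on S f"
proof -
  assume "smooth_on f S"
  hence "times_differentiable_on 0 f S" unfolding smooth_on_def ..
  thus ?thesis by simp
qed

text \<open>The derivative \<open>- v / x\<^sup>2\<close> is a product of functions that the induction already handles.\<close>

lemma smooth_on_inverse:
  assumes "open S" "0 \<notin> S"
  shows "smooth_on (inverse :: real \<Rightarrow> real) S"
proof -
  have "times_differentiable_on n (inverse :: real \<Rightarrow> real) S" for n
  proof (induction n)
    case 0
    show ?case using assms by (auto intro!: continuous_on_inverse continuous_on_id)
  next
    case (Suc n)
    show ?case
    proof (rule times_differentiable_on_SucI[OF assms(1)])
      show "(inverse has_derivative (\<lambda>v. - (inverse x * v * inverse x))) (at x)" if "x \<in> S" for x :: real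
        by (rule has_derivative_inverse') (use that assms(2) in auto)
      have "times_differentiable_on n (\<lambda>x. (- v) * (inverse x * inverse x)) S" for v :: real
        by (intro times_differentiable_on_bounded_linear[OF bounded_linear_mult_right] assms(1)
            times_differentiable_on_bilinear[OF bounded_bilinear_mult] Suc)
      thus "times_differentiable_on n (\<lambda>x. - (inverse x * v * inverse x)) S" for v :: real
        by (simp add: mult_ac)
    qed
  qed
  thus ?thesis by (simp add: smooth_on_def)
qed

text \<open>The real derivative of \<open>f\<close> in the direction \<open>v\<close> is \<open>v f'\<close>, again a holomorphic function.\<close>

lemma holomorphic_imp_smooth_on:
  assumes "open S" "f holomorphic_on S"
  shows "smooth_on f S"
proof -
  have "times_differentiable_on n f S" for n
    using assms(2)
  proof (induction n arbitrary: f)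
    case 0
    then show ?case by (simp add: holomorphic_on_imp_continuous_on)
  next
    case (Suc n)
    show ?case
    proof (rule times_differentiable_on_SucI[OF assms(1)])
      show "(f has_derivative (\<lambda>v. deriv f x * v)) (at x)" if "x \<in> S" for x
        using holomorphic_derivI[OF Suc.prems assms(1) that] has_field_derivative_def by blast
      show "times_differentiable_on n (\<lambda>x. deriv f x * v) S" for v
        by (intro Suc.IH holomorphic_intros Suc.prems assms(1))
    qed
  qed
  thus ?thesis by (simp add: smooth_on_def)
qed

lemma smooth_on_local:
  assumes "\<And>x. x \<in> S \<Longrightarrow> \<exists>U. open U \<and> x \<in> U \<and> smooth_on f U"
  shows "smooth_on f S"
proof -
  have "times_differentiable_on n f S"
    if "\<And>x. x \<in> S \<Longrightarrow> \<exists>U. open U \<and> x \<in> U \<and> times_differentiable_on n f U" for n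
    using that
  proof (induction n arbitrary: f)
    case 0
    have "isCont f x" if "x \<in> S" for x
      using 0[OF that] by (auto simp: continuous_on_eq_continuous_at)
    then show ?case by (simp add: continuous_at_imp_continuous_on)
  next
    case (Suc n)
    have "f differentiable (at x)" if "x \<in> S" for x
      using Suc.prems[OF that] by auto
    moreover have "times_differentiable_on n (\<lambda>x. frechet_derivative f (at x) v) S" for v
    proof (rule Suc.IH)
      fix x assume "x \<in> S"
      then obtain U where "open U" "x \<in> U" "times_differentiable_on (Suc n) f U"
        using Suc.prems by blast
      thus "\<exists>U. open U \<and> x \<in> U \<and> times_differentiable_on n (\<lambda>x. frechet_derivative f (at x) v) U"
        by auto
    qed
    ultimately show ?case by simp
  qed
  moreover have "\<exists>U. open U \<and> x \<in> U \<and> times_differentiable_on n f U" if "x \<in> S" for n x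
    using assms[OF that] unfolding smooth_on_def by blast
  ultimately show ?thesis unfolding smooth_on_def by simp
qed


section \<open>Symmetry of second derivatives\<close>

lemma norm_diff_le_vector_derivative:
  fixes f :: "real \<Rightarrow> 'b::real_normed_vector"
  assumes "t \<ge> 0" "\<And>s. 0 \<le> s \<Longrightarrow> s \<le> t \<Longrightarrow> (f has_vector_derivative f' s) (at s)"
    "\<And>s. 0 \<le> s \<Longrightarrow> s \<le> t \<Longrightarrow> norm (f' s) \<le> B"
  shows "norm (f t - f 0) \<le> B * t"
proof (cases "t = 0")
  case False
  have "norm (f t - f 0) \<le> B * t - B * 0"
  proof (rule differentiable_bound_general[where f' = f'])
    show "continuous_on {0..t} f"
      using assms(2) by (auto intro!: continuous_at_imp_continuous_on has_vector_derivative_continuous)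
    show "((*) B has_vector_derivative B) (at s)" for s
      by (auto simp: has_vector_derivative_def mult.commute intro!: derivative_eq_intros)
  qed (use False assms in \<open>auto intro!: continuous_intros\<close>)
  thus ?thesis by simp
qed simp

lemma has_vector_derivative_along_line:
  assumes "(F has_derivative D) (at (z + s *\<^sub>R v))"
  shows "((\<lambda>s. F (z + s *\<^sub>R v)) has_vector_derivative D v) (at s)"
proof -
  have "((\<lambda>s. z + s *\<^sub>R v) has_derivative (\<lambda>h. h *\<^sub>R v)) (at s)"
    by (auto intro!: derivative_eq_intros)
  from has_derivative_compose[OF this assms]
  show ?thesis
    using linear_cmul[OF has_derivative_linear[OF assms]] by (simp add: has_vector_derivative_def)
qed

lemma norm_diff_le_directional_derivative:
  fixes F :: "'a::real_normed_vector \<Rightarrow> 'b::real_normed_vector"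
  assumes F: "\<And>z. (F has_derivative F' z) (at z)" and B: "\<And>z. norm (F' z v) \<le> B" and t: "t \<ge> 0"
  shows "norm (F (z + t *\<^sub>R v) - F z) \<le> B * t"
  using norm_diff_le_vector_derivative[OF t, of "\<lambda>s. F (z + s *\<^sub>R v)" "\<lambda>s. F' (z + s *\<^sub>R v) v" B]
    has_vector_derivative_along_line[OF F] B by simp

text \<open>The second difference of \<open>F\<close> over a small parallelogram with sides \<open>s v\<close> and \<open>t w\<close> is \<open>s t\<close> times a second
  derivative, up to a small relative error: differentiate along \<open>w\<close>, then along \<open>v\<close>.\<close>

lemma second_difference_bound:
  fixes F :: "'a::real_normed_vector \<Rightarrow> 'b::real_normed_vector"
  assumes st: "s \<ge> 0" "t \<ge> 0"
    and P: "\<And>\<sigma> \<tau>. 0 \<le> \<sigma> \<Longrightarrow> \<sigma> \<le> s \<Longrightarrow> 0 \<le> \<tau> \<Longrightarrow> \<tau> \<le> t \<Longrightarrow> z + \<sigma> *\<^sub>R v + \<tau> *\<^sub>R w \<in> S"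
    and F: "\<And>x. x \<in> S \<Longrightarrow> (F has_derivative F' x) (at x)"
    and G: "\<And>x. x \<in> S \<Longrightarrow> ((\<lambda>x. F' x w) has_derivative G x) (at x)"
    and B: "\<And>x. x \<in> S \<Longrightarrow> norm (G x v - c) \<le> e"
  shows "norm (F (z + s *\<^sub>R v + t *\<^sub>R w) - F (z + t *\<^sub>R w) - (F (z + s *\<^sub>R v) - F z) - (s * t) *\<^sub>R c) \<le> e * s * t"
proof -
  define K where "K \<tau> = F (z + s *\<^sub>R v + \<tau> *\<^sub>R w) - F (z + \<tau> *\<^sub>R w) - (s * \<tau>) *\<^sub>R c" for \<tau>
  have "norm (K t - K 0) \<le> (e * s) * t"
  proof (rule norm_diff_le_vector_derivative[OF st(2)])
    fix \<tau> assume \<tau>: "0 \<le> \<tau>" "\<tau> \<le> t"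
    let ?K' = "F' (z + s *\<^sub>R v + \<tau> *\<^sub>R w) w - F' (z + \<tau> *\<^sub>R w) w - s *\<^sub>R c"
    have "((\<lambda>\<tau>. F (z + s *\<^sub>R v + \<tau> *\<^sub>R w)) has_vector_derivative F' (z + s *\<^sub>R v + \<tau> *\<^sub>R w) w) (at \<tau>)"
      using P[OF st(1) order_refl \<tau>] by (intro has_vector_derivative_along_line F)
    moreover have "((\<lambda>\<tau>. F (z + \<tau> *\<^sub>R w)) has_vector_derivative F' (z + \<tau> *\<^sub>R w) w) (at \<tau>)"
      using P[OF order_refl st(1) \<tau>] by (intro has_vector_derivative_along_line F) simp
    moreover have "((\<lambda>\<tau>. (s * \<tau>) *\<^sub>R c) has_vector_derivative s *\<^sub>R c) (at \<tau>)"
      by (auto simp: has_vector_derivative_def mult.commute intro!: derivative_eq_intros)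
    ultimately show "(K has_vector_derivative ?K') (at \<tau>)"
      unfolding K_def by (intro has_vector_derivative_diff)
    define L where "L \<sigma> = F' (z + \<sigma> *\<^sub>R v + \<tau> *\<^sub>R w) w - \<sigma> *\<^sub>R c" for \<sigma>
    have "norm (L s - L 0) \<le> e * s"
    proof (rule norm_diff_le_vector_derivative[OF st(1)])
      fix \<sigma> assume \<sigma>: "0 \<le> \<sigma>" "\<sigma> \<le> s"
      have comm: "z + \<tau> *\<^sub>R w + \<sigma> *\<^sub>R v = z + \<sigma> *\<^sub>R v + \<tau> *\<^sub>R w" for \<sigma>
        by (simp add: add_ac)
      have "((\<lambda>\<sigma>. F' (z + \<tau> *\<^sub>R w + \<sigma> *\<^sub>R v) w) has_vector_derivative G (z + \<tau> *\<^sub>R w + \<sigma> *\<^sub>R v) v) (at \<sigma>)"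
        using P[OF \<sigma> \<tau>] by (intro has_vector_derivative_along_line[where F = "\<lambda>x. F' x w"] G) (simp add: comm)
      moreover have "((\<lambda>\<sigma>. \<sigma> *\<^sub>R c) has_vector_derivative c) (at \<sigma>)"
        by (auto simp: has_vector_derivative_def intro!: derivative_eq_intros)
      ultimately show "(L has_vector_derivative (G (z + \<sigma> *\<^sub>R v + \<tau> *\<^sub>R w) v - c)) (at \<sigma>)"
        unfolding L_def comm by (rule has_vector_derivative_diff)
      show "norm (G (z + \<sigma> *\<^sub>R v + \<tau> *\<^sub>R w) v - c) \<le> e"
        by (rule B[OF P[OF \<sigma> \<tau>]])
    qed
    moreover have "L s - L 0 = ?K'" by (simp add: L_def)
    ultimately show "norm ?K' \<le> e * s" by simp
  qed
  moreover have "K t - K 0 = F (z + s *\<^sub>R v + t *\<^sub>R w) - F (z + t *\<^sub>R w) - (F (z + s *\<^sub>R v) - F z) - (s * t) *\<^sub>R c"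
    by (simp add: K_def)
  ultimately show ?thesis by simp
qed

text \<open>Both orders of differentiation give the limit of the same second difference, divided by the area of the
parallelogram, as the parallelogram shrinks to a point.\<close>

lemma second_derivative_symmetric:
  assumes F: "smooth_on F S" and S: "open S" "z \<in> S"
  shows "frechet_derivative (\<lambda>x. frechet_derivative F (at x) w) (at z) v
       = frechet_derivative (\<lambda>x. frechet_derivative F (at x) v) (at z) w"
proof -
  let ?D = "\<lambda>x. frechet_derivative F (at x)"
  let ?G = "\<lambda>w x. frechet_derivative (\<lambda>x. ?D x w) (at x)"
  let ?c = "?G w z v" and ?c' = "?G v z w"
  have D: "(F has_derivative ?D x) (at x)" and G: "((\<lambda>x. ?D x w) has_derivative ?G w x) (at x)"
    if "x \<in> S" for x w
    using smooth_on_has_derivative[OF F that]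
      smooth_on_has_derivative[OF smooth_on_frechet_derivative[OF F] that] by auto
  have cont: "continuous_on S (\<lambda>x. ?G w x v)" for w v
    by (intro smooth_on_imp_continuous_on smooth_on_frechet_derivative F)
  have le: "norm (?c - ?c') \<le> 2 * e" if e: "e > 0" for e
  proof -
    obtain r where r: "r > 0" "ball z r \<subseteq> S" using S open_contains_ball by blast
    obtain r1 where r1: "r1 > 0" "\<And>x. x \<in> S \<Longrightarrow> dist x z < r1 \<Longrightarrow> dist (?G w x v) ?c < e"
      using cont[of w v] S(2) e unfolding continuous_on_iff by blast
    obtain r2 where r2: "r2 > 0" "\<And>x. x \<in> S \<Longrightarrow> dist x z < r2 \<Longrightarrow> dist (?G v x w) ?c' < e"
      using cont[of v w] S(2) e unfolding continuous_on_iff by blast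
    define \<rho> where "\<rho> = min r (min r1 r2)"
    have \<rho>: "\<rho> > 0" "\<rho> \<le> r" "\<rho> \<le> r1" "\<rho> \<le> r2" using r(1) r1(1) r2(1) by (auto simp: \<rho>_def)
    (* A side length that keeps the whole parallelogram inside the ball of radius \<rho>. *)
    define d where "d = \<rho> / (1 + norm v + norm w)"
    have pos: "1 + norm v + norm w > 0" by (simp add: add_pos_nonneg)
    have d: "d > 0" using \<rho>(1) pos by (simp add: d_def)
    have near: "z + \<sigma> *\<^sub>R a + \<tau> *\<^sub>R b \<in> ball z \<rho>"
      if "0 \<le> \<sigma>" "\<sigma> \<le> d" "0 \<le> \<tau>" "\<tau> \<le> d" "norm a + norm b = norm v + norm w" for \<sigma> \<tau> a b
    proof -
      have "dist z (z + \<sigma> *\<^sub>R a + \<tau> *\<^sub>R b) = norm (\<sigma> *\<^sub>R a + \<tau> *\<^sub>R b)"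
        by (subst dist_commute) (simp add: dist_norm add.assoc)
      also have "\<dots> \<le> \<sigma> * norm a + \<tau> * norm b"
        using norm_triangle_ineq[of "\<sigma> *\<^sub>R a" "\<tau> *\<^sub>R b"] that(1,3) by simp
      also have "\<dots> \<le> d * norm a + d * norm b"
        using that by (intro add_mono mult_right_mono) auto
      also have "\<dots> = d * (norm v + norm w)" by (simp add: that(5) flip: distrib_left)
      also have "\<dots> < d * (1 + norm v + norm w)" using d by simp
      also have "\<dots> = \<rho>" using pos by (simp add: d_def)
      finally show ?thesis by simp
    qed
    have inS: "x \<in> S" if "x \<in> ball z \<rho>" for x using that \<rho>(2) r(2) by auto
    let ?\<Delta> = "F (z + d *\<^sub>R v + d *\<^sub>R w) - F (z + d *\<^sub>R w) - (F (z + d *\<^sub>R v) - F z)"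
    have 1: "norm (?\<Delta> - (d * d) *\<^sub>R ?c) \<le> e * d * d"
    proof (rule second_difference_bound[where S = "ball z \<rho>" and F' = ?D and G = "?G w"])
      show "norm (?G w x v - ?c) \<le> e" if "x \<in> ball z \<rho>" for x
        using r1(2)[OF inS[OF that]] that \<rho>(3) by (simp add: dist_norm norm_minus_commute)
    qed (use d near D G inS in auto)
    have "norm (F (z + d *\<^sub>R w + d *\<^sub>R v) - F (z + d *\<^sub>R v) - (F (z + d *\<^sub>R w) - F z) - (d * d) *\<^sub>R ?c') \<le> e * d * d"
    proof (rule second_difference_bound[where S = "ball z \<rho>" and F' = ?D and G = "?G v"])
      show "norm (?G v x w - ?c') \<le> e" if "x \<in> ball z \<rho>" for x
        using r2(2)[OF inS[OF that]] that \<rho>(4) by (simp add: dist_norm norm_minus_commute)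
    qed (use d near D G inS in auto)
    moreover have "F (z + d *\<^sub>R w + d *\<^sub>R v) - F (z + d *\<^sub>R v) - (F (z + d *\<^sub>R w) - F z) = ?\<Delta>"
      by (simp add: add_ac)
    ultimately have 2: "norm (?\<Delta> - (d * d) *\<^sub>R ?c') \<le> e * d * d" by simp
    have "(d * d) * norm (?c - ?c') = norm ((?\<Delta> - (d * d) *\<^sub>R ?c') - (?\<Delta> - (d * d) *\<^sub>R ?c))"
      using d by (simp flip: scaleR_diff_right)
    also have "\<dots> \<le> e * d * d + e * d * d"
      using norm_triangle_ineq4 1 2 by (meson add_mono order_trans)
    finally have "(d * d) * norm (?c - ?c') \<le> (d * d) * (2 * e)" by (simp add: algebra_simps)
    thus ?thesis using d by simp
  qed
  have "norm (?c - ?c') \<le> 0"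
  proof (rule field_le_epsilon)
    fix e :: real assume "e > 0"
    thus "norm (?c - ?c') \<le> 0 + e" using le[of "e / 2"] by simp
  qed
  thus ?thesis by simp
qed


section \<open>A smooth bump function\<close>

text \<open>For \<open>p = 1\<close> this is the classical smooth function that is positive on the positive half line and 0 elsewhere; the polynomial
factor makes the family stable under differentiation.\<close>

definition flat_fun :: "real poly \<Rightarrow> real \<Rightarrow> real" where
  "flat_fun p t = (if t > 0 then poly p (1 / t) * exp (- (1 / t)) else 0)"

lemma poly_times_exp_minus_tendsto_0: "((\<lambda>u. poly p u * exp (- u)) \<longlongrightarrow> (0::real)) at_top"
proof -
  have "((\<lambda>u. \<Sum>i\<le>degree p. coeff p i * (u ^ i / exp u)) \<longlongrightarrow> (\<Sum>i\<le>degree p. coeff p i * 0)) at_top"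
    by (intro tendsto_sum tendsto_mult tendsto_const tendsto_power_div_exp_0)
  moreover have "(\<Sum>i\<le>degree p. coeff p i * (u ^ i / exp u)) = poly p u * exp (- u)" for u
    by (simp add: poly_altdef sum_distrib_right exp_minus divide_inverse mult.assoc)
  ultimately show ?thesis by simp
qed

lemma flat_fun_tendsto_0: "(flat_fun p \<longlongrightarrow> 0) (at 0)"
proof (rule filterlim_split_at)
  have "\<forall>\<^sub>F t in at_left (0::real). 0 = flat_fun p t"
    unfolding eventually_at_left_field by (auto simp: flat_fun_def intro!: exI[of _ "-1"])
  thus "(flat_fun p \<longlongrightarrow> 0) (at_left 0)"
    by (rule Lim_transform_eventually[OF tendsto_const])
  have "((\<lambda>t. poly p (inverse t) * exp (- inverse t)) \<longlongrightarrow> 0) (at_right 0)"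
    by (rule filterlim_compose[OF poly_times_exp_minus_tendsto_0 filterlim_inverse_at_top_right])
  moreover have "\<forall>\<^sub>F t in at_right 0. poly p (inverse t) * exp (- inverse t) = flat_fun p t"
    unfolding eventually_at_right_field
    by (auto simp: flat_fun_def divide_inverse intro!: exI[of _ 1])
  ultimately show "(flat_fun p \<longlongrightarrow> 0) (at_right 0)"
    by (rule Lim_transform_eventually)
qed

text \<open>Functions \<open>p(1/t) e\<^sup>-\<^sup>1\<^sup>/\<^sup>t\<close>, continued by 0, are closed under differentiation, because \<open>d/dt = -u\<^sup>2 d/du\<close> for \<open>u = 1/t\<close>; at 0 the
  difference quotient is again such a function, for the polynomial \<open>u p(u)\<close>.\<close>

lemma flat_fun_has_derivative:
  "(flat_fun p has_real_derivative flat_fun ([:0, 0, 1:] * (p - pderiv p)) t) (at t)"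
proof -
  consider "t > 0" | "t < 0" | "t = 0" by linarith
  thus ?thesis
  proof cases
    case 1
    have "((\<lambda>t. poly p (1 / t) * exp (- (1 / t))) has_real_derivative
        poly ([:0, 0, 1:] * (p - pderiv p)) (1 / t) * exp (- (1 / t))) (at t)"
      using 1 by (auto intro!: derivative_eq_intros simp: field_simps power2_eq_square)
    hence "(flat_fun p has_real_derivative
        poly ([:0, 0, 1:] * (p - pderiv p)) (1 / t) * exp (- (1 / t))) (at t)"
      by (rule has_field_derivative_transform_within_open[where S = "{0<..}"])
         (use 1 in \<open>auto simp: flat_fun_def\<close>)
    thus ?thesis using 1 by (simp add: flat_fun_def)
  next
    case 2
    have "(flat_fun p has_real_derivative 0) (at t)"
      by (rule has_field_derivative_transform_within_open[OF DERIV_const, where S = "{..<0}"])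
         (use 2 in \<open>auto simp: flat_fun_def\<close>)
    thus ?thesis using 2 by (simp add: flat_fun_def)
  next
    case 3
    have "\<forall>\<^sub>F h in at 0. flat_fun ([:0, 1:] * p) h = (flat_fun p (0 + h) - flat_fun p 0) / h"
      by (auto simp: flat_fun_def eventually_at_filter)
    hence "(\<lambda>h. (flat_fun p (0 + h) - flat_fun p 0) / h) \<midarrow>0\<rightarrow> 0"
      by (rule Lim_transform_eventually[OF flat_fun_tendsto_0])
    thus ?thesis using 3 by (simp add: DERIV_def flat_fun_def)
  qed
qed

lemma smooth_on_flat_fun: "smooth_on (flat_fun p) UNIV"
proof -
  have "times_differentiable_on n (flat_fun p) UNIV" for n
  proof (induction n arbitrary: p)
    case 0
    show ?case
      using flat_fun_has_derivative by (auto intro!: DERIV_isCont continuous_at_imp_continuous_on)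
  next
    case (Suc n)
    let ?q = "[:0, 0, 1:] * (p - pderiv p)"
    show ?case
    proof (rule times_differentiable_on_SucI[OF open_UNIV])
      show "(flat_fun p has_derivative (\<lambda>v. flat_fun ?q t * v)) (at t)" for t
        using flat_fun_has_derivative unfolding has_field_derivative_def .
      show "times_differentiable_on n (\<lambda>t. flat_fun ?q t * v) UNIV" for v
        by (rule times_differentiable_on_bounded_linear[OF bounded_linear_mult_left open_UNIV Suc])
    qed
  qed
  thus ?thesis by (simp add: smooth_on_def)
qed

text \<open>Compose the flat function with \<open>r\<^sup>2 - \<bar>z - z\<^sub>0\<bar>\<^sup>2\<close>, a polynomial in the coordinates that is positive exactly inside
the disc.\<close>

lemma ex_smooth_bump:
  fixes z0 :: complex
  assumes "r > 0"
  obtains \<beta> :: "complex \<Rightarrow> real"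
  where "smooth_on \<beta> UNIV" "\<And>z. \<beta> z \<ge> 0" "\<beta> z0 > 0" "\<And>z. z \<notin> cball z0 r \<Longrightarrow> \<beta> z = 0"
proof
  let ?\<rho> = "\<lambda>z. r\<^sup>2 - (Re (z - z0) * Re (z - z0) + Im (z - z0) * Im (z - z0))"
  let ?\<beta> = "\<lambda>z. flat_fun 1 (?\<rho> z)"
  have \<rho>: "?\<rho> z = r\<^sup>2 - (dist z0 z)\<^sup>2" for z
  proof -
    have "(dist z0 z)\<^sup>2 = (Re (z - z0))\<^sup>2 + (Im (z - z0))\<^sup>2"
      by (simp only: dist_norm norm_minus_commute[of z0] cmod_power2)
    thus ?thesis by (simp only: power2_eq_square)
  qed
  have "smooth_on ?\<rho> UNIV"
    by (intro smooth_on_diff smooth_on_add smooth_on_mult smooth_on_const smooth_on_id open_UNIV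
        smooth_on_bounded_linear[OF bounded_linear_Re] smooth_on_bounded_linear[OF bounded_linear_Im])
  thus "smooth_on ?\<beta> UNIV"
    by (intro smooth_on_compose[OF _ smooth_on_flat_fun]) auto
  show "?\<beta> z \<ge> 0" for z by (simp add: flat_fun_def)
  show "?\<beta> z0 > 0" using assms by (simp add: flat_fun_def)
  show "?\<beta> z = 0" if "z \<notin> cball z0 r" for z
  proof -
    have "r\<^sup>2 \<le> (dist z0 z)\<^sup>2" using that assms by (intro power_mono) auto
    thus ?thesis using \<rho>[of z] by (simp add: flat_fun_def)
  qed
qed


section \<open>Derivatives of compactly supported functions have integral zero\<close>

lemma integrable_compact_support:
  fixes F :: "'a::euclidean_space \<Rightarrow> 'b::{banach, second_countable_topology}"
  assumes "continuous_on K F" "compact K" "\<And>z. z \<notin> K \<Longrightarrow> F z = 0"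
  shows "integrable lborel F"
proof -
  have "(\<lambda>z. indicator K z *\<^sub>R F z) = F"
    using assms(3) by (auto simp: indicator_def fun_eq_iff)
  thus ?thesis using borel_integrable_compact[OF assms(2,1)] by simp
qed

lemma frechet_derivative_eq_0_outside:
  fixes F :: "'a::euclidean_space \<Rightarrow> 'b::real_normed_vector"
  assumes "compact K" "\<And>z. z \<notin> K \<Longrightarrow> F z = 0" "z \<notin> K"
  shows "frechet_derivative F (at z) v = 0"
proof -
  have "(F has_derivative (\<lambda>v. 0)) (at z)"
    by (rule has_derivative_transform_within_open[OF has_derivative_const, where s = "- K"])
       (use assms compact_imp_closed in auto)
  thus ?thesis using frechet_derivative_at by metis
qed

lemma integrable_directional_derivative:
  fixes F :: "'a::euclidean_space \<Rightarrow> 'b::euclidean_space"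
  assumes F: "smooth_on F UNIV" and K: "compact K" "\<And>z. z \<notin> K \<Longrightarrow> F z = 0"
  shows "integrable lborel (\<lambda>z. frechet_derivative F (at z) v)"
proof (rule integrable_compact_support[OF _ K(1)])
  show "continuous_on K (\<lambda>z. frechet_derivative F (at z) v)"
    using smooth_on_imp_continuous_on[OF smooth_on_frechet_derivative[OF F]] continuous_on_subset by blast
  show "frechet_derivative F (at z) v = 0" if "z \<notin> K" for z
    by (rule frechet_derivative_eq_0_outside[OF K that])
qed

text \<open>Lebesgue measure is translation invariant, so each difference quotient \<open>n (F(z + v/n) - F(z))\<close> has
  integral 0; these converge boundedly, inside a fixed ball, to the directional derivative.\<close>

lemma integral_directional_derivative_eq_0:
  fixes F :: "'a::euclidean_space \<Rightarrow> 'b::euclidean_space"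
  assumes F: "smooth_on F UNIV" and K: "compact K" "\<And>z. z \<notin> K \<Longrightarrow> F z = 0"
  shows "(\<integral>z. frechet_derivative F (at z) v \<partial>lborel) = 0"
proof -
  let ?D = "\<lambda>z. frechet_derivative F (at z)"
  have D: "(F has_derivative ?D z) (at z)" for z
    using smooth_on_has_derivative[OF F] by simp
  have contF: "continuous_on UNIV F" and contD: "continuous_on UNIV (\<lambda>z. ?D z v)"
    using smooth_on_imp_continuous_on[OF F]
      smooth_on_imp_continuous_on[OF smooth_on_frechet_derivative[OF F]] by blast+
  have D0: "?D z v = 0" if "z \<notin> K" for z
    by (rule frechet_derivative_eq_0_outside[OF K that])
  have "compact ((\<lambda>z. ?D z v) ` K)"
    using compact_continuous_image continuous_on_subset[OF contD] K(1) by blast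
  then obtain B0 where B0: "\<And>w. w \<in> (\<lambda>z. ?D z v) ` K \<Longrightarrow> norm w \<le> B0"
    using compact_imp_bounded bounded_iff by metis
  define B where "B = max B0 0"
  have B: "norm (?D z v) \<le> B" for z
  proof (cases "z \<in> K")
    case True
    thus ?thesis using B0[of "?D z v"] by (simp add: B_def)
  qed (simp add: D0 B_def)
  obtain R where R: "\<And>z. z \<in> K \<Longrightarrow> norm z \<le> R"
    using compact_imp_bounded[OF K(1)] bounded_iff by metis
  let ?t = "\<lambda>n. inverse (real (Suc n))"
  define s where "s n z = real (Suc n) *\<^sub>R (F (z + ?t n *\<^sub>R v) - F z)" for n z
  (* The translates by v / n, n \<ge> 1, move the support of F by at most norm v. *)
  define w where "w z = indicator (cball 0 (R + norm v)) z *\<^sub>R B" for z :: 'a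
  have intF: "integrable lborel F"
    using integrable_compact_support[OF continuous_on_subset[OF contF]] K by blast
  have intT: "integrable lborel (\<lambda>z. F (z + c)) \<and> (\<integral>z. F (z + c) \<partial>lborel) = (\<integral>z. F z \<partial>lborel)" for c
    using integrable_distr[of "(+) c" lborel borel F] integral_distr[of "(+) c" lborel borel F] intF
      borel_measurable_continuous_onI[OF contF]
    by (simp add: lborel_distr_plus add.commute)
  have s0: "(\<integral>z. s n z \<partial>lborel) = 0" for n
    unfolding s_def using intT[of "?t n *\<^sub>R v"] intF by simp
  have "(\<lambda>n. \<integral>z. s n z \<partial>lborel) \<longlonglongrightarrow> (\<integral>z. ?D z v \<partial>lborel)"
  proof (rule integral_dominated_convergence[where w = w])
    show "(\<lambda>z. ?D z v) \<in> borel_measurable lborel"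
      using borel_measurable_continuous_onI[OF contD] by simp
    show "s n \<in> borel_measurable lborel" for n
      unfolding s_def
      by (simp, intro borel_measurable_continuous_onI continuous_intros continuous_on_compose2[OF contF]) auto
    show "integrable lborel w"
      unfolding w_def by (intro borel_integrable_compact) auto
    show "AE z in lborel. (\<lambda>n. s n z) \<longlonglongrightarrow> ?D z v"
    proof (rule AE_I2)
      fix z
      have "((\<lambda>t. F (z + t *\<^sub>R v)) has_vector_derivative ?D z v) (at 0)"
      proof -
        have "((\<lambda>s. z + s *\<^sub>R v) has_derivative (\<lambda>h. h *\<^sub>R v)) (at 0)"
          by (auto intro!: derivative_eq_intros)
        moreover have "(F has_derivative ?D z) (at (z + 0 *\<^sub>R v))" using D by simp
        ultimately have "((\<lambda>t. F (z + t *\<^sub>R v)) has_derivative (\<lambda>h. ?D z (h *\<^sub>R v))) (at 0)"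
          by (rule has_derivative_compose)
        thus ?thesis
          using linear_cmul[OF has_derivative_linear[OF D]] by (simp add: has_vector_derivative_def)
      qed
      hence "((\<lambda>t. (F (z + t *\<^sub>R v) - F z) /\<^sub>R t) \<longlongrightarrow> ?D z v) (at 0)"
      proof -
        assume "((\<lambda>t. F (z + t *\<^sub>R v)) has_vector_derivative ?D z v) (at 0)"
        hence "((\<lambda>t. norm (F (z + t *\<^sub>R v) - F z - t *\<^sub>R ?D z v) / norm t) \<longlongrightarrow> 0) (at 0)"
          by (simp add: has_vector_derivative_def has_derivative_at)
        moreover have "\<forall>\<^sub>F t in at 0. norm (F (z + t *\<^sub>R v) - F z - t *\<^sub>R ?D z v) / norm t
            = norm ((F (z + t *\<^sub>R v) - F z) /\<^sub>R t - ?D z v)"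
        proof -
          have "norm (x - t *\<^sub>R d) / norm t = norm (x /\<^sub>R t - d)" if "t \<noteq> 0" for t x and d :: 'b
          proof -
            have "x - t *\<^sub>R d = t *\<^sub>R (x /\<^sub>R t - d)" using that by (simp add: algebra_simps)
            thus ?thesis using that by simp
          qed
          thus ?thesis by (simp add: eventually_at_filter)
        qed
        ultimately have "((\<lambda>t. norm ((F (z + t *\<^sub>R v) - F z) /\<^sub>R t - ?D z v)) \<longlongrightarrow> 0) (at 0)"
          by (rule Lim_transform_eventually)
        thus ?thesis by (simp add: tendsto_norm_zero_iff LIM_zero_iff)
      qed
      hence "(\<lambda>n. (F (z + ?t n *\<^sub>R v) - F z) /\<^sub>R ?t n) \<longlonglongrightarrow> ?D z v"
        by (rule filterlim_compose)
           (use LIMSEQ_inverse_real_of_nat in \<open>auto simp: filterlim_at\<close>)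
      thus "(\<lambda>n. s n z) \<longlonglongrightarrow> ?D z v" by (simp add: s_def)
    qed
    show "AE z in lborel. norm (s n z) \<le> w z" for n
    proof (rule AE_I2)
      fix z
      have t: "?t n \<ge> 0" "?t n \<le> 1" by (auto simp: inverse_le_1_iff)
      have "norm (s n z) = real (Suc n) * norm (F (z + ?t n *\<^sub>R v) - F z)"
        by (simp only: s_def norm_scaleR abs_of_nat)
      also have "\<dots> \<le> real (Suc n) * (B * ?t n)"
        by (intro mult_left_mono norm_diff_le_directional_derivative[OF D B t(1)]) simp
      also have "\<dots> = B" by (simp add: field_simps)
      finally have le: "norm (s n z) \<le> B" .
      show "norm (s n z) \<le> w z"
      proof (cases "z \<in> cball 0 (R + norm v)")
        case False
        have "norm (?t n *\<^sub>R v) \<le> norm v"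
          using mult_right_mono[OF t(2) norm_ge_zero[of v]] t(1) by simp
        moreover have "norm z \<le> norm (z + ?t n *\<^sub>R v) + norm (?t n *\<^sub>R v)"
          using norm_triangle_ineq4[of "z + ?t n *\<^sub>R v" "?t n *\<^sub>R v"] by simp
        moreover have "norm z > R + norm v" using False by simp
        moreover have "norm v \<ge> 0" by simp
        ultimately have "norm z > R" "norm (z + ?t n *\<^sub>R v) > R" by linarith+
        hence "z \<notin> K" "z + ?t n *\<^sub>R v \<notin> K"
          by (auto dest: R)
        thus ?thesis using K(2) B_def by (simp add: s_def w_def)
      qed (use le in \<open>simp add: w_def\<close>)
    qed
  qed
  thus ?thesis by (simp add: s0 LIMSEQ_const_iff)
qed


section \<open>The space \<open>V\<close> and the action of \<open>P\<^sub>+(\<real>)\<close>\<close>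

lemma aff_nth [simp]:
  "aff a b $ 1 $ 1 = a" "aff a b $ 1 $ 2 = b" "aff a b $ 2 $ 1 = 0" "aff a b $ 2 $ 2 = 1"
  by (simp_all add: aff_def)

lemma aff_mult: "aff a b ** aff c d = aff (a * c) (a * d + b)"
  by (simp add: vec_eq_iff forall_2 matrix_matrix_mult_def sum_2)

lemma mat_1_eq_aff: "mat 1 = aff 1 0"
  by (simp add: vec_eq_iff forall_2 mat_def)

lemma aff_inject: "aff a b = aff c d \<longleftrightarrow> a = c \<and> b = d"
  by (auto simp: vec_eq_iff forall_2)

lemma arch_mat_aff: "arch_mat (aff a b) = aff (1, a) (0, b)"
  by (simp add: vec_eq_iff forall_2 arch_mat_def mat_1_eq_aff zero_prod_def one_prod_def)

lemma arch_mat_aff_mult: "arch_mat (aff a b ** aff c d) = arch_mat (aff a b) ** arch_mat (aff c d)"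
  by (simp add: arch_mat_aff aff_mult times_prod_def)

lemma finite_adele_of_rat_hom:
  "finite_adele_of_rat 0 = 0" "finite_adele_of_rat 1 = 1"
  "finite_adele_of_rat (q * r) = finite_adele_of_rat q * finite_adele_of_rat r"
  "finite_adele_of_rat (q - r) = finite_adele_of_rat q - finite_adele_of_rat r"
proof -
  show "finite_adele_of_rat 0 = 0" "finite_adele_of_rat 1 = 1"
    "finite_adele_of_rat (q * r) = finite_adele_of_rat q * finite_adele_of_rat r"
    by (transfer, simp add: finite_adele_rel_refl finite_adele_rep_rat)+
  have "finite_adele_of_rat (q + - r) = finite_adele_of_rat q + - finite_adele_of_rat r"
    by (transfer, simp add: finite_adele_rel_def finite_adele_rep_rat padic_null_0)
  thus "finite_adele_of_rat (q - r) = finite_adele_of_rat q - finite_adele_of_rat r" by simp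
qed

text \<open>The finite adeles have zero divisors, but a nonzero rational number is a unit among them.\<close>

lemma finite_adele_of_rat_mult_eq_0_iff: "finite_adele_of_rat q * a = 0 \<longleftrightarrow> q = 0 \<or> a = 0"
proof -
  have "a = finite_adele_of_rat (inverse q) * (finite_adele_of_rat q * a)" if "q \<noteq> 0"
    using that by (simp flip: finite_adele_of_rat_hom mult.assoc) (simp add: finite_adele_of_rat_hom)
  thus ?thesis by (cases "q = 0") (auto simp: finite_adele_of_rat_hom)
qed

lemma finite_adele_of_rat_inject: "finite_adele_of_rat q = finite_adele_of_rat r \<longleftrightarrow> q = r"
  using finite_adele_of_rat_mult_eq_0_iff[of "q - r" 1] by (simp add: finite_adele_of_rat_hom)

lemma adele_of_rat_hom:
  "adele_of_rat 0 = 0" "adele_of_rat 1 = 1"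
  "adele_of_rat (q * r) = adele_of_rat q * adele_of_rat r"
  by (simp_all add: adele_of_rat_def finite_adele_of_rat_hom zero_prod_def one_prod_def
      times_prod_def of_rat_mult)

lemma rational_mat_aff: "rational_mat (aff q r) = aff (adele_of_rat q) (adele_of_rat r)"
  by (simp add: vec_eq_iff forall_2 rational_mat_def adele_of_rat_hom)

lemma in_class_of_aff_iff:
  "m \<in> class_of (aff y x) \<longleftrightarrow>
     (\<exists>q r. q \<noteq> 0 \<and> m = aff (adele_of_rat q * y) (adele_of_rat q * x + adele_of_rat r))"
proof -
  have "class_of (aff y x) = {rational_mat (aff q r) ** aff y x | q r. q \<noteq> 0}"
    unfolding class_of_def P_group_def by (fastforce simp: dvd_field_iff)
  thus ?thesis by (auto simp: rational_mat_aff aff_mult)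
qed

lemma aff_in_class_of: "aff y x \<in> class_of (aff y x)"
  unfolding in_class_of_aff_iff
  by (rule exI[of _ 1], rule exI[of _ 0]) (simp add: adele_of_rat_hom)

lemma right_act_class_of: "right_act (class_of m) h = class_of (m ** arch_mat h)"
  unfolding right_act_def class_of_def by (auto simp: matrix_mul_assoc)

lemma right_act_aff:
  "right_act (class_of (aff y x)) (aff a b) = class_of (aff (y * (1, a)) (y * (0, b) + x))"
  by (simp add: right_act_class_of arch_mat_aff aff_mult)

lemma right_act_aff_mult:
  "right_act (right_act c (aff a b)) (aff a' b') = right_act c (aff a b ** aff a' b')"
  by (simp add: right_act_def image_image arch_mat_aff_mult matrix_mul_assoc)

text \<open>The left action multiplies \<open>y\<close> by a rational unit, so the condition that defines \<open>V\<close> does not depend on the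
representative of a class.\<close>

lemma class_of_aff_in_V_iff: "class_of (aff y x) \<in> V_space \<longleftrightarrow> fst y \<noteq> 0 \<and> snd y \<noteq> 0"
proof
  assume "class_of (aff y x) \<in> V_space"
  then obtain y' x' where *: "class_of (aff y x) = class_of (aff y' x')" "fst y' \<noteq> 0" "snd y' \<noteq> 0"
    unfolding V_space_def by blast
  then obtain q r where "q \<noteq> 0" "aff y x = aff (adele_of_rat q * y') (adele_of_rat q * x' + adele_of_rat r)"
    using aff_in_class_of[of y x] unfolding *(1) in_class_of_aff_iff by blast
  thus "fst y \<noteq> 0 \<and> snd y \<noteq> 0"
    using * by (auto simp: aff_inject times_prod_def adele_of_rat_def finite_adele_of_rat_mult_eq_0_iff)
next
  assume "fst y \<noteq> 0 \<and> snd y \<noteq> 0"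
  thus "class_of (aff y x) \<in> V_space" unfolding V_space_def by blast
qed

lemma V_space_cases:
  assumes "c \<in> V_space"
  obtains y x where "c = class_of (aff y x)" "fst y \<noteq> 0" "snd y \<noteq> 0"
  using assms unfolding V_space_def by blast

text \<open>A nonzero finite adele has a component \<open>a\<^sub>p \<noteq> 0\<close>, and the \<open>p\<close>-adic distance from 0 to \<open>a\<^sub>p\<close>
  keeps a whole neighbourhood of \<open>a\<close> away from 0.\<close>

lemma ex_local_norm_pos:
  assumes "a \<noteq> 0"
  shows "\<exists>p. prime p \<and> local_norm p a > 0"
  using assms
proof (transfer)
  fix a
  assume rel: "finite_adele_rel a a" and "\<not> finite_adele_rel a (\<lambda>p n. 0)"
  then obtain p where p: "prime p" and nn: "\<not> padic_null p (a p)"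
    using finite_adele_rep_rat[of 0] by (auto simp: finite_adele_rel_def)
  have C: "padic_Cauchy p (a p)" using rel p by (simp add: finite_adele_rel_def finite_adele_rep_def)
  have le: "\<bar>pabs p x - pabs p y\<bar> \<le> pabs p (x - y)" for x y
    using pabs_add_le[OF p, of "x - y" y] pabs_add_le[OF p, of "y - x" x] pabs_minus[of p "x - y"]
    by simp
  have "Cauchy (\<lambda>n. pabs p (a p n))"
  proof (rule CauchyI)
    fix e :: real assume "0 < e"
    then obtain N where "\<forall>m\<ge>N. \<forall>n\<ge>N. pabs p (a p m - a p n) < e"
      using C unfolding padic_Cauchy_def by blast
    thus "\<exists>M. \<forall>m\<ge>M. \<forall>n\<ge>M. norm (pabs p (a p m) - pabs p (a p n)) < e"
      using le le_less_trans by (metis real_norm_def)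
  qed
  then obtain L where L: "(\<lambda>n. pabs p (a p n)) \<longlonglongrightarrow> L"
    using Cauchy_convergent convergent_def by blast
  have "L \<ge> 0" using L by (rule LIMSEQ_le_const) simp
  moreover have "L \<noteq> 0" using L nn by (auto simp: padic_null_def)
  ultimately show "\<exists>p. prime p \<and> 0 < (if prime p then lim (\<lambda>n. pabs p (a p n)) else 0)"
    using p limI[OF L] by (intro exI[of _ p]) simp
qed

lemma local_norm_minus: "local_norm p (- a) = local_norm p a"
  by transfer simp

lemma open_finite_adele_nonzero: "open {a :: finite_adele. a \<noteq> 0}"
  unfolding open_finite_adele_def
proof
  fix a :: finite_adele assume "a \<in> {a. a \<noteq> 0}"
  then obtain p where p: "prime p" "local_norm p a > 0" using ex_local_norm_pos by blast
  have "b \<noteq> 0" if "local_norm p (b - a) < local_norm p a" for b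
    using that local_norm_minus[of p a] by auto
  thus "\<exists>S e. finite S \<and> 0 < e \<and>
      {b. (\<forall>p. prime p \<longrightarrow> local_norm p (b - a) \<le> 1) \<and> (\<forall>p\<in>S. prime p \<longrightarrow> local_norm p (b - a) < e)}
        \<subseteq> {a. a \<noteq> 0}"
    using p by (intro exI[of _ "{p}"] exI[of _ "local_norm p a"]) auto
qed

lemma openin_class_topology_iff:
  "openin class_topology U \<longleftrightarrow>
     U \<subseteq> class_of ` P_bar \<and> openin (top_of_set P_bar) {m \<in> P_bar. class_of m \<in> U}"
proof -
  have "istopology (\<lambda>U. U \<subseteq> class_of ` P_bar \<and>
     openin (top_of_set P_bar) {m \<in> P_bar. class_of m \<in> U})"
    unfolding istopology_def
  proof (intro conjI allI impI)
    fix S T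
    assume "S \<subseteq> class_of ` P_bar \<and> openin (top_of_set P_bar) {m \<in> P_bar. class_of m \<in> S}"
      "T \<subseteq> class_of ` P_bar \<and> openin (top_of_set P_bar) {m \<in> P_bar. class_of m \<in> T}"
    moreover have "{m \<in> P_bar. class_of m \<in> S \<inter> T}
        = {m \<in> P_bar. class_of m \<in> S} \<inter> {m \<in> P_bar. class_of m \<in> T}" by auto
    ultimately show "S \<inter> T \<subseteq> class_of ` P_bar"
      "openin (top_of_set P_bar) {m \<in> P_bar. class_of m \<in> S \<inter> T}" by auto
  next
    fix K
    assume K: "\<forall>S\<in>K. S \<subseteq> class_of ` P_bar \<and> openin (top_of_set P_bar) {m \<in> P_bar. class_of m \<in> S}"
    show "\<Union>K \<subseteq> class_of ` P_bar" using K by blast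
    have "{m \<in> P_bar. class_of m \<in> \<Union>K} = (\<Union>S\<in>K. {m \<in> P_bar. class_of m \<in> S})" by auto
    thus "openin (top_of_set P_bar) {m \<in> P_bar. class_of m \<in> \<Union>K}" using K by auto
  qed
  thus ?thesis by (simp add: class_topology_def)
qed

lemma openin_V_space: "openin class_topology V_space"
  unfolding openin_class_topology_iff
proof
  show "V_space \<subseteq> class_of ` P_bar" unfolding V_space_def P_bar_def by blast
  let ?N = "{a :: finite_adele. a \<noteq> 0} \<times> {t :: real. t \<noteq> 0}"
  have "{m \<in> P_bar. class_of m \<in> V_space} = P_bar \<inter> (\<lambda>m. m $ 1) -` ((\<lambda>v. v $ 1) -` ?N)"
    by (auto simp: P_bar_def class_of_aff_in_V_iff)
  moreover have "open ?N"
    by (intro open_Times open_finite_adele_nonzero) (simp add: open_Collect_neq)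
  ultimately show "openin (top_of_set P_bar) {m \<in> P_bar. class_of m \<in> V_space}"
    by (simp add: openin_open_Int open_vimage_vec_nth)
qed

lemma right_act_in_V:
  assumes "c \<in> V_space" "a \<noteq> 0"
  shows "right_act c (aff a b) \<in> V_space"
  using assms(1)
proof (rule V_space_cases)
  fix y x assume "c = class_of (aff y x)" "fst y \<noteq> 0" "snd y \<noteq> 0"
  thus ?thesis using assms(2) by (simp add: right_act_aff class_of_aff_in_V_iff times_prod_def)
qed

lemma right_act_mat_1: "c \<in> V_space \<Longrightarrow> right_act c (mat 1) = c"
  by (auto elim!: V_space_cases simp: mat_1_eq_aff right_act_aff times_prod_def)

text \<open>If \<open>h = (a, b)\<close> fixes the class of \<open>(y, x)\<close>, then some rational \<open>(q, r)\<close> acts on \<open>(y, x)\<close> from the left as \<open>h\<close>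
  does from the right. At the finite places \<open>h\<close> is trivial: there \<open>q y\<^sub>f = y\<^sub>f\<close>
  forces \<open>q = 1\<close>, and then \<open>r = 0\<close>. So \<open>h\<close> acts trivially at the archimedean place, where \<open>y\<close> is invertible.\<close>

lemma right_act_fixed_imp_trivial:
  assumes "c \<in> V_space" "right_act c (aff a b) = c"
  shows "a = 1 \<and> b = 0"
  using assms(1)
proof (rule V_space_cases)
  fix y x assume c: "c = class_of (aff y x)" and y: "fst y \<noteq> 0" "snd y \<noteq> 0"
  have "aff (y * (1, a)) (y * (0, b) + x) \<in> class_of (aff y x)"
    using assms(2) aff_in_class_of[of "y * (1, a)" "y * (0, b) + x"] by (simp add: c right_act_aff)
  then obtain q r where q: "y * (1, a) = adele_of_rat q * y"
    and r: "y * (0, b) + x = adele_of_rat q * x + adele_of_rat r"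
    unfolding in_class_of_aff_iff aff_inject by blast
  have "fst y = finite_adele_of_rat q * fst y"
    using arg_cong[OF q, of fst] by (simp add: times_prod_def adele_of_rat_def)
  hence "finite_adele_of_rat (q - 1) * fst y = 0"
    by (simp add: finite_adele_of_rat_hom algebra_simps)
  hence q1: "q = 1" using y by (simp add: finite_adele_of_rat_mult_eq_0_iff)
  have "finite_adele_of_rat r = finite_adele_of_rat 0"
    using arg_cong[OF r, of fst] by (simp add: times_prod_def adele_of_rat_def q1 finite_adele_of_rat_hom)
  hence r0: "r = 0" unfolding finite_adele_of_rat_inject .
  show ?thesis
    using arg_cong[OF q, of snd] arg_cong[OF r, of snd] y(2)
    by (simp add: times_prod_def adele_of_rat_def q1 r0)
qed

lemma free_right_action_V_space: "free_right_action P_plus V_space right_act"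
  unfolding free_right_action_def P_plus_def
  by (auto simp: right_act_in_V right_act_mat_1 right_act_aff_mult simp flip: mat_1_eq_aff
      dest: right_act_fixed_imp_trivial)


section \<open>Orbits\<close>

text \<open>The orbit of \<open>c\<close> with the group element \<open>(a, b)\<close> recorded as the point \<open>b + \<i> a\<close>.\<close>

definition orbit_map :: "adele_class \<Rightarrow> complex \<Rightarrow> adele_class" where
  "orbit_map c z = right_act c (aff (Im z) (Re z))"

text \<open>A change of base point acts on the coordinate by a real affine map, because left multiplication
in \<open>P\<^sub>+(\<real>)\<close> does.\<close>

lemma orbit_map_orbit_map: "orbit_map (orbit_map c w) z = orbit_map c (of_real (Im w) * z + of_real (Re w))"
  by (simp add: orbit_map_def right_act_aff_mult aff_mult)

lemma orbit_of_eq: "orbit_of c = orbit_map c ` upper_half_plane"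
proof -
  have eq: "P_plus = (\<lambda>z. aff (Im z) (Re z)) ` upper_half_plane"
  proof (intro set_eqI iffI)
    fix h assume "h \<in> P_plus"
    then obtain a b where "h = aff a b" "a > 0" unfolding P_plus_def by blast
    thus "h \<in> (\<lambda>z. aff (Im z) (Re z)) ` upper_half_plane"
      by (intro image_eqI[of _ _ "Complex b a"]) (auto simp: upper_half_plane_def)
  qed (auto simp: P_plus_def upper_half_plane_def)
  show ?thesis unfolding orbit_of_def orbit_map_def eq image_image by (rule refl)
qed

lemma orbit_map_i: "c \<in> V_space \<Longrightarrow> orbit_map c \<i> = c"
  using right_act_mat_1 by (simp add: orbit_map_def mat_1_eq_aff)

text \<open>If \<open>c h = c k\<close>, act by \<open>k\<^sup>-\<^sup>1\<close> (the point \<open>u\<close> below) and use that \<open>h k\<^sup>-\<^sup>1\<close> fixes \<open>c\<close>.\<close>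

lemma inj_on_orbit_map:
  assumes "c \<in> V_space"
  shows "inj_on (orbit_map c) upper_half_plane"
proof (rule inj_onI)
  fix z w assume zw: "z \<in> upper_half_plane" "w \<in> upper_half_plane" and eq: "orbit_map c z = orbit_map c w"
  have w: "Im w \<noteq> 0" using zw by (simp add: upper_half_plane_def)
  let ?u = "Complex (- Re w / Im w) (1 / Im w)"
  have "orbit_map (orbit_map c z) ?u = orbit_map (orbit_map c w) ?u" using eq by simp
  moreover have "of_real (Im w) * ?u + of_real (Re w) = \<i>" using w by (simp add: complex_eq_iff)
  ultimately have "orbit_map c (of_real (Im z) * ?u + of_real (Re z)) = c"
    using orbit_map_i[OF assms] by (simp add: orbit_map_orbit_map)
  hence "Im z / Im w = 1 \<and> Re z - Im z * Re w / Im w = 0"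
    using right_act_fixed_imp_trivial[OF assms] unfolding orbit_map_def by fastforce
  thus "z = w" using w by (auto simp: complex_eq_iff field_simps)
qed

lemma matrix_exp_gen_X: "matrix_exp (t *\<^sub>R gen_X) = aff 1 t"
proof -
  let ?M = "t *\<^sub>R gen_X"
  let ?P = "\<lambda>n. ((\<lambda>B. ?M ** B) ^^ n) (mat 1)"
  (* The generator X is nilpotent, so the exponential series has two terms. *)
  have MM: "?M ** ?M = 0"
    by (simp add: vec_eq_iff forall_2 matrix_matrix_mult_def sum_2 gen_X_def)
  have P2: "?P (Suc (Suc n)) = 0" for n
    by (induction n) (use MM in \<open>auto simp: matrix_mul_assoc\<close>)
  have "matrix_exp ?M = (\<Sum>n\<in>{0, Suc 0}. (1 / fact n) *\<^sub>R ?P n)"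
    unfolding matrix_exp_def
  proof (rule suminf_finite)
    fix n :: nat assume "n \<notin> {0, Suc 0}"
    then obtain m where "n = Suc (Suc m)" by (metis insert_iff not0_implies_Suc)
    thus "(1 / fact n) *\<^sub>R ?P n = 0" using P2 by simp
  qed simp
  also have "\<dots> = aff 1 t"
    by (simp add: vec_eq_iff forall_2 matrix_matrix_mult_def sum_2 gen_X_def mat_1_eq_aff)
  finally show ?thesis .
qed

lemma matrix_exp_gen_Y: "matrix_exp (t *\<^sub>R gen_Y) = aff (exp t) 0"
proof -
  let ?P = "\<lambda>n. ((\<lambda>B. (t *\<^sub>R gen_Y) ** B) ^^ n) (mat 1)"
  (* The generator Y is a projection: its powers are Y, and only the term n = 0 differs. *)
  have P: "?P n = t ^ n *\<^sub>R gen_Y + (if n = 0 then mat 1 - gen_Y else 0)" for n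
  proof (induction n)
    case (Suc n)
    then show ?case
      by (cases n) (auto simp: vec_eq_iff forall_2 matrix_matrix_mult_def sum_2 gen_Y_def mat_1_eq_aff)
  qed simp
  have "(\<lambda>n. (t ^ n /\<^sub>R fact n) *\<^sub>R gen_Y + (if n = 0 then mat 1 - gen_Y else 0))
      sums (exp t *\<^sub>R gen_Y + (mat 1 - gen_Y))"
    by (intro sums_add sums_scaleR_left exp_converges sums_single)
  also have "(\<lambda>n. (t ^ n /\<^sub>R fact n) *\<^sub>R gen_Y + (if n = 0 then mat 1 - gen_Y else 0))
      = (\<lambda>n. (1 / fact n) *\<^sub>R ?P n)"
    by (auto simp: fun_eq_iff P scaleR_add_right divide_inverse mult.commute)
  finally have "matrix_exp (t *\<^sub>R gen_Y) = exp t *\<^sub>R gen_Y + (mat 1 - gen_Y)"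
    unfolding matrix_exp_def by (rule sums_unique[symmetric])
  also have "\<dots> = aff (exp t) 0"
    by (simp add: vec_eq_iff forall_2 gen_Y_def mat_1_eq_aff)
  finally show ?thesis .
qed

lemma flow_gen_X: "flow gen_X (orbit_map c z) t = orbit_map c (z + of_real (t * Im z))"
  by (simp add: flow_def matrix_exp_gen_X orbit_map_def right_act_aff_mult aff_mult mult.commute add.commute)

lemma flow_gen_Y: "flow gen_Y (orbit_map c z) t = orbit_map c (Complex (Re z) (exp t * Im z))"
  by (simp add: flow_def matrix_exp_gen_Y orbit_map_def right_act_aff_mult aff_mult mult.commute)

text \<open>An orbit seen through its coordinate in the upper half plane. The base point only matters up to the
  real affine maps \<open>z \<mapsto> a z + b\<close>, \<open>a > 0\<close>, so every chart of the orbit is such a map of one coordinate.\<close>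

locale parametrized_orbit =
  fixes Q :: "adele_class set" and \<Psi> :: "complex \<Rightarrow> adele_class"
  assumes bij: "bij_betw \<Psi> upper_half_plane Q"
    and atlas_eq: "orbit_atlas Q =
      {(Q, restrict (\<lambda>c. (inv_into upper_half_plane \<Psi> c - of_real b) / of_real a) Q) | a b. a > 0}"
    and flow_X: "z \<in> upper_half_plane \<Longrightarrow> flow gen_X (\<Psi> z) t = \<Psi> (z + of_real (t * Im z))"
    and flow_Y: "z \<in> upper_half_plane \<Longrightarrow> flow gen_Y (\<Psi> z) t = \<Psi> (Complex (Re z) (exp t * Im z))"

lemma affine_mem_half_plane_iff:
  "a > 0 \<Longrightarrow> of_real a * z + of_real b \<in> upper_half_plane \<longleftrightarrow> z \<in> upper_half_plane"
  by (simp add: upper_half_plane_def zero_less_mult_iff)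

lemma orbit_subset_V: "c \<in> V_space \<Longrightarrow> orbit_of c \<subseteq> V_space"
  by (auto simp: orbit_of_eq orbit_map_def upper_half_plane_def intro!: right_act_in_V)

lemma orbit_of_eq_of_mem:
  assumes "c \<in> orbit_of c'"
  shows "orbit_of c = orbit_of c'"
proof -
  obtain w where w: "w \<in> upper_half_plane" "c = orbit_map c' w"
    using assms unfolding orbit_of_eq by blast
  let ?f = "\<lambda>z. of_real (Im w) * z + of_real (Re w)"
  have a: "Im w > 0" using w by (simp add: upper_half_plane_def)
  have "?f ` upper_half_plane = upper_half_plane"
  proof (intro set_eqI iffI)
    fix z assume z: "z \<in> upper_half_plane"
    have "z = ?f ((z - of_real (Re w)) / of_real (Im w))" using a by simp
    thus "z \<in> ?f ` upper_half_plane"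
      using affine_mem_half_plane_iff[OF a] z by (metis imageI)
  qed (use affine_mem_half_plane_iff[OF a] in auto)
  thus ?thesis
    unfolding orbit_of_eq w(2) orbit_map_orbit_map by (metis (no_types, lifting) image_cong image_image)
qed

lemma parametrized_orbit_orbit_map:
  assumes Q: "Q \<in> orbit_of ` V_space" and c: "c \<in> Q"
  shows "parametrized_orbit Q (orbit_map c)"
proof
  obtain c' where c': "c' \<in> V_space" "Q = orbit_of c'" using Q by blast
  have cV: "c \<in> V_space" using c c' orbit_subset_V by blast
  have Qc: "Q = orbit_of c" using c c' orbit_of_eq_of_mem by blast
  let ?H = upper_half_plane
  show bij: "bij_betw (orbit_map c) ?H Q"
    by (simp add: bij_betw_def inj_on_orbit_map[OF cV] Qc orbit_of_eq)
  show "flow gen_X (orbit_map c z) t = orbit_map c (z + of_real (t * Im z))"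
    "flow gen_Y (orbit_map c z) t = orbit_map c (Complex (Re z) (exp t * Im z))" for z t
    by (rule flow_gen_X flow_gen_Y)+
  let ?\<phi> = "inv_into ?H (orbit_map c)"
  have coord: "restrict (inv_into ?H (orbit_map (orbit_map c w))) Q
      = restrict (\<lambda>d. (?\<phi> d - of_real (Re w)) / of_real (Im w)) Q" if w: "w \<in> ?H" for w
  proof (rule restrict_ext)
    fix d assume d: "d \<in> Q"
    have a: "Im w > 0" using w by (simp add: upper_half_plane_def)
    let ?z = "(?\<phi> d - of_real (Re w)) / of_real (Im w)"
    have phi: "?\<phi> d \<in> ?H" "orbit_map c (?\<phi> d) = d"
      using d bij by (auto simp: bij_betw_def inv_into_into f_inv_into_f)
    have e: "of_real (Im w) * ?z + of_real (Re w) = ?\<phi> d" using a by simp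
    have "?z \<in> ?H" using affine_mem_half_plane_iff[OF a, of ?z "Re w"] phi(1) unfolding e by simp
    moreover have "orbit_map (orbit_map c w) ?z = d"
      unfolding orbit_map_orbit_map e by (rule phi(2))
    moreover have "orbit_map c w \<in> V_space"
      using w a cV by (auto simp: orbit_map_def intro!: right_act_in_V)
    ultimately show "inv_into ?H (orbit_map (orbit_map c w)) d = ?z"
      using inv_into_f_f[OF inj_on_orbit_map] by metis
  qed
  have "orbit_atlas Q = (\<lambda>d. (Q, restrict (inv_into ?H (orbit_map d)) Q)) ` Q"
    unfolding orbit_atlas_def orbit_map_def[abs_def] by blast
  also have "\<dots> = (\<lambda>w. (Q, restrict (inv_into ?H (orbit_map (orbit_map c w))) Q)) ` ?H"
    by (subst (3) Qc) (simp only: orbit_of_eq image_image)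
  also have "\<dots> = (\<lambda>w. (Q, restrict (\<lambda>d. (?\<phi> d - of_real (Re w)) / of_real (Im w)) Q)) ` ?H"
    by (rule image_cong) (simp_all add: coord)
  also have "\<dots> = {(Q, restrict (\<lambda>d. (?\<phi> d - of_real b) / of_real a) Q) | a b. a > 0}"
  proof (intro set_eqI iffI)
    fix ch assume "ch \<in> {(Q, restrict (\<lambda>d. (?\<phi> d - of_real b) / of_real a) Q) | a b. a > 0}"
    then obtain a b where "a > 0" "ch = (Q, restrict (\<lambda>d. (?\<phi> d - of_real b) / of_real a) Q)" by blast
    thus "ch \<in> (\<lambda>w. (Q, restrict (\<lambda>d. (?\<phi> d - of_real (Re w)) / of_real (Im w)) Q)) ` ?H"
      by (intro image_eqI[of _ _ "Complex b a"]) (auto simp: upper_half_plane_def)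
  qed (auto simp: upper_half_plane_def)
  finally show "orbit_atlas Q = {(Q, restrict (\<lambda>d. (?\<phi> d - of_real b) / of_real a) Q) | a b. a > 0}" .
qed


section \<open>Charts and the half plane\<close>

lemma open_upper_half_plane: "open upper_half_plane"
  unfolding upper_half_plane_def by (rule open_halfspace_Im_gt)

lemma smooth_on_inverse_Im: "smooth_on (\<lambda>z. inverse (Im z)) upper_half_plane"
  by (rule smooth_on_compose[where T = "- {0}", OF open_upper_half_plane smooth_on_inverse
        smooth_on_bounded_linear[OF bounded_linear_Im open_upper_half_plane
          smooth_on_id[OF open_upper_half_plane]]])
     (auto simp: upper_half_plane_def)

lemma second_countable_euclidean_subspace:
  "second_countable (top_of_set (S :: 'a::second_countable_topology set))"
proof -
  obtain B :: "'a set set" where B: "countable B" "topological_basis B"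
    using ex_countable_basis by blast
  have "second_countable (euclidean :: 'a topology)"
    unfolding second_countable_def
  proof (intro exI[of _ B] conjI ballI allI impI)
    show "openin euclidean V" if "V \<in> B" for V
      using topological_basis_open[OF B(2) that] by simp
    fix U :: "'a set" and x assume "openin euclidean U \<and> x \<in> U"
    thus "\<exists>V\<in>B. x \<in> V \<and> V \<subseteq> U"
      using topological_basisE[OF B(2), of U x] by (metis open_openin)
  qed (rule B(1))
  thus ?thesis by (rule second_countable_subtopology)
qed

lemma ball_chart_iff: "(\<forall>(U, \<kappa>)\<in>C. P U \<kappa>) \<longleftrightarrow> (\<forall>U \<kappa>. (U, \<kappa>) \<in> C \<longrightarrow> P U \<kappa>)"
  by auto

lemma is_atlas_holomorphic_imp_smooth: "is_atlas (holomorphic_on) C \<Longrightarrow> is_atlas smooth_on C"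
  unfolding is_atlas_def ball_chart_iff using holomorphic_imp_smooth_on by blast

lemma partial_eq:
  assumes "(h has_derivative D) (at z)"
  shows "partial v h z = D v"
proof -
  have "((\<lambda>t. z + of_real t * v) has_derivative (\<lambda>s. of_real s * v)) (at 0)"
    by (auto intro!: derivative_eq_intros)
  moreover have "(h has_derivative D) (at (z + of_real 0 * v))" using assms by simp
  ultimately have "((\<lambda>t. h (z + of_real t * v)) has_derivative (\<lambda>s. D (of_real s * v))) (at 0)"
    by (rule has_derivative_compose)
  moreover have "D (of_real s * v) = s *\<^sub>R D v" for s
    using linear_cmul[OF has_derivative_linear[OF assms], of s v] by (simp add: scaleR_conv_of_real)
  ultimately have "((\<lambda>t. h (z + of_real t * v)) has_vector_derivative D v) (at 0)"
    by (simp add: has_vector_derivative_def)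
  thus ?thesis unfolding partial_def by (rule vector_derivative_at)
qed

lemma real_linear_complex_eq:
  fixes D :: "complex \<Rightarrow> complex"
  assumes "linear D"
  shows "D h = of_real (Re h) * D 1 + of_real (Im h) * D \<i>"
proof -
  have "h = Re h *\<^sub>R 1 + Im h *\<^sub>R \<i>" by (simp add: complex_eq_iff)
  hence "D h = D (Re h *\<^sub>R 1 + Im h *\<^sub>R \<i>)" by simp
  also have "\<dots> = of_real (Re h) * D 1 + of_real (Im h) * D \<i>"
    unfolding linear_add[OF assms] linear_cmul[OF assms] by (simp add: scaleR_conv_of_real)
  finally show ?thesis .
qed

lemma cauchy_riemann_imp_field_derivative:
  fixes F :: "complex \<Rightarrow> complex"
  assumes "(F has_derivative D) (at z)" "D 1 + \<i> * D \<i> = 0"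
  shows "(F has_field_derivative D 1) (at z)"
proof -
  have "\<i> * (D 1 + \<i> * D \<i>) = 0" using assms(2) by simp
  hence Di: "D \<i> = \<i> * D 1" by (simp add: algebra_simps)
  have "D h = D 1 * h" for h
    unfolding real_linear_complex_eq[OF has_derivative_linear[OF assms(1)], of h] Di
    by (subst (3) complex_eq[of h]) (simp add: algebra_simps)
  hence "D = (*) (D 1)" by (rule ext)
  thus ?thesis using assms(1) by (simp add: has_field_derivative_def)
qed


section \<open>Integration against the hyperbolic volume\<close>

text \<open>The measure \<open>dx dy / y\<^sup>2\<close> is invariant under \<open>z \<mapsto> a z + b\<close>: the Jacobian \<open>a\<^sup>2\<close> cancels the change of the density.
This makes the volume independent of the chart.\<close>

lemma nn_integral_hyperbolic_affine:
  fixes a b :: real and S :: "complex set"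
  assumes a: "a > 0" and S: "S \<in> sets borel"
  shows "(\<integral>\<^sup>+z\<in>(\<lambda>z. of_real a * z + of_real b) -` S. ennreal (1 / (Im z)\<^sup>2) \<partial>lborel)
       = (\<integral>\<^sup>+z\<in>S. ennreal (1 / (Im z)\<^sup>2) \<partial>lborel)"
proof -
  have Im_meas [measurable]: "Im \<in> borel_measurable borel"
    by (intro borel_measurable_continuous_onI continuous_intros)
  let ?T = "\<lambda>z. of_real b + a *\<^sub>R z :: complex"
  have [measurable]: "?T \<in> borel_measurable borel"
    by (intro borel_measurable_continuous_onI continuous_intros)
  let ?f = "\<lambda>z. ennreal (1 / (Im z)\<^sup>2) * indicator S z"
  have f [measurable]: "?f \<in> borel_measurable borel" using S by measurable
  have "(\<integral>\<^sup>+z. ?f z \<partial>lborel)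
      = (\<integral>\<^sup>+z. ?f z \<partial>(density (distr lborel borel ?T) (\<lambda>_. \<bar>a\<bar> ^ DIM(complex))))"
    using a by (subst lborel_affine[where c = a and t = "of_real b"]) auto
  also have "\<dots> = (\<integral>\<^sup>+z. ennreal (a\<^sup>2) * ?f (?T z) \<partial>lborel)"
    by (subst nn_integral_density) (simp_all add: nn_integral_distr)
  also have "\<dots> = (\<integral>\<^sup>+z\<in>(\<lambda>z. of_real a * z + of_real b) -` S. ennreal (1 / (Im z)\<^sup>2) \<partial>lborel)"
  proof (rule nn_integral_cong)
    fix z
    have "ennreal (a\<^sup>2) * ennreal (1 / (Im (?T z))\<^sup>2) = ennreal (1 / (Im z)\<^sup>2)"
      using a by (simp add: power_mult_distrib flip: ennreal_mult)
    moreover have "indicator S (?T z) = (indicator ((\<lambda>z. of_real a * z + of_real b) -` S) z :: ennreal)"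
      by (simp add: indicator_def scaleR_conv_of_real add.commute)
    ultimately show "ennreal (a\<^sup>2) * ?f (?T z)
        = ennreal (1 / (Im z)\<^sup>2) * indicator ((\<lambda>z. of_real a * z + of_real b) -` S) z"
      by (simp add: mult.assoc[symmetric])
  qed
  finally show ?thesis ..
qed

text \<open>Otherwise the function would be nonzero on a nonempty open set, and such a set is not negligible.\<close>

lemma continuous_nonneg_integral_0_imp_0:
  fixes G :: "complex \<Rightarrow> real"
  assumes "integrable lborel G" "\<And>z. G z \<ge> 0" "integral\<^sup>L lborel G = 0"
    and "continuous_on S G" "open S" "z \<in> S"
  shows "G z = 0"
proof (rule ccontr)
  assume "G z \<noteq> 0"
  define T where "T = S \<inter> G -` (- {0})"
  have "open (- {0 :: real})" by (simp add: open_Compl)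
  hence T: "open T" unfolding T_def by (rule continuous_open_preimage[OF assms(4,5)])
  have "AE z in lborel. G z = 0"
    using integral_nonneg_eq_0_iff_AE[OF assms(1)] assms(2,3) by simp
  hence "AE z in lborel. z \<notin> T" by eventually_elim (simp add: T_def)
  hence "T \<in> null_sets lborel" using T by (simp add: AE_iff_null_sets)
  hence "negligible T" by (simp add: negligible_iff_null_sets null_sets_completionI)
  moreover have "T \<noteq> {}" using \<open>G z \<noteq> 0\<close> assms(6) by (auto simp: T_def)
  ultimately show False using open_not_negligible[OF T] by blast
qed

lemma integrable_hyperbolic_compact_support:
  fixes g :: "complex \<Rightarrow> 'b::euclidean_space"
  assumes "continuous_on upper_half_plane g" "compact K" "K \<subseteq> upper_half_plane"
    "\<And>z. z \<in> upper_half_plane - K \<Longrightarrow> g z = 0"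
  shows "integrable lborel (\<lambda>z. (indicator upper_half_plane z / (Im z)\<^sup>2) *\<^sub>R g z)"
proof (rule integrable_compact_support[OF _ assms(2)])
  have "continuous_on K (\<lambda>z. (1 / (Im z)\<^sup>2) *\<^sub>R g z)"
    using assms(3) by (intro continuous_intros continuous_on_subset[OF assms(1)])
      (auto simp: upper_half_plane_def)
  thus "continuous_on K (\<lambda>z. (indicator upper_half_plane z / (Im z)\<^sup>2) *\<^sub>R g z)"
    using assms(3) by (subst continuous_on_cong[OF refl, of _ _ "\<lambda>z. (1 / (Im z)\<^sup>2) *\<^sub>R g z"]) auto
qed (use assms(4) in \<open>auto simp: indicator_def\<close>)


section \<open>The smooth structure of an orbit\<close>

context parametrized_orbit
begin

abbreviation \<phi> where "\<phi> \<equiv> inv_into upper_half_plane \<Psi>"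
abbreviation A where "A \<equiv> orbit_atlas Q"

lemma \<Psi>_in [simp]: "z \<in> upper_half_plane \<Longrightarrow> \<Psi> z \<in> Q"
  using bij by (auto simp: bij_betw_def)

lemma \<phi>_in [simp]: "c \<in> Q \<Longrightarrow> \<phi> c \<in> upper_half_plane"
  using bij by (auto simp: bij_betw_def inv_into_into)

lemma \<phi>_\<Psi> [simp]: "z \<in> upper_half_plane \<Longrightarrow> \<phi> (\<Psi> z) = z"
  using bij by (simp add: bij_betw_def inv_into_f_f)

lemma \<Psi>_\<phi> [simp]: "c \<in> Q \<Longrightarrow> \<Psi> (\<phi> c) = c"
  using bij by (simp add: bij_betw_def f_inv_into_f)

lemma Im_\<phi>_pos [simp]: "c \<in> Q \<Longrightarrow> Im (\<phi> c) > 0"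
  using \<phi>_in by (auto simp: upper_half_plane_def)

lemma inj_on_\<phi>: "inj_on \<phi> Q"
  by (rule inj_on_inverseI[where g = \<Psi>]) simp

lemma \<phi>_image: "\<phi> ` Q = upper_half_plane"
proof (intro set_eqI iffI)
  fix z assume "z \<in> upper_half_plane"
  thus "z \<in> \<phi> ` Q" by (intro image_eqI[of _ _ "\<Psi> z"]) auto
qed auto

lemma \<phi>_image_subset: "W \<subseteq> Q \<Longrightarrow> \<phi> ` W \<subseteq> upper_half_plane"
  by auto

lemma mem_\<phi>_image_iff: "W \<subseteq> Q \<Longrightarrow> z \<in> upper_half_plane \<Longrightarrow> z \<in> \<phi> ` W \<longleftrightarrow> \<Psi> z \<in> W"
proof
  assume "W \<subseteq> Q" "z \<in> \<phi> ` W"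
  thus "\<Psi> z \<in> W" by auto
next
  assume "z \<in> upper_half_plane" "\<Psi> z \<in> W"
  thus "z \<in> \<phi> ` W" by (intro image_eqI[of _ _ "\<Psi> z"]) auto
qed

lemma \<phi>_image_Int: "S \<subseteq> Q \<Longrightarrow> T \<subseteq> Q \<Longrightarrow> \<phi> ` (S \<inter> T) = \<phi> ` S \<inter> \<phi> ` T"
  by (rule inj_on_image_Int[OF inj_on_\<phi>])

text \<open>The chart whose base point has the coordinate \<open>b + \<i> a\<close>.\<close>

definition affine_chart :: "real \<Rightarrow> real \<Rightarrow> (adele_class \<Rightarrow> complex) \<Rightarrow> bool" where
  "affine_chart a b \<kappa> \<longleftrightarrow> a > 0 \<and> \<kappa> = restrict (\<lambda>c. (\<phi> c - of_real b) / of_real a) Q"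

lemma mem_atlas_iff: "(U, \<kappa>) \<in> A \<longleftrightarrow> U = Q \<and> (\<exists>a b. affine_chart a b \<kappa>)"
  unfolding atlas_eq affine_chart_def by blast

lemma atlasE:
  assumes "(U, \<kappa>) \<in> A"
  obtains a b where "U = Q" "affine_chart a b \<kappa>"
  using assms unfolding mem_atlas_iff by blast

lemma affine_chartD:
  assumes "affine_chart a b \<kappa>"
  shows "a > 0" "\<And>c. c \<in> Q \<Longrightarrow> of_real a * \<kappa> c + of_real b = \<phi> c"
    "\<And>z. z \<in> upper_half_plane \<Longrightarrow> inv_into Q \<kappa> z = \<Psi> (of_real a * z + of_real b)"
    "\<And>z. z \<in> upper_half_plane \<Longrightarrow> of_real a * z + of_real b \<in> upper_half_plane"
    "inj_on \<kappa> Q" "\<kappa> \<in> extensional Q" "\<kappa> ` Q = upper_half_plane"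
    "\<And>W. W \<subseteq> Q \<Longrightarrow> \<kappa> ` W = (\<lambda>z. of_real a * z + of_real b) -` (\<phi> ` W)"
proof -
  show a: "a > 0" using assms by (simp add: affine_chart_def)
  have val: "\<kappa> c = (\<phi> c - of_real b) / of_real a" if "c \<in> Q" for c
    using that assms by (simp add: affine_chart_def)
  show aff: "of_real a * \<kappa> c + of_real b = \<phi> c" if "c \<in> Q" for c
    using a by (simp add: val[OF that])
  show inj: "inj_on \<kappa> Q"
    by (rule inj_on_inverseI[where g = "\<lambda>z. \<Psi> (of_real a * z + of_real b)"]) (simp add: aff)
  show in_H: "of_real a * z + of_real b \<in> upper_half_plane" if "z \<in> upper_half_plane" for z
    using affine_mem_half_plane_iff[OF a] that by blast
  show "inv_into Q \<kappa> z = \<Psi> (of_real a * z + of_real b)" if "z \<in> upper_half_plane" for z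
    using inv_into_f_f[OF inj, of "\<Psi> (of_real a * z + of_real b)"] in_H[OF that] a by (simp add: val)
  show "\<kappa> \<in> extensional Q" using assms by (simp add: affine_chart_def)
  show img: "\<kappa> ` W = (\<lambda>z. of_real a * z + of_real b) -` (\<phi> ` W)" if "W \<subseteq> Q" for W
  proof (intro set_eqI iffI)
    fix z assume "z \<in> (\<lambda>z. of_real a * z + of_real b) -` (\<phi> ` W)"
    then obtain c where c: "c \<in> W" "of_real a * z + of_real b = \<phi> c" by auto
    have "of_real a * \<kappa> c + of_real b = of_real a * z + of_real b"
      using aff[of c] c that by auto
    hence "\<kappa> c = z" using a by simp
    thus "z \<in> \<kappa> ` W" using c(1) by blast
  next
    fix z assume "z \<in> \<kappa> ` W"
    thus "z \<in> (\<lambda>z. of_real a * z + of_real b) -` (\<phi> ` W)" using that aff by auto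
  qed
  show "\<kappa> ` Q = upper_half_plane"
    unfolding img[OF order_refl] \<phi>_image using affine_mem_half_plane_iff[OF a, of _ b] by auto
qed

lemma base_chart: "(Q, restrict \<phi> Q) \<in> A"
proof -
  have "affine_chart 1 0 (restrict \<phi> Q)" by (simp add: affine_chart_def)
  thus ?thesis unfolding mem_atlas_iff by blast
qed

lemma inv_base_chart: "z \<in> upper_half_plane \<Longrightarrow> inv_into Q (restrict \<phi> Q) z = \<Psi> z"
  using inv_into_f_f[of "restrict \<phi> Q" Q "\<Psi> z"] inj_on_\<phi> by simp

lemma points_atlas: "points A = Q"
proof -
  have "fst ch = Q" if "ch \<in> A" for ch using that unfolding atlas_eq by auto
  hence "fst ` A = {Q}" using base_chart by (auto simp: image_iff intro!: bexI[OF _ base_chart])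
  thus ?thesis by (simp add: points_def split_beta)
qed

lemma open_chart_image_iff:
  assumes "W \<subseteq> Q"
  shows "(\<forall>(U, \<kappa>)\<in>A. open (\<kappa> ` (U \<inter> W))) \<longleftrightarrow> open (\<phi> ` W)"
  unfolding ball_chart_iff
proof
  assume "\<forall>U \<kappa>. (U, \<kappa>) \<in> A \<longrightarrow> open (\<kappa> ` (U \<inter> W))"
  hence "open (restrict \<phi> Q ` (Q \<inter> W))" using base_chart by blast
  moreover have "restrict \<phi> Q ` (Q \<inter> W) = \<phi> ` W" using assms by (auto simp: Int_absorb1)
  ultimately show "open (\<phi> ` W)" by simp
next
  assume W: "open (\<phi> ` W)"
  have "open (\<kappa> ` (U \<inter> W))" if ch: "(U, \<kappa>) \<in> A" for U \<kappa>
  proof -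
    obtain a b where "U = Q" "affine_chart a b \<kappa>" by (rule atlasE[OF ch])
    moreover from this(2) have "\<kappa> ` W = (\<lambda>z. of_real a * z + of_real b) -` (\<phi> ` W)"
      by (rule affine_chartD(8)[OF _ assms])
    moreover have "open ((\<lambda>z. of_real a * z + of_real b) -` (\<phi> ` W))"
      by (rule open_vimage[OF W]) (intro continuous_intros)
    ultimately show ?thesis using assms by (simp add: Int_absorb1)
  qed
  thus "\<forall>U \<kappa>. (U, \<kappa>) \<in> A \<longrightarrow> open (\<kappa> ` (U \<inter> W))" by blast
qed

lemma openin_iff: "openin (surface_topology A) W \<longleftrightarrow> W \<subseteq> Q \<and> open (\<phi> ` W)"
proof -
  have "istopology (\<lambda>W. W \<subseteq> Q \<and> open (\<phi> ` W))"
    unfolding istopology_def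
  proof (intro conjI allI impI)
    fix S T assume *: "S \<subseteq> Q \<and> open (\<phi> ` S)" "T \<subseteq> Q \<and> open (\<phi> ` T)"
    thus "S \<inter> T \<subseteq> Q" by blast
    have "\<phi> ` (S \<inter> T) = \<phi> ` S \<inter> \<phi> ` T" using * by (intro \<phi>_image_Int) auto
    thus "open (\<phi> ` (S \<inter> T))" using * by (simp add: open_Int)
  next
    fix K assume *: "\<forall>S\<in>K. S \<subseteq> Q \<and> open (\<phi> ` S)"
    thus "\<Union>K \<subseteq> Q" by blast
    show "open (\<phi> ` \<Union>K)" unfolding image_Union using * by blast
  qed
  moreover have "(\<lambda>W. W \<subseteq> points A \<and> (\<forall>(U, \<kappa>)\<in>A. open (\<kappa> ` (U \<inter> W))))
      = (\<lambda>W. W \<subseteq> Q \<and> open (\<phi> ` W))"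
    unfolding points_atlas
    by (rule ext, rule conj_cong[OF refl]) (rule open_chart_image_iff)
  ultimately show ?thesis by (simp add: surface_topology_def)
qed

lemma openin_Q: "openin (surface_topology A) Q"
  by (simp add: openin_iff \<phi>_image open_upper_half_plane)

lemma topspace_Q: "topspace (surface_topology A) = Q"
proof (rule subset_antisym)
  show "topspace (surface_topology A) \<subseteq> Q"
    using openin_topspace[of "surface_topology A"] unfolding openin_iff by blast
qed (rule openin_subset[OF openin_Q])

lemma homeomorphic_half_plane:
  "homeomorphic_maps (surface_topology A) (top_of_set upper_half_plane) \<phi> \<Psi>"
  unfolding homeomorphic_maps_def
proof (intro conjI ballI)
  show "continuous_map (surface_topology A) (top_of_set upper_half_plane) \<phi>"
    unfolding continuous_map
  proof (intro conjI allI impI)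
    fix U assume "openin (top_of_set upper_half_plane) U"
    hence U: "open U" "U \<subseteq> upper_half_plane"
      by (simp_all add: openin_open_eq[OF open_upper_half_plane])
    have "\<phi> ` {x \<in> Q. \<phi> x \<in> U} = U"
    proof (intro set_eqI iffI)
      fix z assume "z \<in> U"
      thus "z \<in> \<phi> ` {x \<in> Q. \<phi> x \<in> U}" using U(2) by (intro image_eqI[of _ _ "\<Psi> z"]) auto
    qed auto
    thus "openin (surface_topology A) {x \<in> topspace (surface_topology A). \<phi> x \<in> U}"
      using U by (auto simp: openin_iff topspace_Q)
  qed (auto simp: topspace_Q)
  show "continuous_map (top_of_set upper_half_plane) (surface_topology A) \<Psi>"
    unfolding continuous_map
  proof (intro conjI allI impI)
    fix W assume "openin (surface_topology A) W"
    hence W: "W \<subseteq> Q" "open (\<phi> ` W)" by (auto simp: openin_iff)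
    hence "{z \<in> upper_half_plane. \<Psi> z \<in> W} = \<phi> ` W"
    proof (intro set_eqI)
      fix z
      show "z \<in> {z \<in> upper_half_plane. \<Psi> z \<in> W} \<longleftrightarrow> z \<in> \<phi> ` W"
        using mem_\<phi>_image_iff[OF W(1), of z] \<phi>_image_subset[OF W(1)]
        by (cases "z \<in> upper_half_plane") auto
    qed
    thus "openin (top_of_set upper_half_plane) {x \<in> topspace (top_of_set upper_half_plane). \<Psi> x \<in> W}"
      using W(2) \<phi>_image_subset[OF W(1)] by (simp add: openin_open_eq[OF open_upper_half_plane])
  qed (auto simp: topspace_Q)
qed (auto simp: topspace_Q)

lemma atlas_holomorphic: "is_atlas (holomorphic_on) A"
proof -
  have "(\<kappa>' \<circ> inv_into U \<kappa>) holomorphic_on (\<kappa> ` (U \<inter> U'))"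
    if ch: "(U, \<kappa>) \<in> A" and ch': "(U', \<kappa>') \<in> A" for U \<kappa> U' \<kappa>'
  proof -
    obtain a b where 1: "U = Q" "affine_chart a b \<kappa>" by (rule atlasE[OF ch])
    obtain a' b' where 2: "U' = Q" "affine_chart a' b' \<kappa>'" by (rule atlasE[OF ch'])
    note k = affine_chartD[OF 1(2)] and k' = affine_chartD[OF 2(2)]
    have "(\<lambda>z. (of_real a * z + of_real b - of_real b') / of_real a') holomorphic_on upper_half_plane"
      using k'(1) by (intro holomorphic_intros) auto
    moreover have "(of_real a * z + of_real b - of_real b') / of_real a' = (\<kappa>' \<circ> inv_into U \<kappa>) z"
      if "z \<in> upper_half_plane" for z
      using k(4)[OF that] k'(1) k'(2)[of "\<Psi> (of_real a * z + of_real b)"] that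
      by (simp add: 1(1) k(3) field_simps)
    ultimately have "(\<kappa>' \<circ> inv_into U \<kappa>) holomorphic_on upper_half_plane"
      by (rule holomorphic_transform)
    thus ?thesis by (simp add: 1(1) k(7) 2(1))
  qed
  moreover have "inj_on \<kappa> U \<and> \<kappa> \<in> extensional U" if "(U, \<kappa>) \<in> A" for U \<kappa>
    by (rule atlasE[OF that]) (simp add: affine_chartD)
  moreover have "open (\<kappa> ` (U \<inter> U'))" if "(U, \<kappa>) \<in> A" "(U', \<kappa>') \<in> A" for U \<kappa> U' \<kappa>'
  proof -
    have "U = Q" "U' = Q" using that by (simp_all add: mem_atlas_iff)
    moreover have "\<kappa> ` Q = upper_half_plane"
      by (rule atlasE[OF that(1)]) (rule affine_chartD(7))
    ultimately show ?thesis by (simp add: open_upper_half_plane)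
  qed
  ultimately show ?thesis unfolding is_atlas_def ball_chart_iff by blast
qed

lemma smooth_surface_orbit: "smooth_surface A"
proof -
  have h: "surface_topology A homeomorphic_space top_of_set upper_half_plane"
    using homeomorphic_half_plane by (auto simp: homeomorphic_space_def)
  have "Hausdorff_space (surface_topology A)"
    using homeomorphic_Hausdorff_space[OF h] Hausdorff_space_subtopology[OF Hausdorff_space_euclidean] by blast
  moreover have "second_countable (surface_topology A)"
    using homeomorphic_space_second_countability[OF h] second_countable_euclidean_subspace by blast
  ultimately show ?thesis
    using is_atlas_holomorphic_imp_smooth[OF atlas_holomorphic] by (simp add: smooth_surface_def)
qed

lemma smooth_on_chart_iff:
  assumes "(U, \<kappa>) \<in> A" "W \<subseteq> Q" "open (\<phi> ` W)" "smooth_on (f \<circ> \<Psi>) (\<phi> ` W)"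
  shows "smooth_on (f \<circ> inv_into U \<kappa>) (\<kappa> ` (U \<inter> W))"
proof -
  obtain a b where U: "U = Q" and "affine_chart a b \<kappa>" by (rule atlasE[OF assms(1)])
  note k = affine_chartD[OF this(2)]
  let ?h = "\<lambda>z. of_real a * z + of_real b :: complex"
  have op: "open (\<kappa> ` W)"
    unfolding k(8)[OF assms(2)] by (rule open_vimage[OF assms(3)]) (intro continuous_intros)
  have "smooth_on ?h (\<kappa> ` W)"
    by (intro holomorphic_imp_smooth_on[OF op] holomorphic_intros)
  hence "smooth_on (\<lambda>z. (f \<circ> \<Psi>) (?h z)) (\<kappa> ` W)"
    by (rule smooth_on_compose[OF op assms(4)]) (auto simp: k(8)[OF assms(2)])
  hence "smooth_on (f \<circ> inv_into Q \<kappa>) (\<kappa> ` W)"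
  proof (rule smooth_on_cong[OF op])
    fix z assume "z \<in> \<kappa> ` W"
    hence "z \<in> upper_half_plane" using k(7) assms(2) by blast
    thus "(f \<circ> \<Psi>) (?h z) = (f \<circ> inv_into Q \<kappa>) z" using k(3) by simp
  qed
  thus ?thesis using assms(2) by (simp add: U Int_absorb1)
qed

text \<open>The other charts differ from \<open>\<phi>\<close> by affine maps, so smoothness needs to be tested in \<open>\<phi>\<close> only.\<close>

lemma smooth_fun_iff:
  assumes "W \<subseteq> Q" "open (\<phi> ` W)"
  shows "smooth_fun A W f \<longleftrightarrow> smooth_on (f \<circ> \<Psi>) (\<phi> ` W)"
proof
  assume "smooth_fun A W f"
  hence "smooth_on (f \<circ> inv_into Q (restrict \<phi> Q)) (restrict \<phi> Q ` (Q \<inter> W))"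
    using base_chart unfolding smooth_fun_def ball_chart_iff by blast
  moreover have "restrict \<phi> Q ` (Q \<inter> W) = \<phi> ` W" using assms by (auto simp: Int_absorb1)
  ultimately have "smooth_on (f \<circ> inv_into Q (restrict \<phi> Q)) (\<phi> ` W)" by simp
  thus "smooth_on (f \<circ> \<Psi>) (\<phi> ` W)"
    by (rule smooth_on_cong[OF assms(2)]) (use assms(1) inv_base_chart in auto)
next
  assume "smooth_on (f \<circ> \<Psi>) (\<phi> ` W)"
  thus "smooth_fun A W f" unfolding smooth_fun_def ball_chart_iff using smooth_on_chart_iff[OF _ assms] by blast
qed

lemma smooth_fun_Q_iff: "smooth_fun A Q f \<longleftrightarrow> smooth_on (f \<circ> \<Psi>) upper_half_plane"
  using smooth_fun_iff[of Q f] by (simp add: \<phi>_image open_upper_half_plane)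

lemma smooth_fun_has_derivative:
  assumes "openin (surface_topology A) W" "smooth_fun A W f" "c \<in> W"
  shows "(f \<circ> \<Psi> has_derivative frechet_derivative (f \<circ> \<Psi>) (at (\<phi> c))) (at (\<phi> c))"
  using assms by (auto simp: openin_iff smooth_fun_iff intro: smooth_on_has_derivative)

lemma flow_X_at: "c \<in> Q \<Longrightarrow> flow gen_X c t = \<Psi> (\<phi> c + of_real (t * Im (\<phi> c)))"
  using flow_X[of "\<phi> c" t] by simp

lemma flow_Y_at: "c \<in> Q \<Longrightarrow> flow gen_Y c t = \<Psi> (Complex (Re (\<phi> c)) (exp t * Im (\<phi> c)))"
  using flow_Y[of "\<phi> c" t] by simp

lemma flow_in_Q:
  assumes "c \<in> Q"
  shows "flow gen_X c t \<in> Q" "flow gen_Y c t \<in> Q"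
    "\<phi> (flow gen_X c t) = \<phi> c + of_real (t * Im (\<phi> c))"
    "\<phi> (flow gen_Y c t) = Complex (Re (\<phi> c)) (exp t * Im (\<phi> c))"
proof -
  have "\<phi> c + of_real (t * Im (\<phi> c)) \<in> upper_half_plane"
    "Complex (Re (\<phi> c)) (exp t * Im (\<phi> c)) \<in> upper_half_plane"
    using Im_\<phi>_pos[OF assms] by (simp_all add: upper_half_plane_def)
  thus "flow gen_X c t \<in> Q" "flow gen_Y c t \<in> Q"
    "\<phi> (flow gen_X c t) = \<phi> c + of_real (t * Im (\<phi> c))"
    "\<phi> (flow gen_Y c t) = Complex (Re (\<phi> c)) (exp t * Im (\<phi> c))"
    using assms by (simp_all add: flow_X_at flow_Y_at)
qed

lemma flow_derivatives:
  assumes "c \<in> Q"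
  shows "((\<lambda>t. \<phi> (flow gen_X c t)) has_vector_derivative of_real (Im (\<phi> c))) (at 0)"
    "((\<lambda>t. \<phi> (flow gen_Y c t)) has_vector_derivative \<i> * of_real (Im (\<phi> c))) (at 0)"
proof -
  have "((\<lambda>t. \<phi> c + of_real t * of_real (Im (\<phi> c))) has_vector_derivative of_real (Im (\<phi> c))) (at 0)"
    by (auto intro!: derivative_eq_intros)
  thus "((\<lambda>t. \<phi> (flow gen_X c t)) has_vector_derivative of_real (Im (\<phi> c))) (at 0)"
    by (simp add: flow_in_Q[OF assms])
  have "((\<lambda>t. of_real (Re (\<phi> c)) + exp t *\<^sub>R (\<i> * of_real (Im (\<phi> c))))
      has_vector_derivative \<i> * of_real (Im (\<phi> c))) (at 0)"
    by (auto intro!: derivative_eq_intros)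
  moreover have "of_real (Re (\<phi> c)) + exp t *\<^sub>R (\<i> * of_real (Im (\<phi> c)))
      = Complex (Re (\<phi> c)) (exp t * Im (\<phi> c))" for t
    by (simp add: complex_eq_iff)
  ultimately show "((\<lambda>t. \<phi> (flow gen_Y c t)) has_vector_derivative \<i> * of_real (Im (\<phi> c))) (at 0)"
    by (simp add: flow_in_Q[OF assms])
qed

lemma curve_chain_rule:
  fixes f :: "adele_class \<Rightarrow> 'b::real_normed_vector"
  assumes e: "e > 0" "\<And>t. \<bar>t\<bar> < e \<Longrightarrow> \<gamma> t \<in> Q"
    and \<gamma>: "((\<lambda>t. \<phi> (\<gamma> t)) has_vector_derivative v) (at 0)"
    and f: "(f \<circ> \<Psi> has_derivative D) (at (\<phi> (\<gamma> 0)))"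
  shows "vector_derivative (\<lambda>t. f (\<gamma> t)) (at 0) = D v"
proof -
  have "((\<lambda>t. (f \<circ> \<Psi>) (\<phi> (\<gamma> t))) has_derivative (\<lambda>h. D (h *\<^sub>R v))) (at 0)"
    using has_derivative_compose[OF \<gamma>[unfolded has_vector_derivative_def] f] .
  hence "((\<lambda>t. (f \<circ> \<Psi>) (\<phi> (\<gamma> t))) has_vector_derivative D v) (at 0)"
    using linear_cmul[OF has_derivative_linear[OF f]] by (simp add: has_vector_derivative_def)
  hence "((\<lambda>t. f (\<gamma> t)) has_vector_derivative D v) (at 0)"
    by (rule has_vector_derivative_transform_within_open[where S = "{-e<..<e}"]) (use e in auto)
  thus ?thesis by (rule vector_derivative_at)
qed

text \<open>The flows move \<open>x + \<i> y\<close> to \<open>x + t y + \<i> y\<close> and \<open>x + \<i> e\<^sup>t y\<close>, with velocities \<open>y\<close> and \<open>\<i> y\<close> at \<open>t = 0\<close>: so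
\<open>X = y \<partial>\<^sub>x\<close> and \<open>Y = y \<partial>\<^sub>y\<close>.\<close>

lemma X_Y_op_eq:
  assumes "c \<in> Q" "(f \<circ> \<Psi> has_derivative D) (at (\<phi> c))"
  shows "X_op f c = D (of_real (Im (\<phi> c)))" "Y_op f c = D (\<i> * of_real (Im (\<phi> c)))"
proof -
  have "flow gen_X c 0 = c" "flow gen_Y c 0 = c"
    using assms(1) by (simp_all add: flow_X_at flow_Y_at)
  thus "X_op f c = D (of_real (Im (\<phi> c)))" "Y_op f c = D (\<i> * of_real (Im (\<phi> c)))"
    using curve_chain_rule[of 1 "flow gen_X c", OF _ _ flow_derivatives(1)[OF assms(1)], of f D]
      curve_chain_rule[of 1 "flow gen_Y c", OF _ _ flow_derivatives(2)[OF assms(1)], of f D]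
      assms flow_in_Q[OF assms(1)] by (simp_all add: along_def)
qed


section \<open>Tangent vectors and the metric\<close>

text \<open>The tangent vector at \<open>c\<close> with coordinates \<open>v\<close>: the derivative in the direction \<open>v\<close>, with the value that
velocities have on functions that are not smooth near \<open>c\<close>.\<close>

definition tvec :: "adele_class \<Rightarrow> complex \<Rightarrow> adele_class tangent" where
  "tvec c v f = (if \<exists>W. openin (surface_topology A) W \<and> c \<in> W \<and> smooth_fun A W f
     then frechet_derivative (f \<circ> \<Psi>) (at (\<phi> c)) v else 0)"

lemma velocity_eq_tvec:
  assumes "e > 0" "\<And>t. \<bar>t\<bar> < e \<Longrightarrow> \<gamma> t \<in> Q"
    and "((\<lambda>t. \<phi> (\<gamma> t)) has_vector_derivative v) (at 0)"
  shows "velocity A \<gamma> = tvec (\<gamma> 0) v"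
proof
  fix f :: "adele_class \<Rightarrow> real"
  show "velocity A \<gamma> f = tvec (\<gamma> 0) v f"
  proof (cases "\<exists>W. openin (surface_topology A) W \<and> \<gamma> 0 \<in> W \<and> smooth_fun A W f")
    case True
    then obtain W where "openin (surface_topology A) W" "\<gamma> 0 \<in> W" "smooth_fun A W f" by blast
    from curve_chain_rule[OF assms smooth_fun_has_derivative[OF this(1,3,2)]]
    show ?thesis using True by (simp add: velocity_def tvec_def o_def)
  next
    case False
    thus ?thesis unfolding velocity_def tvec_def by (simp only: if_False)
  qed
qed

lemma X_Y_vec_eq:
  assumes "c \<in> Q"
  shows "X_vec Q c = tvec c (of_real (Im (\<phi> c)))" "Y_vec Q c = tvec c (\<i> * of_real (Im (\<phi> c)))"
proof -
  have "flow gen_X c 0 = c" "flow gen_Y c 0 = c"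
    using assms by (simp_all add: flow_X_at flow_Y_at)
  thus "X_vec Q c = tvec c (of_real (Im (\<phi> c)))" "Y_vec Q c = tvec c (\<i> * of_real (Im (\<phi> c)))"
    using velocity_eq_tvec[of 1 "flow gen_X c", OF _ _ flow_derivatives(1)[OF assms]]
      velocity_eq_tvec[of 1 "flow gen_Y c", OF _ _ flow_derivatives(2)[OF assms]] flow_in_Q[OF assms]
    by (auto simp: X_vec_def Y_vec_def)
qed

lemma lines_in_half_plane:
  assumes "z \<in> upper_half_plane"
  obtains e where "e > 0" "\<And>t. \<bar>t\<bar> < e \<Longrightarrow> z + of_real t * v \<in> upper_half_plane"
proof -
  have "isCont (\<lambda>t. z + of_real t * v) 0" by (intro continuous_intros)
  hence "open ((\<lambda>t. z + of_real t * v) -` upper_half_plane)"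
    by (intro open_vimage[OF open_upper_half_plane] continuous_intros)
  moreover have "(0 :: real) \<in> (\<lambda>t. z + of_real t * v) -` upper_half_plane" using assms by simp
  ultimately obtain e where "e > 0" "ball 0 e \<subseteq> (\<lambda>t. z + of_real t * v) -` upper_half_plane"
    using open_contains_ball by metis
  thus ?thesis using that[of e] by (auto simp: subset_iff)
qed

lemma velocity_line:
  assumes "c \<in> Q" "\<And>t. \<phi> c + of_real t * v \<in> upper_half_plane \<Longrightarrow> \<gamma> t = \<Psi> (\<phi> c + of_real t * v)"
  shows "velocity A \<gamma> = tvec c v"
proof -
  obtain e where e: "e > 0" "\<And>t. \<bar>t\<bar> < e \<Longrightarrow> \<phi> c + of_real t * v \<in> upper_half_plane"
    using lines_in_half_plane[OF \<phi>_in[OF assms(1)]] by blast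
  have "((\<lambda>t. \<phi> c + of_real t * v) has_vector_derivative v) (at 0)"
    by (auto intro!: derivative_eq_intros)
  hence "((\<lambda>t. \<phi> (\<gamma> t)) has_vector_derivative v) (at 0)"
    by (rule has_vector_derivative_transform_within_open[where S = "{-e<..<e}"])
       (use e assms(2) in auto)
  moreover have "\<gamma> 0 = c" using assms(2)[of 0] assms(1) by simp
  ultimately show ?thesis
    using velocity_eq_tvec[of e \<gamma> v] e assms(2) by simp
qed

text \<open>By the chain rule a velocity depends only on the derivative of the curve in the coordinate, and straight lines
  realise every derivative.\<close>

lemma tangent_space_eq:
  assumes "c \<in> Q"
  shows "tangent_space A c = range (tvec c)"
proof (intro set_eqI iffI)
  fix u assume "u \<in> tangent_space A c"
  then obtain \<gamma> where u: "u = velocity A \<gamma>" "\<gamma> 0 = c" "smooth_curve A \<gamma>"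
    unfolding tangent_space_def by blast
  then obtain U \<kappa> e where ch: "(U, \<kappa>) \<in> A" and e: "e > 0" "\<gamma> ` {-e<..<e} \<subseteq> U"
    "smooth_on (\<kappa> \<circ> \<gamma>) {-e<..<e}" unfolding smooth_curve_def by blast
  obtain a b where U: "U = Q" and "affine_chart a b \<kappa>" by (rule atlasE[OF ch])
  note k = affine_chartD[OF this(2)]
  have in_Q: "\<gamma> t \<in> Q" if "\<bar>t\<bar> < e" for t
    using e(2) that U by (auto simp: abs_less_iff image_subset_iff)
  obtain D where D: "((\<lambda>t. \<kappa> (\<gamma> t)) has_derivative D) (at 0)"
    using smooth_on_has_derivative[OF e(3), of 0] e(1) by (auto simp: o_def)
  hence "((\<lambda>t. of_real a * \<kappa> (\<gamma> t) + of_real b) has_derivative (\<lambda>h. of_real a * D h)) (at 0)"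
    by (auto intro!: derivative_eq_intros)
  moreover have "(\<lambda>h. of_real a * D h) = (\<lambda>h. h *\<^sub>R (of_real a * D 1))"
  proof
    fix h
    have "D h = h *\<^sub>R D 1"
      using linear_cmul[OF has_derivative_linear[OF D], of h 1] by simp
    thus "of_real a * D h = h *\<^sub>R (of_real a * D 1)" by (simp only: mult_scaleR_right)
  qed
  ultimately have "((\<lambda>t. of_real a * \<kappa> (\<gamma> t) + of_real b) has_vector_derivative of_real a * D 1) (at 0)"
    unfolding has_vector_derivative_def by simp
  hence "((\<lambda>t. \<phi> (\<gamma> t)) has_vector_derivative of_real a * D 1) (at 0)"
    by (rule has_vector_derivative_transform_within_open[where S = "{-e<..<e}"])
       (use e(1) in_Q k(2) in auto)
  hence "velocity A \<gamma> = tvec c (of_real a * D 1)"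
    using velocity_eq_tvec[OF e(1) in_Q] u(2) by simp
  thus "u \<in> range (tvec c)" using u(1) by blast
next
  fix u assume "u \<in> range (tvec c)"
  then obtain v where v: "u = tvec c v" by blast
  obtain e where e: "e > 0" "\<And>t. \<bar>t\<bar> < e \<Longrightarrow> \<phi> c + of_real t * v \<in> upper_half_plane"
    using lines_in_half_plane[OF \<phi>_in[OF assms]] by blast
  let ?\<gamma> = "\<lambda>t. \<Psi> (\<phi> c + of_real t * v)"
  have "smooth_on (\<lambda>t. \<phi> c + t *\<^sub>R v) {-e<..<e}"
    by (intro smooth_on_add smooth_on_scaleR smooth_on_const smooth_on_id) auto
  hence "smooth_on (restrict \<phi> Q \<circ> ?\<gamma>) {-e<..<e}"
    by (rule smooth_on_cong[rotated]) (use e in \<open>auto simp: scaleR_conv_of_real\<close>)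
  moreover have "?\<gamma> ` {-e<..<e} \<subseteq> Q" using e by auto
  ultimately have "smooth_curve A ?\<gamma>"
    unfolding smooth_curve_def using base_chart e(1) by blast
  moreover have "?\<gamma> 0 = c" using assms by simp
  ultimately have "velocity A ?\<gamma> \<in> tangent_space A c" unfolding tangent_space_def by blast
  thus "u \<in> tangent_space A c" using velocity_line[OF assms, of v ?\<gamma>] v by simp
qed

lemma lincomb_tvec: "lincomb a (tvec c v) b (tvec c w) = tvec c (a *\<^sub>R v + b *\<^sub>R w)"
proof
  fix f
  show "lincomb a (tvec c v) b (tvec c w) f = tvec c (a *\<^sub>R v + b *\<^sub>R w) f"
  proof (cases "\<exists>W. openin (surface_topology A) W \<and> c \<in> W \<and> smooth_fun A W f")
    case True
    then obtain W where "openin (surface_topology A) W" "c \<in> W" "smooth_fun A W f" by blast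
    hence "linear (frechet_derivative (f \<circ> \<Psi>) (at (\<phi> c)))"
      using smooth_fun_has_derivative has_derivative_linear by blast
    thus ?thesis using True by (simp add: lincomb_def tvec_def linear_add linear_cmul)
  qed (auto simp: lincomb_def tvec_def)
qed

text \<open>The coordinate functions \<open>Re \<circ> \<phi>\<close> and \<open>Im \<circ> \<phi>\<close> are themselves smooth on the orbit, so a tangent vector remembers
  its coordinates.\<close>

lemma pushforward_tvec:
  assumes "c \<in> Q"
  shows "pushforward \<phi> (tvec c v) Re = Re v" "pushforward \<phi> (tvec c v) Im = Im v"
proof -
  have "pushforward \<phi> (tvec c v) L = L v" if L: "bounded_linear L" for L :: "complex \<Rightarrow> real"
  proof -
    have "smooth_on ((L \<circ> \<phi>) \<circ> \<Psi>) upper_half_plane"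
      by (rule smooth_on_cong[OF open_upper_half_plane
            smooth_on_bounded_linear[OF L open_upper_half_plane smooth_on_id[OF open_upper_half_plane]]])
         simp
    hence "\<exists>W. openin (surface_topology A) W \<and> c \<in> W \<and> smooth_fun A W (L \<circ> \<phi>)"
      using assms openin_Q smooth_fun_Q_iff by blast
    moreover have "(L \<circ> \<phi> \<circ> \<Psi> has_derivative L) (at (\<phi> c))"
      by (rule has_derivative_transform_within_open[OF bounded_linear_imp_has_derivative[OF L]
            open_upper_half_plane]) (use assms in auto)
    ultimately show ?thesis by (simp add: pushforward_def tvec_def flip: frechet_derivative_at)
  qed
  thus "pushforward \<phi> (tvec c v) Re = Re v" "pushforward \<phi> (tvec c v) Im = Im v"
    using bounded_linear_Re bounded_linear_Im by blast+
qed

text \<open>The default value 0 is the one that a metric must have on arguments that are not tangent vectors, so it is needed for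
  uniqueness.\<close>

definition half_plane_metric :: "adele_class metric" where
  "half_plane_metric c u v =
     (if c \<in> Q \<and> u \<in> tangent_space A c \<and> v \<in> tangent_space A c
      then poincare_metric (\<phi> c) (pushforward \<phi> u) (pushforward \<phi> v) else 0)"

lemma half_plane_metric_tvec:
  "c \<in> Q \<Longrightarrow> half_plane_metric c (tvec c v) (tvec c w) = (v \<bullet> w) / (Im (\<phi> c))\<^sup>2"
  by (simp add: half_plane_metric_def tangent_space_eq poincare_metric_def pushforward_tvec
      inner_complex_def)

lemma coord_vec_eq:
  assumes "affine_chart a b \<kappa>" "c \<in> Q"
  shows "coord_vec A (Q, \<kappa>) v c = tvec c (of_real a * v)"
  unfolding coord_vec_def fst_conv snd_conv
proof (rule velocity_line[OF assms(2)])
  note k = affine_chartD[OF assms(1)]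
  fix t assume *: "\<phi> c + of_real t * (of_real a * v) \<in> upper_half_plane"
  have e: "of_real a * (\<kappa> c + of_real t * v) + of_real b = \<phi> c + of_real t * (of_real a * v)"
    by (simp add: k(2)[OF assms(2), symmetric] algebra_simps)
  hence "\<kappa> c + of_real t * v \<in> upper_half_plane"
    using * affine_mem_half_plane_iff[OF k(1), of "\<kappa> c + of_real t * v" b] by simp
  thus "inv_into Q \<kappa> (\<kappa> c + of_real t * v) = \<Psi> (\<phi> c + of_real t * (of_real a * v))"
    using k(3) e by simp
qed

lemma riemannian_half_plane_metric: "riemannian_metric A half_plane_metric"
  unfolding riemannian_metric_def points_atlas ball_chart_iff
proof (intro conjI ballI allI impI)
  fix c u v assume "\<not> (c \<in> Q \<and> u \<in> tangent_space A c \<and> v \<in> tangent_space A c)"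
  thus "half_plane_metric c u v = 0" by (auto simp: half_plane_metric_def)
next
  fix c u v assume "c \<in> Q" "u \<in> tangent_space A c" "v \<in> tangent_space A c"
  thus "half_plane_metric c u v = half_plane_metric c v u"
    by (auto simp: tangent_space_eq half_plane_metric_tvec inner_commute)
next
  fix c u v w a b
  assume "c \<in> Q" "u \<in> tangent_space A c" "v \<in> tangent_space A c" "w \<in> tangent_space A c"
  thus "half_plane_metric c (lincomb a u b v) w = a * half_plane_metric c u w + b * half_plane_metric c v w"
    by (auto simp: tangent_space_eq half_plane_metric_tvec lincomb_tvec inner_add_left add_divide_distrib)
next
  fix c u assume c: "c \<in> Q" and "u \<in> tangent_space A c" and u0: "u \<noteq> (\<lambda>f. 0)"
  then obtain v where v: "u = tvec c v" by (auto simp: tangent_space_eq)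
  have "v \<noteq> 0"
    using u0 lincomb_tvec[of 0 c v 0 v] by (auto simp: v lincomb_def)
  thus "half_plane_metric c u u > 0" using Im_\<phi>_pos[OF c] by (simp add: v half_plane_metric_tvec[OF c])
next
  fix U \<kappa> v w assume ch: "(U, \<kappa>) \<in> A"
  obtain a b where U: "U = Q" and k: "affine_chart a b \<kappa>" by (rule atlasE[OF ch])
  let ?f = "\<lambda>c. half_plane_metric c (coord_vec A (U, \<kappa>) v c) (coord_vec A (U, \<kappa>) w c)"
  let ?k = "(of_real a * v) \<bullet> (of_real a * w)"
  have "smooth_on (?f \<circ> \<Psi>) upper_half_plane"
    by (rule smooth_on_cong[OF open_upper_half_plane
          smooth_on_mult[OF open_upper_half_plane smooth_on_const[OF open_upper_half_plane, of ?k]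
            smooth_on_mult[OF open_upper_half_plane smooth_on_inverse_Im smooth_on_inverse_Im]]])
       (simp add: U coord_vec_eq[OF k] half_plane_metric_tvec power2_eq_square divide_inverse)
  hence "smooth_on (?f \<circ> inv_into U \<kappa>) (\<kappa> ` (U \<inter> Q))"
    using smooth_on_chart_iff[OF ch order_refl, of ?f] by (simp add: \<phi>_image open_upper_half_plane)
  thus "smooth_on (?f \<circ> inv_into U \<kappa>) (\<kappa> ` U)" by (simp add: U)
qed

lemma tvec_eq_lincomb:
  assumes "c \<in> Q"
  shows "tvec c v = lincomb (Re v / Im (\<phi> c)) (X_vec Q c) (Im v / Im (\<phi> c)) (Y_vec Q c)"
proof -
  have "(Re v / Im (\<phi> c)) *\<^sub>R of_real (Im (\<phi> c)) + (Im v / Im (\<phi> c)) *\<^sub>R (\<i> * of_real (Im (\<phi> c))) = v"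
    using Im_\<phi>_pos[OF assms] by (simp add: complex_eq_iff)
  thus ?thesis by (simp add: X_Y_vec_eq[OF assms] lincomb_tvec)
qed

lemma orbit_half_plane_metric: "orbit_metric Q half_plane_metric"
  unfolding orbit_metric_def
proof (intro conjI ballI riemannian_half_plane_metric)
  fix c assume c: "c \<in> Q"
  have y: "Im (\<phi> c) \<noteq> 0" using Im_\<phi>_pos[OF c] by linarith
  show "orthonormal_basis (tangent_space A c) (half_plane_metric c) (X_vec Q c) (Y_vec Q c)"
    unfolding orthonormal_basis_def
  proof (intro conjI ballI)
    fix w assume "w \<in> tangent_space A c"
    thus "\<exists>r s. w = lincomb r (X_vec Q c) s (Y_vec Q c)"
      using tvec_eq_lincomb[OF c] by (auto simp: tangent_space_eq[OF c])
  qed (use y c in \<open>auto simp: tangent_space_eq X_Y_vec_eq half_plane_metric_tvec inner_complex_def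
        power2_eq_square\<close>)
qed

text \<open>Bilinearity and orthonormality determine all values of the metric, which gives uniqueness; existence holds because
\<open>y \<partial>\<^sub>x\<close> and \<open>y \<partial>\<^sub>y\<close> are orthonormal for \<open>(dx\<^sup>2 + dy\<^sup>2) / y\<^sup>2\<close>.\<close>

lemma orbit_metric_lincomb:
  assumes "orbit_metric Q g" "c \<in> Q"
  shows "g c (lincomb r (X_vec Q c) s (Y_vec Q c)) (lincomb r' (X_vec Q c) s' (Y_vec Q c)) = r * r' + s * s'"
proof -
  let ?T = "tangent_space A c" and ?X = "X_vec Q c" and ?Y = "Y_vec Q c"
  have g: "riemannian_metric A g" and onb: "orthonormal_basis ?T (g c) ?X ?Y"
    using assms unfolding orbit_metric_def by auto
  have lin: "g c (lincomb a u b v) w = a * g c u w + b * g c v w"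
    if "u \<in> ?T" "v \<in> ?T" "w \<in> ?T" for u v w a b
    using g that assms(2) unfolding riemannian_metric_def points_atlas by blast
  have sym: "g c u v = g c v u" if "u \<in> ?T" "v \<in> ?T" for u v
    using g that assms(2) unfolding riemannian_metric_def points_atlas by blast
  have X: "?X \<in> ?T" "?Y \<in> ?T" "g c ?X ?X = 1" "g c ?Y ?Y = 1" "g c ?X ?Y = 0"
    using onb unfolding orthonormal_basis_def by auto
  have YX: "g c ?Y ?X = 0" using sym[OF X(2,1)] X(5) by simp
  have T: "lincomb a ?X b ?Y \<in> ?T" for a b
    using assms(2) by (simp add: X_Y_vec_eq lincomb_tvec tangent_space_eq)
  have "g c ?X (lincomb r' ?X s' ?Y) = r'" "g c ?Y (lincomb r' ?X s' ?Y) = s'"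
    unfolding sym[OF X(1) T] sym[OF X(2) T] using lin[OF X(1,2,1)] lin[OF X(1,2,2)] X YX by simp_all
  thus ?thesis using lin[OF X(1,2) T] by simp
qed

lemma orbit_metric_unique:
  assumes "orbit_metric Q g"
  shows "g = half_plane_metric"
proof (intro ext)
  fix c u v
  show "g c u v = half_plane_metric c u v"
  proof (cases "c \<in> Q \<and> u \<in> tangent_space A c \<and> v \<in> tangent_space A c")
    case False
    thus ?thesis using assms unfolding orbit_metric_def riemannian_metric_def points_atlas
      by (auto simp: half_plane_metric_def)
  next
    case True
    then obtain v' w' where "u = tvec c v'" "v = tvec c w'" by (auto simp: tangent_space_eq)
    thus ?thesis
      using True orbit_metric_lincomb[OF assms] orbit_metric_lincomb[OF orbit_half_plane_metric]
      by (simp only: tvec_eq_lincomb)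
  qed
qed


section \<open>The complex structure\<close>

text \<open>All charts that are holomorphic in the coordinate \<open>\<phi>\<close>: the maximal atlas of the half plane, transported to
  the orbit.\<close>

definition holo_atlas :: "adele_class chart set" where
  "holo_atlas = {(U, \<kappa>). U \<subseteq> Q \<and> inj_on \<kappa> U \<and> \<kappa> \<in> extensional U \<and> open (\<phi> ` U) \<and>
     (\<kappa> \<circ> \<Psi>) holomorphic_on \<phi> ` U}"

lemma holo_atlasD:
  assumes "(U, \<kappa>) \<in> holo_atlas"
  shows "U \<subseteq> Q" "inj_on \<kappa> U" "\<kappa> \<in> extensional U" "open (\<phi> ` U)" "(\<kappa> \<circ> \<Psi>) holomorphic_on \<phi> ` U"
    "inj_on (\<kappa> \<circ> \<Psi>) (\<phi> ` U)" "\<And>W. W \<subseteq> U \<Longrightarrow> (\<kappa> \<circ> \<Psi>) ` (\<phi> ` W) = \<kappa> ` W"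
proof -
  show *: "U \<subseteq> Q" "inj_on \<kappa> U" "\<kappa> \<in> extensional U" "open (\<phi> ` U)" "(\<kappa> \<circ> \<Psi>) holomorphic_on \<phi> ` U"
    using assms by (auto simp: holo_atlas_def)
  have \<Psi>\<phi>: "\<Psi> (\<phi> c) = c" if "c \<in> U" for c using that *(1) by auto
  show "inj_on (\<kappa> \<circ> \<Psi>) (\<phi> ` U)"
    using *(2) by (auto simp: inj_on_def \<Psi>\<phi>)
  show "(\<kappa> \<circ> \<Psi>) ` (\<phi> ` W) = \<kappa> ` W" if "W \<subseteq> U" for W
    using that by (auto simp: image_image \<Psi>\<phi> subset_iff intro!: image_cong)
qed

lemma holo_atlas_open_image:
  assumes "(U, \<kappa>) \<in> holo_atlas" "W \<subseteq> U" "open (\<phi> ` W)"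
  shows "open (\<kappa> ` W)"
proof -
  note k = holo_atlasD[OF assms(1)]
  have sub: "\<phi> ` W \<subseteq> \<phi> ` U" using assms(2) by blast
  have "open ((\<kappa> \<circ> \<Psi>) ` (\<phi> ` W))"
    by (rule open_mapping_thm3[OF holomorphic_on_subset[OF k(5) sub] assms(3) inj_on_subset[OF k(6) sub]])
  thus ?thesis by (simp only: k(7)[OF assms(2)])
qed

text \<open>An injective holomorphic function has a holomorphic inverse whose derivative does not vanish. In the coordinate
\<open>\<phi>\<close> this gives the inverse of a chart as a function to which the chain rule applies.\<close>

lemma holo_atlas_inverse:
  assumes "(U, \<kappa>) \<in> holo_atlas"
  obtains k where "k holomorphic_on \<kappa> ` U" "\<And>c. c \<in> U \<Longrightarrow> k (\<kappa> c) = \<phi> c"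
    "\<And>c. c \<in> U \<Longrightarrow> deriv k (\<kappa> c) \<noteq> 0" "\<And>w. w \<in> \<kappa> ` U \<Longrightarrow> inv_into U \<kappa> w = \<Psi> (k w)"
proof -
  note h = holo_atlasD[OF assms]
  obtain k where k: "k holomorphic_on (\<kappa> \<circ> \<Psi>) ` (\<phi> ` U)"
    "\<And>z. z \<in> \<phi> ` U \<Longrightarrow> deriv (\<kappa> \<circ> \<Psi>) z * deriv k ((\<kappa> \<circ> \<Psi>) z) = 1"
    "\<And>z. z \<in> \<phi> ` U \<Longrightarrow> k ((\<kappa> \<circ> \<Psi>) z) = z"
    using holomorphic_has_inverse[OF h(5,4,6)] by blast
  have \<Psi>\<phi>: "\<Psi> (\<phi> c) = c" if "c \<in> U" for c using that h(1) by auto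
  show ?thesis
  proof (rule that)
    show "k holomorphic_on \<kappa> ` U" using k(1) by (simp only: h(7)[OF order_refl])
    show k\<kappa>: "k (\<kappa> c) = \<phi> c" if "c \<in> U" for c
      using k(3)[of "\<phi> c"] that by (simp add: \<Psi>\<phi>)
    show "deriv k (\<kappa> c) \<noteq> 0" if "c \<in> U" for c
      using k(2)[of "\<phi> c"] that by (auto simp: \<Psi>\<phi>)
    show "inv_into U \<kappa> w = \<Psi> (k w)" if "w \<in> \<kappa> ` U" for w
      using that h(2) by (auto simp: k\<kappa> \<Psi>\<phi>)
  qed
qed

text \<open>The inverse of an injective holomorphic function is holomorphic, so any two such charts are compatible.\<close>

lemma is_atlas_subset_holo_atlas:
  assumes "C \<subseteq> holo_atlas"
  shows "is_atlas (holomorphic_on) C"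
  unfolding is_atlas_def ball_chart_iff
proof (intro conjI allI impI)
  fix U \<kappa> assume "(U, \<kappa>) \<in> C"
  hence "(U, \<kappa>) \<in> holo_atlas" using assms by blast
  thus "inj_on \<kappa> U" "\<kappa> \<in> extensional U" by (rule holo_atlasD)+
next
  fix U \<kappa> U' \<kappa>' assume "(U, \<kappa>) \<in> C" "(U', \<kappa>') \<in> C"
  hence ch: "(U, \<kappa>) \<in> holo_atlas" "(U', \<kappa>') \<in> holo_atlas" using assms by auto
  note h = holo_atlasD[OF ch(1)] and h' = holo_atlasD[OF ch(2)]
  have "\<phi> ` (U \<inter> U') = \<phi> ` U \<inter> \<phi> ` U'" using h(1) h'(1) by (rule \<phi>_image_Int)
  hence "open (\<phi> ` (U \<inter> U'))" using h(4) h'(4) by (simp add: open_Int)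
  thus "open (\<kappa> ` (U \<inter> U'))" by (intro holo_atlas_open_image[OF ch(1)]) auto
  obtain k where k: "k holomorphic_on \<kappa> ` U" "\<And>c. c \<in> U \<Longrightarrow> k (\<kappa> c) = \<phi> c"
    "\<And>w. w \<in> \<kappa> ` U \<Longrightarrow> inv_into U \<kappa> w = \<Psi> (k w)"
    using holo_atlas_inverse[OF ch(1)] by metis
  have "((\<kappa>' \<circ> \<Psi>) \<circ> k) holomorphic_on \<kappa> ` (U \<inter> U')"
  proof (rule holomorphic_on_compose_gen[OF _ h'(5)])
    show "k holomorphic_on \<kappa> ` (U \<inter> U')" by (rule holomorphic_on_subset[OF k(1)]) auto
    show "k ` \<kappa> ` (U \<inter> U') \<subseteq> \<phi> ` U'" using k(2) by auto
  qed
  thus "(\<kappa>' \<circ> inv_into U \<kappa>) holomorphic_on \<kappa> ` (U \<inter> U')"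
    by (rule holomorphic_transform) (use k(3) in auto)
qed

lemma atlas_subset_holo_atlas: "A \<subseteq> holo_atlas"
proof
  fix ch assume "ch \<in> A"
  then obtain U \<kappa> where ch: "ch = (U, \<kappa>)" "(U, \<kappa>) \<in> A" by (cases ch) auto
  obtain a b where U: "U = Q" and "affine_chart a b \<kappa>" by (rule atlasE[OF ch(2)])
  note k = affine_chartD[OF this(2)]
  have "(\<lambda>z. (z - of_real b) / of_real a) holomorphic_on upper_half_plane"
    using k(1) by (intro holomorphic_intros) auto
  hence "(\<kappa> \<circ> \<Psi>) holomorphic_on upper_half_plane"
  proof (rule holomorphic_transform)
    fix z assume "z \<in> upper_half_plane"
    hence "of_real a * \<kappa> (\<Psi> z) + of_real b = z" using k(2)[of "\<Psi> z"] by simp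
    thus "(z - of_real b) / of_real a = (\<kappa> \<circ> \<Psi>) z" using k(1) by (auto simp: field_simps)
  qed
  thus "ch \<in> holo_atlas"
    using k(5,6) by (simp add: ch(1) U holo_atlas_def \<phi>_image open_upper_half_plane)
qed

lemma points_holo_atlas: "points holo_atlas = Q"
proof
  show "points holo_atlas \<subseteq> Q" by (auto simp: points_def holo_atlas_def)
  show "Q \<subseteq> points holo_atlas"
    using atlas_subset_holo_atlas base_chart unfolding points_def by fastforce
qed

lemma in_holo_atlasI:
  assumes "is_atlas R C" "(U, \<kappa>) \<in> C" "U \<subseteq> Q" "open (\<phi> ` U)" "(\<kappa> \<circ> \<Psi>) holomorphic_on \<phi> ` U"
  shows "(U, \<kappa>) \<in> holo_atlas"
proof -
  have "inj_on \<kappa> U \<and> \<kappa> \<in> extensional U"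
    using assms(1,2) unfolding is_atlas_def ball_chart_iff by blast
  thus ?thesis using assms(3-5) by (simp add: holo_atlas_def)
qed

lemma compatible_with_base_chart:
  assumes "is_atlas R C" "(U, \<kappa>) \<in> C" "(Q, restrict \<phi> Q) \<in> C" "U \<subseteq> Q"
  shows "open (\<phi> ` U)" "R (\<kappa> \<circ> inv_into Q (restrict \<phi> Q)) (\<phi> ` U)"
proof -
  have "restrict \<phi> Q ` (Q \<inter> U) = \<phi> ` U" using assms(4) by (auto simp: Int_absorb1)
  thus "open (\<phi> ` U)" "R (\<kappa> \<circ> inv_into Q (restrict \<phi> Q)) (\<phi> ` U)"
    using assms(1-3) unfolding is_atlas_def ball_chart_iff by metis+
qed

lemma complex_structure_holo_atlas: "complex_structure A holo_atlas"
  unfolding complex_structure_def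
proof (intro conjI allI impI)
  show "is_atlas (holomorphic_on) holo_atlas" by (rule is_atlas_subset_holo_atlas) simp
  show "points holo_atlas = points A" by (simp add: points_holo_atlas points_atlas)
  show "is_atlas smooth_on (A \<union> holo_atlas)"
    using atlas_subset_holo_atlas
    by (intro is_atlas_holomorphic_imp_smooth is_atlas_subset_holo_atlas) auto
  fix U \<kappa> assume U: "U \<subseteq> points A" and atl: "is_atlas (holomorphic_on) (insert (U, \<kappa>) holo_atlas)"
  have UQ: "U \<subseteq> Q" using U by (simp add: points_atlas)
  have base: "(Q, restrict \<phi> Q) \<in> insert (U, \<kappa>) holo_atlas"
    using atlas_subset_holo_atlas base_chart by blast
  note c = compatible_with_base_chart[OF atl insertI1 base UQ]
  have "(\<kappa> \<circ> \<Psi>) holomorphic_on \<phi> ` U"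
    by (rule holomorphic_transform[OF c(2)]) (use UQ inv_base_chart in auto)
  thus "(U, \<kappa>) \<in> holo_atlas" by (rule in_holo_atlasI[OF atl insertI1 UQ c(1)])
qed

lemma dbar_op_eq:
  assumes "openin (surface_topology A) W" "smooth_fun A W f" "c \<in> W"
  defines "D \<equiv> frechet_derivative (f \<circ> \<Psi>) (at (\<phi> c))"
  shows "dbar_op f c = of_real (Im (\<phi> c)) * (D 1 + \<i> * D \<i>)"
proof -
  have D: "(f \<circ> \<Psi> has_derivative D) (at (\<phi> c))"
    unfolding D_def by (rule smooth_fun_has_derivative[OF assms(1-3)])
  have c: "c \<in> Q" using assms(1,3) by (auto simp: openin_iff)
  show ?thesis
    unfolding dbar_op_def X_Y_op_eq[OF c D]
    by (simp add: real_linear_complex_eq[OF has_derivative_linear[OF D], of "of_real (Im (\<phi> c))"]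
        real_linear_complex_eq[OF has_derivative_linear[OF D], of "\<i> * of_real (Im (\<phi> c))"] algebra_simps)
qed

text \<open>A change of holomorphic coordinate with derivative \<open>k'\<close> multiplies \<open>\<partial>\<^sub>x + \<i> \<partial>\<^sub>y\<close> by the conjugate of
  \<open>k'\<close>, which is not 0. So whether \<open>\<partial>\<^sub>x f + \<i> \<partial>\<^sub>y f\<close> vanishes can be read off in any chart.\<close>

lemma dbar_in_holo_chart:
  assumes W: "openin (surface_topology A) W" "smooth_fun A W f" "c \<in> W"
    and ch: "(U, \<kappa>) \<in> holo_atlas" "c \<in> U"
  shows "partial 1 (f \<circ> inv_into U \<kappa>) (\<kappa> c) + \<i> * partial \<i> (f \<circ> inv_into U \<kappa>) (\<kappa> c) = 0
     \<longleftrightarrow> dbar_op f c = 0"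
proof -
  define D where "D = frechet_derivative (f \<circ> \<Psi>) (at (\<phi> c))"
  have D: "(f \<circ> \<Psi> has_derivative D) (at (\<phi> c))"
    unfolding D_def by (rule smooth_fun_has_derivative[OF W])
  note h = holo_atlasD[OF ch(1)]
  have op: "open (\<kappa> ` U)" by (rule holo_atlas_open_image[OF ch(1) order_refl h(4)])
  obtain k where k: "k holomorphic_on \<kappa> ` U" "\<And>c. c \<in> U \<Longrightarrow> k (\<kappa> c) = \<phi> c"
    "\<And>c. c \<in> U \<Longrightarrow> deriv k (\<kappa> c) \<noteq> 0" "\<And>w. w \<in> \<kappa> ` U \<Longrightarrow> inv_into U \<kappa> w = \<Psi> (k w)"
    using holo_atlas_inverse[OF ch(1)] by metis
  define k' where "k' = deriv k (\<kappa> c)"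
  have "(k has_derivative (\<lambda>h. k' * h)) (at (\<kappa> c))"
    using holomorphic_derivI[OF k(1) op, of "\<kappa> c"] ch(2) by (simp add: k'_def has_field_derivative_def)
  moreover have "(f \<circ> \<Psi> has_derivative D) (at (k (\<kappa> c)))" using D k(2)[OF ch(2)] by simp
  ultimately have "((\<lambda>w. (f \<circ> \<Psi>) (k w)) has_derivative (\<lambda>h. D (k' * h))) (at (\<kappa> c))"
    by (rule has_derivative_compose)
  hence "(f \<circ> inv_into U \<kappa> has_derivative (\<lambda>h. D (k' * h))) (at (\<kappa> c))"
    by (rule has_derivative_transform_within_open[OF _ op]) (use ch(2) k(4) in auto)
  hence "partial 1 (f \<circ> inv_into U \<kappa>) (\<kappa> c) + \<i> * partial \<i> (f \<circ> inv_into U \<kappa>) (\<kappa> c)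
      = D (k' * 1) + \<i> * D (k' * \<i>)"
    by (simp only: partial_eq)
  also have "\<dots> = cnj k' * (D 1 + \<i> * D \<i>)"
    unfolding real_linear_complex_eq[OF has_derivative_linear[OF D], of "k' * 1"]
      real_linear_complex_eq[OF has_derivative_linear[OF D], of "k' * \<i>"]
    by (subst (5) complex_eq[of k']) (simp add: algebra_simps)
  also have "\<dots> = 0 \<longleftrightarrow> D 1 + \<i> * D \<i> = 0" using k(3)[OF ch(2)] by (simp add: k'_def)
  also have "\<dots> \<longleftrightarrow> dbar_op f c = 0"
  proof -
    have "c \<in> Q" using h(1) ch(2) by blast
    hence "Im (\<phi> c) \<noteq> 0" using Im_\<phi>_pos[of c] by linarith
    thus ?thesis by (simp add: dbar_op_eq[OF W] D_def)
  qed
  finally show ?thesis .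
qed

lemma orbit_complex_structure_holo_atlas: "orbit_complex_structure Q holo_atlas"
  unfolding orbit_complex_structure_def
proof (intro conjI allI impI complex_structure_holo_atlas)
  fix W and f :: "adele_class \<Rightarrow> complex"
  assume "openin (surface_topology A) W \<and> smooth_fun A W f"
  hence W: "openin (surface_topology A) W" "smooth_fun A W f" by auto
  have WQ: "W \<subseteq> Q" using W(1) by (simp add: openin_iff)
  show "dbar_vanishes holo_atlas W f \<longleftrightarrow> (\<forall>c\<in>W. dbar_op f c = 0)"
    unfolding dbar_vanishes_def ball_chart_iff
  proof (intro iffI ballI allI impI)
    fix c assume *: "\<forall>U \<kappa>. (U, \<kappa>) \<in> holo_atlas \<longrightarrow> (\<forall>z\<in>\<kappa> ` (U \<inter> W).
       (partial 1 (f \<circ> inv_into U \<kappa>) z + \<i> * partial \<i> (f \<circ> inv_into U \<kappa>) z) / 2 = 0)" and c: "c \<in> W"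
    have base: "(Q, restrict \<phi> Q) \<in> holo_atlas"
      using atlas_subset_holo_atlas base_chart by blast
    have cQ: "c \<in> Q" using c WQ by blast
    let ?\<kappa> = "restrict \<phi> Q"
    have "?\<kappa> c \<in> ?\<kappa> ` (Q \<inter> W)" using c cQ by blast
    hence "(partial 1 (f \<circ> inv_into Q ?\<kappa>) (?\<kappa> c) + \<i> * partial \<i> (f \<circ> inv_into Q ?\<kappa>) (?\<kappa> c)) / 2 = 0"
      using *[rule_format, OF base] by blast
    thus "dbar_op f c = 0" using dbar_in_holo_chart[OF W c base cQ] by simp
  next
    fix U \<kappa> z
    assume *: "\<forall>c\<in>W. dbar_op f c = 0" and ch: "(U, \<kappa>) \<in> holo_atlas" and "z \<in> \<kappa> ` (U \<inter> W)"
    then obtain c where c: "c \<in> U" "c \<in> W" "z = \<kappa> c" by blast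
    show "(partial 1 (f \<circ> inv_into U \<kappa>) z + \<i> * partial \<i> (f \<circ> inv_into U \<kappa>) z) / 2 = 0"
      using dbar_in_holo_chart[OF W c(2) ch c(1)] * c by simp
  qed
qed

text \<open>A chart of any complex structure with the required \<open>\<partial>\<close>-bar equation is itself a smooth function killed by
  \<open>X + \<i> Y\<close>, so it satisfies the Cauchy-Riemann equations in \<open>\<phi>\<close>; maximality gives the reverse inclusion.\<close>

lemma orbit_complex_structure_unique:
  assumes "orbit_complex_structure Q C"
  shows "C = holo_atlas"
proof -
  have cs: "is_atlas (holomorphic_on) C" "points C = points A" "is_atlas smooth_on (A \<union> C)"
    and max: "\<And>U \<kappa>. U \<subseteq> points A \<Longrightarrow> is_atlas (holomorphic_on) (insert (U, \<kappa>) C) \<Longrightarrow> (U, \<kappa>) \<in> C"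
    using assms unfolding orbit_complex_structure_def complex_structure_def by auto
  have dbar: "dbar_vanishes C W f \<longleftrightarrow> (\<forall>c\<in>W. dbar_op f c = 0)"
    if "openin (surface_topology A) W" "smooth_fun A W f" for W f
    using assms that unfolding orbit_complex_structure_def by blast
  have sub: "C \<subseteq> holo_atlas"
  proof
    fix ch assume "ch \<in> C"
    then obtain U \<kappa> where ch: "ch = (U, \<kappa>)" "(U, \<kappa>) \<in> C" by (cases ch) auto
    have "U \<subseteq> points C" using ch(2) by (force simp: points_def)
    hence U: "U \<subseteq> Q" by (simp add: cs(2) points_atlas)
    note c = compatible_with_base_chart[OF cs(3) UnI2[OF ch(2)] UnI1[OF base_chart] U]
    have sm: "smooth_on (\<kappa> \<circ> \<Psi>) (\<phi> ` U)"
      by (rule smooth_on_cong[OF c(1,2)]) (use U inv_base_chart in auto)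
    have W: "openin (surface_topology A) U" "smooth_fun A U \<kappa>"
      using U c(1) sm by (simp_all add: openin_iff smooth_fun_iff)
    have "dbar_vanishes C U \<kappa>"
      unfolding dbar_vanishes_def ball_chart_iff
    proof (intro allI impI ballI)
      fix U' \<kappa>' z assume ch': "(U', \<kappa>') \<in> C" and z: "z \<in> \<kappa>' ` (U' \<inter> U)"
      have "open (\<kappa>' ` (U' \<inter> U))" "(\<kappa> \<circ> inv_into U' \<kappa>') holomorphic_on \<kappa>' ` (U' \<inter> U)"
        using cs(1) ch(2) ch' unfolding is_atlas_def ball_chart_iff by blast+
      then obtain d where "((\<kappa> \<circ> inv_into U' \<kappa>') has_field_derivative d) (at z)"
        using holomorphic_derivI z by blast
      hence d: "((\<kappa> \<circ> inv_into U' \<kappa>') has_derivative (*) d) (at z)"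
        by (simp add: has_field_derivative_def)
      show "(partial 1 (\<kappa> \<circ> inv_into U' \<kappa>') z + \<i> * partial \<i> (\<kappa> \<circ> inv_into U' \<kappa>') z) / 2 = 0"
        unfolding partial_eq[OF d] by (simp add: mult.commute[of d])
    qed
    hence d0: "dbar_op \<kappa> c = 0" if "c \<in> U" for c using dbar[OF W] that by blast
    have "(\<kappa> \<circ> \<Psi>) holomorphic_on \<phi> ` U"
      unfolding holomorphic_on_open[OF c(1)]
    proof (intro ballI)
      fix z assume "z \<in> \<phi> ` U"
      then obtain c where c: "c \<in> U" "z = \<phi> c" by blast
      let ?D = "frechet_derivative (\<kappa> \<circ> \<Psi>) (at (\<phi> c))"
      have "c \<in> Q" using U c(1) by blast
      hence "Im (\<phi> c) \<noteq> 0" using Im_\<phi>_pos[of c] by linarith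
      hence "?D 1 + \<i> * ?D \<i> = 0" using dbar_op_eq[OF W c(1)] d0[OF c(1)] by simp
      thus "\<exists>f'. ((\<kappa> \<circ> \<Psi>) has_field_derivative f') (at z)"
        using cauchy_riemann_imp_field_derivative[OF smooth_fun_has_derivative[OF W c(1)]] c(2) by blast
    qed
    thus "ch \<in> holo_atlas" unfolding ch(1) by (rule in_holo_atlasI[OF cs(1) ch(2) U c(1)])
  qed
  moreover have "holo_atlas \<subseteq> C"
  proof
    fix ch assume "ch \<in> holo_atlas"
    then obtain U \<kappa> where ch: "ch = (U, \<kappa>)" "(U, \<kappa>) \<in> holo_atlas" by (cases ch) auto
    have "is_atlas (holomorphic_on) (insert (U, \<kappa>) C)"
      by (rule is_atlas_subset_holo_atlas) (use ch(2) sub in auto)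
    thus "ch \<in> C" using max[of U \<kappa>] holo_atlasD(1)[OF ch(2)] by (simp add: ch(1) points_atlas)
  qed
  ultimately show ?thesis by blast
qed


section \<open>The isomorphism with the half plane\<close>

lemma inv_half_plane_chart:
  "z \<in> upper_half_plane \<Longrightarrow> inv_into upper_half_plane (restrict id upper_half_plane) z = z"
  using inv_into_f_f[of "restrict id upper_half_plane" upper_half_plane z] by (simp add: inj_on_def)

text \<open>Used for both structures: with the smooth atlas, whose charts are affine in \<open>\<phi>\<close> and hence holomorphic, and with the full
holomorphic atlas.\<close>

lemma surface_iso_\<phi>:
  assumes C: "C \<subseteq> holo_atlas" "points C = Q"
    and R: "\<And>S f. open S \<Longrightarrow> f holomorphic_on S \<Longrightarrow> R f S"
  shows "surface_iso R C half_plane_atlas \<phi>"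
proof -
  let ?H = upper_half_plane and ?\<psi> = "restrict id upper_half_plane"
  have pH: "points half_plane_atlas = ?H" by (simp add: points_def half_plane_atlas_def)
  have bij\<phi>: "bij_betw \<phi> Q ?H" using inj_on_\<phi> \<phi>_image by (simp add: bij_betw_def)
  have inv\<phi>: "inv_into Q \<phi> z = \<Psi> z" if "z \<in> ?H" for z
    using inv_into_f_f[OF inj_on_\<phi>, of "\<Psi> z"] that by simp
  have "open (\<kappa> ` {c \<in> U. \<phi> c \<in> ?H}) \<and> open (?\<psi> ` (\<phi> ` U \<inter> ?H)) \<and>
      R (?\<psi> \<circ> \<phi> \<circ> inv_into U \<kappa>) (\<kappa> ` {c \<in> U. \<phi> c \<in> ?H}) \<and>
      R (\<kappa> \<circ> inv_into Q \<phi> \<circ> inv_into ?H ?\<psi>) (?\<psi> ` (\<phi> ` U \<inter> ?H))" if ch: "(U, \<kappa>) \<in> C" for U \<kappa>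
  proof -
    have ch: "(U, \<kappa>) \<in> holo_atlas" using ch C(1) by blast
    note h = holo_atlasD[OF ch]
    have UH: "\<phi> ` U \<subseteq> ?H" using h(1) by (rule \<phi>_image_subset)
    have 1: "{c \<in> U. \<phi> c \<in> ?H} = U" using UH by blast
    have 2: "?\<psi> ` (\<phi> ` U \<inter> ?H) = \<phi> ` U" using UH by (auto simp: image_iff subset_iff Int_absorb2)
    have op: "open (\<kappa> ` U)" by (rule holo_atlas_open_image[OF ch order_refl h(4)])
    obtain k where k: "k holomorphic_on \<kappa> ` U" "\<And>c. c \<in> U \<Longrightarrow> k (\<kappa> c) = \<phi> c"
      "\<And>w. w \<in> \<kappa> ` U \<Longrightarrow> inv_into U \<kappa> w = \<Psi> (k w)"
      using holo_atlas_inverse[OF ch] by metis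
    have "(?\<psi> \<circ> \<phi> \<circ> inv_into U \<kappa>) holomorphic_on \<kappa> ` U"
    proof (rule holomorphic_transform[OF k(1)])
      fix w assume w: "w \<in> \<kappa> ` U"
      hence "k w \<in> ?H" using k(2) UH by auto
      thus "k w = (?\<psi> \<circ> \<phi> \<circ> inv_into U \<kappa>) w" using k(3)[OF w] by simp
    qed
    moreover have "(\<kappa> \<circ> inv_into Q \<phi> \<circ> inv_into ?H ?\<psi>) holomorphic_on \<phi> ` U"
      by (rule holomorphic_transform[OF h(5)]) (use UH inv\<phi> inv_half_plane_chart in auto)
    ultimately show ?thesis using R op h(4) unfolding 1 2 by blast
  qed
  thus ?thesis
    unfolding surface_iso_def C(2) pH ball_chart_iff using bij\<phi>
    by (simp add: half_plane_atlas_def)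
qed

lemma half_plane_isomorphism:
  assumes "orbit_metric Q g" "orbit_complex_structure Q C"
  shows "surface_iso smooth_on A half_plane_atlas \<phi>" "surface_iso (holomorphic_on) C half_plane_atlas \<phi>"
    "\<And>c u v. c \<in> Q \<Longrightarrow> u \<in> tangent_space A c \<Longrightarrow> v \<in> tangent_space A c \<Longrightarrow>
       poincare_metric (\<phi> c) (pushforward \<phi> u) (pushforward \<phi> v) = g c u v"
proof -
  show "surface_iso smooth_on A half_plane_atlas \<phi>"
    by (rule surface_iso_\<phi>[OF atlas_subset_holo_atlas points_atlas holomorphic_imp_smooth_on])
  show "surface_iso (holomorphic_on) C half_plane_atlas \<phi>"
    unfolding orbit_complex_structure_unique[OF assms(2)]
    by (rule surface_iso_\<phi>[OF order_refl points_holo_atlas])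
  show "poincare_metric (\<phi> c) (pushforward \<phi> u) (pushforward \<phi> v) = g c u v"
    if "c \<in> Q" "u \<in> tangent_space A c" "v \<in> tangent_space A c" for c u v
    using that by (simp add: orbit_metric_unique[OF assms(1)] half_plane_metric_def)
qed


section \<open>Second order operators in the coordinate\<close>

definition coord_deriv :: "(adele_class \<Rightarrow> complex) \<Rightarrow> complex \<Rightarrow> complex \<Rightarrow> complex" where
  "coord_deriv f v z = frechet_derivative (f \<circ> \<Psi>) (at z) v"

text \<open>First \<open>\<partial>\<^sub>v\<close>, then \<open>\<partial>\<^sub>w\<close>.\<close>

definition coord_deriv2 :: "(adele_class \<Rightarrow> complex) \<Rightarrow> complex \<Rightarrow> complex \<Rightarrow> complex \<Rightarrow> complex" where
  "coord_deriv2 f v w z = frechet_derivative (coord_deriv f v) (at z) w"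

lemma smooth_on_coord_deriv: "smooth_fun A Q f \<Longrightarrow> smooth_on (coord_deriv f v) upper_half_plane"
  unfolding smooth_fun_Q_iff coord_deriv_def[abs_def] by (rule smooth_on_frechet_derivative)

lemma coord_deriv_has_derivative:
  "smooth_fun A Q f \<Longrightarrow> z \<in> upper_half_plane \<Longrightarrow>
     (f \<circ> \<Psi> has_derivative (\<lambda>v. coord_deriv f v z)) (at z)"
  unfolding smooth_fun_Q_iff coord_deriv_def using smooth_on_has_derivative by blast

lemma coord_deriv2_has_derivative:
  assumes "smooth_fun A Q f" "z \<in> upper_half_plane"
  shows "(coord_deriv f v has_derivative (\<lambda>w. coord_deriv2 f v w z)) (at z)"
  unfolding coord_deriv2_def
  by (rule smooth_on_has_derivative[OF smooth_on_coord_deriv[OF assms(1)] assms(2)])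

lemma coord_deriv2_symmetric:
  assumes "smooth_fun A Q f" "z \<in> upper_half_plane"
  shows "coord_deriv2 f v w z = coord_deriv2 f w v z"
  using second_derivative_symmetric[of "f \<circ> \<Psi>" upper_half_plane z v w] assms open_upper_half_plane
  unfolding smooth_fun_Q_iff coord_deriv2_def coord_deriv_def[abs_def] by blast

lemma coord_deriv_eqI:
  assumes "\<And>z. z \<in> upper_half_plane \<Longrightarrow> k z = f (\<Psi> z)" "(k has_derivative D) (at z)"
    "z \<in> upper_half_plane"
  shows "coord_deriv f v z = D v"
proof -
  have "(f \<circ> \<Psi> has_derivative D) (at z)"
    by (rule has_derivative_transform_within_open[OF assms(2) open_upper_half_plane assms(3)])
       (simp add: assms(1))
  hence "D = frechet_derivative (f \<circ> \<Psi>) (at z)" by (rule frechet_derivative_at)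
  thus ?thesis by (simp add: coord_deriv_def)
qed

lemma coord_deriv_linear:
  assumes "smooth_fun A Q f" "smooth_fun A Q g" "z \<in> upper_half_plane"
  shows "coord_deriv (\<lambda>c. a * f c + b * g c) v z = a * coord_deriv f v z + b * coord_deriv g v z"
proof (rule coord_deriv_eqI[OF _ _ assms(3)])
  show "((\<lambda>z. a * (f \<circ> \<Psi>) z + b * (g \<circ> \<Psi>) z) has_derivative
      (\<lambda>v. a * coord_deriv f v z + b * coord_deriv g v z)) (at z)"
    by (intro has_derivative_add has_derivative_mult_right coord_deriv_has_derivative assms)
qed simp

lemma smooth_fun_linear:
  assumes "smooth_fun A Q f" "smooth_fun A Q g"
  shows "smooth_fun A Q (\<lambda>c. a * f c + b * g c :: complex)"
proof -
  have "smooth_on (\<lambda>z. a * (f \<circ> \<Psi>) z + b * (g \<circ> \<Psi>) z) upper_half_plane"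
    using assms unfolding smooth_fun_Q_iff
    by (intro smooth_on_add smooth_on_bounded_linear[OF bounded_linear_mult_right] open_upper_half_plane)
  thus ?thesis unfolding smooth_fun_Q_iff by (simp add: o_def)
qed

lemma X_Y_op_coord:
  assumes "smooth_fun A Q f" "z \<in> upper_half_plane"
  shows "X_op f (\<Psi> z) = Im z *\<^sub>R coord_deriv f 1 z" "Y_op f (\<Psi> z) = Im z *\<^sub>R coord_deriv f \<i> z"
proof -
  note D = coord_deriv_has_derivative[OF assms]
  have "coord_deriv f (r *\<^sub>R v) z = r *\<^sub>R coord_deriv f v z" for r v
    using linear_cmul[OF has_derivative_linear[OF D]] by simp
  from this[of "Im z" 1] this[of "Im z" \<i>]
  show "X_op f (\<Psi> z) = Im z *\<^sub>R coord_deriv f 1 z" "Y_op f (\<Psi> z) = Im z *\<^sub>R coord_deriv f \<i> z"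
    using X_Y_op_eq[of "\<Psi> z" f "\<lambda>v. coord_deriv f v z"] D assms(2)
    by (simp_all add: scaleR_conv_of_real mult.commute)
qed

lemma smooth_fun_X_Y_op:
  assumes "smooth_fun A Q f"
  shows "smooth_fun A Q (X_op f)" "smooth_fun A Q (Y_op f)"
proof -
  have sm: "smooth_on (\<lambda>z. Im z *\<^sub>R coord_deriv f v z) upper_half_plane" for v
    by (intro smooth_on_scaleR smooth_on_coord_deriv assms open_upper_half_plane
        smooth_on_bounded_linear[OF bounded_linear_Im] smooth_on_id)
  show "smooth_fun A Q (X_op f)" "smooth_fun A Q (Y_op f)"
    unfolding smooth_fun_Q_iff
    by (rule smooth_on_cong[OF open_upper_half_plane sm[of 1]], simp add: X_Y_op_coord[OF assms])
       (rule smooth_on_cong[OF open_upper_half_plane sm[of \<i>]], simp add: X_Y_op_coord[OF assms])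
qed

lemma coord_deriv_X_Y_op:
  assumes "smooth_fun A Q f" "z \<in> upper_half_plane"
  shows "coord_deriv (X_op f) v z = Im z *\<^sub>R coord_deriv2 f 1 v z + Im v *\<^sub>R coord_deriv f 1 z"
    "coord_deriv (Y_op f) v z = Im z *\<^sub>R coord_deriv2 f \<i> v z + Im v *\<^sub>R coord_deriv f \<i> z"
proof -
  have D: "((\<lambda>z. Im z *\<^sub>R coord_deriv f u z) has_derivative
      (\<lambda>v. Im z *\<^sub>R coord_deriv2 f u v z + Im v *\<^sub>R coord_deriv f u z)) (at z)" for u
    by (intro has_derivative_scaleR coord_deriv2_has_derivative assms
        bounded_linear_imp_has_derivative bounded_linear_Im)
  show "coord_deriv (X_op f) v z = Im z *\<^sub>R coord_deriv2 f 1 v z + Im v *\<^sub>R coord_deriv f 1 z"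
    by (rule coord_deriv_eqI[OF _ D assms(2)]) (simp add: X_Y_op_coord[OF assms(1)])
  show "coord_deriv (Y_op f) v z = Im z *\<^sub>R coord_deriv2 f \<i> v z + Im v *\<^sub>R coord_deriv f \<i> z"
    by (rule coord_deriv_eqI[OF _ D assms(2)]) (simp add: X_Y_op_coord[OF assms(1)])
qed

lemma X_Y_op_linear:
  assumes "smooth_fun A Q f" "smooth_fun A Q g" "c \<in> Q"
  shows "X_op (\<lambda>c. a * f c + b * g c) c = a * X_op f c + b * X_op g c"
    "Y_op (\<lambda>c. a * f c + b * g c) c = a * Y_op f c + b * Y_op g c"
proof -
  have z: "\<phi> c \<in> upper_half_plane" "\<Psi> (\<phi> c) = c" using assms(3) by auto
  show "X_op (\<lambda>c. a * f c + b * g c) c = a * X_op f c + b * X_op g c"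
    "Y_op (\<lambda>c. a * f c + b * g c) c = a * Y_op f c + b * Y_op g c"
    using X_Y_op_coord[OF smooth_fun_linear[OF assms(1,2)] z(1), of a b]
      X_Y_op_coord[OF assms(1) z(1)] X_Y_op_coord[OF assms(2) z(1)]
    by (simp_all add: z(2) coord_deriv_linear[OF assms(1,2) z(1)] scaleR_add_right)
qed

text \<open>In the difference of \<open>y \<partial>\<^sub>y (y \<partial>\<^sub>x f)\<close> and \<open>y \<partial>\<^sub>x (y \<partial>\<^sub>y f)\<close> the mixed second derivatives cancel, and the
derivative of the coefficient \<open>y\<close> leaves \<open>y \<partial>\<^sub>x f\<close>.\<close>

lemma commutator_Y_X:
  assumes "smooth_fun A Q f" "c \<in> Q"
  shows "Y_op (X_op f) c - X_op (Y_op f) c = X_op f c"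
proof -
  have z: "\<phi> c \<in> upper_half_plane" "\<Psi> (\<phi> c) = c" using assms(2) by auto
  show ?thesis
    using X_Y_op_coord[OF smooth_fun_X_Y_op(1)[OF assms(1)] z(1)]
      X_Y_op_coord[OF smooth_fun_X_Y_op(2)[OF assms(1)] z(1)] X_Y_op_coord[OF assms(1) z(1)]
      coord_deriv2_symmetric[OF assms(1) z(1), of 1 \<i>]
    by (simp add: z(2) coord_deriv_X_Y_op[OF assms(1) z(1)] scaleR_add_right)
qed

text \<open>The operator that integration by parts against \<open>dx dy / y\<^sup>2\<close> produces from \<open>X + \<i> Y\<close>.\<close>

definition dbar_adjoint :: "(adele_class \<Rightarrow> complex) \<Rightarrow> adele_class \<Rightarrow> complex" where
  "dbar_adjoint h c = - X_op h c + \<i> * Y_op h c - \<i> * h c"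

lemma smooth_fun_dbar_op: "smooth_fun A Q f \<Longrightarrow> smooth_fun A Q (dbar_op f)"
  using smooth_fun_linear[OF smooth_fun_X_Y_op, of f f 1 \<i>] by (simp add: dbar_op_def[abs_def])

lemma smooth_fun_dbar_adjoint:
  assumes "smooth_fun A Q h"
  shows "smooth_fun A Q (dbar_adjoint h)"
proof -
  have "smooth_fun A Q (\<lambda>c. 1 * (-1 * X_op h c + \<i> * Y_op h c) + (- \<i>) * h c)"
    by (intro smooth_fun_linear smooth_fun_X_Y_op assms)
  thus ?thesis by (simp add: dbar_adjoint_def[abs_def])
qed

text \<open>Expanding \<open>(X - \<i> Y + \<i>) (X + \<i> Y)\<close> gives \<open>X\<^sup>2 + Y\<^sup>2 - Y + \<i> ([X, Y] + X)\<close>, and the bracket term is 0. Completing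
the square in \<open>Y\<close> gives the first form.\<close>

lemma dbar_adjoint_dbar:
  assumes "smooth_fun A Q f" "c \<in> Q"
  shows "- dbar_adjoint (dbar_op f) c = X_op (X_op f) c + Y_half (Y_half f) c - f c / 4"
    "- dbar_adjoint (dbar_op f) c = X_op (X_op f) c + Y_op (Y_op f) c - Y_op f c"
proof -
  note sm = smooth_fun_X_Y_op[OF assms(1)]
  have db: "dbar_op f = (\<lambda>c. 1 * X_op f c + \<i> * Y_op f c)" by (simp add: dbar_op_def[abs_def])
  have "X_op (dbar_op f) c = X_op (X_op f) c + \<i> * X_op (Y_op f) c"
    "Y_op (dbar_op f) c = Y_op (X_op f) c + \<i> * Y_op (Y_op f) c"
    unfolding db using X_Y_op_linear[OF sm assms(2), of 1 \<i>] by simp_all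
  hence "- dbar_adjoint (dbar_op f) c = X_op (X_op f) c + Y_op (Y_op f) c - Y_op f c
      - \<i> * (Y_op (X_op f) c - X_op (Y_op f) c - X_op f c)"
    by (simp add: dbar_adjoint_def dbar_op_def algebra_simps flip: mult.assoc)
  thus *: "- dbar_adjoint (dbar_op f) c = X_op (X_op f) c + Y_op (Y_op f) c - Y_op f c"
    using commutator_Y_X[OF assms] by simp
  have yh: "Y_half f = (\<lambda>c. 1 * Y_op f c + (- 1 / 2) * f c)" by (simp add: Y_half_def[abs_def])
  have 1: "Y_half (Y_half f) c = Y_op (Y_half f) c - Y_half f c / 2" by (rule Y_half_def)
  have 2: "Y_op (Y_half f) c = 1 * Y_op (Y_op f) c + (- 1 / 2) * Y_op f c"
    unfolding yh by (rule X_Y_op_linear(2)[OF sm(2) assms])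
  have 3: "Y_half f c = Y_op f c - f c / 2" by (rule Y_half_def)
  show "- dbar_adjoint (dbar_op f) c = X_op (X_op f) c + Y_half (Y_half f) c - f c / 4"
    unfolding * 1 2 3 by (simp add: field_simps)
qed

text \<open>In the chart \<open>(\<phi> - b) / a\<close> both the coordinate vectors and \<open>y\<close> are rescaled by \<open>a\<close>, so the metric has the
same coefficients in all charts.\<close>

lemma gram_half_plane_metric:
  assumes "(U, \<kappa>) \<in> A" "z \<in> upper_half_plane"
  shows "gram A half_plane_metric (U, \<kappa>) v w z = (v \<bullet> w) / (Im z)\<^sup>2"
proof -
  obtain a b where U: "U = Q" and ch: "affine_chart a b \<kappa>" by (rule atlasE[OF assms(1)])
  note k = affine_chartD[OF ch]
  have "inv_into Q \<kappa> z = \<Psi> (of_real a * z + of_real b)" "\<Psi> (of_real a * z + of_real b) \<in> Q"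
    using k(3,4)[OF assms(2)] by auto
  hence "gram A half_plane_metric (U, \<kappa>) v w z
      = ((of_real a * v) \<bullet> (of_real a * w)) / (Im (of_real a * z + of_real b))\<^sup>2"
    using k(4)[OF assms(2)] by (simp add: gram_def Let_def U coord_vec_eq[OF ch] half_plane_metric_tvec)
  also have "\<dots> = (v \<bullet> w) / (Im z)\<^sup>2"
    using k(1) by (simp add: power_mult_distrib power2_eq_square flip: scaleR_conv_of_real)
  finally show ?thesis .
qed

lemma vol_density_half_plane_metric:
  assumes "(U, \<kappa>) \<in> A" "z \<in> upper_half_plane"
  shows "vol_density A half_plane_metric (U, \<kappa>) z = 1 / (Im z)\<^sup>2"
proof -
  have "1 / (Im z)\<^sup>2 * (1 / (Im z)\<^sup>2) = (1 / (Im z)\<^sup>2)\<^sup>2" by (simp add: power2_eq_square)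
  thus ?thesis
    by (simp add: vol_density_def gram_half_plane_metric[OF assms] inner_complex_def)
qed

text \<open>The two diagonal coefficients of the metric equal the volume density, and the mixed one is 0, so the coordinate
formula collapses to \<open>y\<^sup>2 (\<partial>\<^sub>x\<^sup>2 + \<partial>\<^sub>y\<^sup>2)\<close>, as in any conformal coordinate on a surface.\<close>

lemma laplace_beltrami_base_chart:
  assumes f: "smooth_fun A Q f" and c: "c \<in> Q"
  shows "laplace_beltrami A half_plane_metric (Q, restrict \<phi> Q) f c
       = X_op (X_op f) c + Y_half (Y_half f) c - f c / 4"
proof -
  let ?H = upper_half_plane and ?h = "f \<circ> inv_into Q (restrict \<phi> Q)"
  define z where "z = \<phi> c"
  have z: "z \<in> ?H" "\<Psi> z = c" "Im z > 0" using c by (auto simp: z_def)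
  have h: "partial v ?h w = coord_deriv f v w" if "w \<in> ?H" for v w
  proof (rule partial_eq)
    show "(?h has_derivative (\<lambda>v. coord_deriv f v w)) (at w)"
      by (rule has_derivative_transform_within_open[OF coord_deriv_has_derivative[OF f that]
            open_upper_half_plane that]) (simp add: inv_base_chart)
  qed
  let ?g = "gram A half_plane_metric (Q, restrict \<phi> Q)" and ?r = "vol_density A half_plane_metric (Q, restrict \<phi> Q)"
  note g = gram_half_plane_metric[OF base_chart] and r = vol_density_half_plane_metric[OF base_chart]
  have P: "partial u k z = coord_deriv2 f v u z" if k: "\<And>w. w \<in> ?H \<Longrightarrow> coord_deriv f v w = k w" for u v k
    by (rule partial_eq, rule has_derivative_transform_within_open[OF coord_deriv2_has_derivative[OF f z(1)]
            open_upper_half_plane z(1)]) (rule k)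
  have ne: "Im w \<noteq> 0" if "w \<in> ?H" for w using that by (simp add: upper_half_plane_def)
  have "laplace_beltrami A half_plane_metric (Q, restrict \<phi> Q) f c
      = (1 / ?r z) *\<^sub>R
         (partial 1 (\<lambda>z. (?g \<i> \<i> z / ?r z) *\<^sub>R partial 1 ?h z - (?g 1 \<i> z / ?r z) *\<^sub>R partial \<i> ?h z) z
        + partial \<i> (\<lambda>z. (?g 1 1 z / ?r z) *\<^sub>R partial \<i> ?h z - (?g 1 \<i> z / ?r z) *\<^sub>R partial 1 ?h z) z)"
    using c by (simp add: laplace_beltrami_def Let_def z_def)
  also have "\<dots> = (Im z)\<^sup>2 *\<^sub>R (coord_deriv2 f 1 1 z + coord_deriv2 f \<i> \<i> z)"
    by (subst (1 2) P) (simp_all add: g r h ne z(1) inner_complex_def)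
  also have "\<dots> = X_op (X_op f) c + Y_op (Y_op f) c - Y_op f c"
    using X_Y_op_coord[OF smooth_fun_X_Y_op(1)[OF f] z(1)]
      X_Y_op_coord[OF smooth_fun_X_Y_op(2)[OF f] z(1)] X_Y_op_coord[OF f z(1)]
    by (simp add: z(2) coord_deriv_X_Y_op[OF f z(1)] scaleR_add_right power2_eq_square)
  finally show ?thesis using dbar_adjoint_dbar[OF assms] by simp
qed


section \<open>The Riemannian volume\<close>

definition orbit_volume :: "adele_class measure" where
  "orbit_volume = distr (restrict_space (density lborel (\<lambda>z. ennreal (1 / (Im z)\<^sup>2))) upper_half_plane)
     (sigma Q {W. openin (surface_topology A) W}) \<Psi>"

lemma opens_subset: "{W. openin (surface_topology A) W} \<subseteq> Pow Q"
  by (auto simp: openin_iff)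

lemma \<Psi>_measurable:
  assumes "sets M = sets borel"
  shows "\<Psi> \<in> measurable (restrict_space M upper_half_plane) (sigma Q {W. openin (surface_topology A) W})"
proof (rule measurable_measure_of[OF opens_subset])
  have sp: "space M = UNIV" using sets_eq_imp_space_eq[OF assms] by simp
  have H: "upper_half_plane \<in> sets M" using open_upper_half_plane by (simp add: assms)
  show "\<Psi> \<in> space (restrict_space M upper_half_plane) \<rightarrow> Q"
    by (auto simp: space_restrict_space sp)
  fix W assume "W \<in> {W. openin (surface_topology A) W}"
  hence W: "W \<subseteq> Q" "open (\<phi> ` W)" by (simp_all add: openin_iff)
  have "\<Psi> -` W \<inter> space (restrict_space M upper_half_plane) = \<phi> ` W"
    using mem_\<phi>_image_iff[OF W(1)] \<phi>_image_subset[OF W(1)] by (auto simp: space_restrict_space sp)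
  thus "\<Psi> -` W \<inter> space (restrict_space M upper_half_plane) \<in> sets (restrict_space M upper_half_plane)"
    using W(2) \<phi>_image_subset[OF W(1)] H by (simp add: sets_restrict_space_iff sp assms)
qed

lemma space_sets_orbit_volume:
  "space orbit_volume = Q" "sets orbit_volume = sigma_sets Q {W. openin (surface_topology A) W}"
  using opens_subset by (simp_all add: orbit_volume_def sets_measure_of space_measure_of)

lemma vimage_\<Psi>_eq: "B \<subseteq> Q \<Longrightarrow> \<Psi> -` B \<inter> upper_half_plane = \<phi> ` B"
  using mem_\<phi>_image_iff[of B] \<phi>_image_subset[of B] by auto

lemma \<phi>_image_borel:
  assumes "B \<in> sets orbit_volume"
  shows "\<phi> ` B \<in> sets borel"
proof -
  have BQ: "B \<subseteq> Q" using sets.sets_into_space[OF assms] by (simp add: space_sets_orbit_volume)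
  have "B \<in> sets (sigma Q {W. openin (surface_topology A) W})"
    using assms by (simp add: orbit_volume_def)
  from measurable_sets[OF \<Psi>_measurable[of borel] this]
  have "\<phi> ` B \<in> sets (restrict_space borel upper_half_plane)"
    using vimage_\<Psi>_eq[OF BQ] by (simp add: space_restrict_space)
  thus ?thesis using open_upper_half_plane by (simp add: sets_restrict_space_iff)
qed

lemma emeasure_orbit_volume:
  assumes "B \<in> sets orbit_volume"
  shows "emeasure orbit_volume B = (\<integral>\<^sup>+z\<in>\<phi> ` B. ennreal (1 / (Im z)\<^sup>2) \<partial>lborel)"
proof -
  let ?N = "density lborel (\<lambda>z. ennreal (1 / (Im z)\<^sup>2)) :: complex measure"
  have [measurable]: "Im \<in> borel_measurable borel"
    by (intro borel_measurable_continuous_onI continuous_intros)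
  have BQ: "B \<subseteq> Q" using sets.sets_into_space[OF assms] by (simp add: space_sets_orbit_volume)
  have "emeasure orbit_volume B = emeasure (restrict_space ?N upper_half_plane) (\<phi> ` B)"
    using assms vimage_\<Psi>_eq[OF BQ] \<Psi>_measurable[of ?N]
    by (simp add: orbit_volume_def emeasure_distr space_restrict_space)
  also have "\<dots> = emeasure ?N (\<phi> ` B)"
    using open_upper_half_plane \<phi>_image_subset[OF BQ] by (intro emeasure_restrict_space) auto
  also have "\<dots> = (\<integral>\<^sup>+z\<in>\<phi> ` B. ennreal (1 / (Im z)\<^sup>2) \<partial>lborel)"
    using \<phi>_image_borel[OF assms] by (intro emeasure_density) auto
  finally show ?thesis .
qed

lemma riemannian_volume_orbit_volume: "riemannian_volume A half_plane_metric orbit_volume"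
  unfolding riemannian_volume_def points_atlas ball_chart_iff
proof (intro conjI allI impI ballI space_sets_orbit_volume)
  fix U \<kappa> B assume ch: "(U, \<kappa>) \<in> A" and B: "B \<in> sets orbit_volume"
  have BQ: "B \<subseteq> Q" using sets.sets_into_space[OF B] by (simp add: space_sets_orbit_volume)
  obtain a b where U: "U = Q" and "affine_chart a b \<kappa>" by (rule atlasE[OF ch])
  note k = affine_chartD[OF this(2)]
  have "emeasure orbit_volume B = (\<integral>\<^sup>+z\<in>\<phi> ` B. ennreal (1 / (Im z)\<^sup>2) \<partial>lborel)"
    by (rule emeasure_orbit_volume[OF B])
  also have "\<dots> = (\<integral>\<^sup>+z\<in>\<kappa> ` B. ennreal (1 / (Im z)\<^sup>2) \<partial>lborel)"
    unfolding k(8)[OF BQ] by (rule nn_integral_hyperbolic_affine[OF k(1) \<phi>_image_borel[OF B], symmetric])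
  also have "\<dots> = (\<integral>\<^sup>+z\<in>\<kappa> ` B. ennreal (vol_density A half_plane_metric (U, \<kappa>) z) \<partial>lborel)"
  proof (rule nn_integral_cong)
    fix z
    have "z \<in> \<kappa> ` B \<Longrightarrow> z \<in> upper_half_plane" using k(7) BQ by blast
    thus "ennreal (1 / (Im z)\<^sup>2) * indicator (\<kappa> ` B) z
        = ennreal (vol_density A half_plane_metric (U, \<kappa>) z) * indicator (\<kappa> ` B) z"
      by (cases "z \<in> \<kappa> ` B") (simp_all add: vol_density_half_plane_metric[OF ch])
  qed
  finally show "emeasure orbit_volume B
      = (\<integral>\<^sup>+z\<in>\<kappa> ` B. ennreal (vol_density A half_plane_metric (U, \<kappa>) z) \<partial>lborel)" .
qed

text \<open>The domain of a single chart is the whole orbit, so the local formula gives the measure of every set.\<close>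

lemma riemannian_volume_unique:
  assumes "riemannian_volume A half_plane_metric \<mu>"
  shows "\<mu> = orbit_volume"
proof (rule measure_eqI)
  show sets: "sets \<mu> = sets orbit_volume"
    using assms unfolding riemannian_volume_def points_atlas space_sets_orbit_volume by blast
  fix B assume B: "B \<in> sets \<mu>"
  have BQ: "B \<subseteq> Q" using sets.sets_into_space[of B orbit_volume] B by (simp add: space_sets_orbit_volume sets)
  have "emeasure \<nu> B = (\<integral>\<^sup>+z\<in>restrict \<phi> Q ` B.
      ennreal (vol_density A half_plane_metric (Q, restrict \<phi> Q) z) \<partial>lborel)"
    if "riemannian_volume A half_plane_metric \<nu>" "B \<in> sets \<nu>" for \<nu>
    using that BQ base_chart unfolding riemannian_volume_def ball_chart_iff by blast
  thus "emeasure \<mu> B = emeasure orbit_volume B"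
    using assms riemannian_volume_orbit_volume B sets by simp
qed

lemma \<phi>_measurable: "\<phi> \<in> measurable (sigma Q {W. openin (surface_topology A) W}) borel"
proof (rule borel_measurableI)
  fix S :: "complex set" assume S: "open S"
  have "\<phi> ` (\<phi> -` S \<inter> Q) = S \<inter> \<phi> ` Q" by blast
  hence "\<phi> ` (\<phi> -` S \<inter> Q) = S \<inter> upper_half_plane" by (simp only: \<phi>_image)
  hence "openin (surface_topology A) (\<phi> -` S \<inter> Q)"
    using S open_upper_half_plane by (simp add: openin_iff open_Int)
  thus "\<phi> -` S \<inter> space (sigma Q {W. openin (surface_topology A) W})
      \<in> sets (sigma Q {W. openin (surface_topology A) W})"
    using opens_subset by (simp add: space_measure_of sets_measure_of)
qed

lemma integral_orbit_volume:
  fixes g :: "adele_class \<Rightarrow> complex"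
  assumes "continuous_on upper_half_plane (g \<circ> \<Psi>)"
  shows "(\<integral>c. g c \<partial>orbit_volume) = (\<integral>z. (indicator upper_half_plane z / (Im z)\<^sup>2) *\<^sub>R g (\<Psi> z) \<partial>lborel)"
proof -
  let ?H = upper_half_plane and ?N = "density lborel (\<lambda>z. ennreal (1 / (Im z)\<^sup>2)) :: complex measure"
  let ?S = "sigma Q {W. openin (surface_topology A) W}"
  have [measurable]: "Im \<in> borel_measurable borel"
    by (intro borel_measurable_continuous_onI continuous_intros)
  have k: "(\<lambda>z. indicator ?H z *\<^sub>R (g \<circ> \<Psi>) z) \<in> borel_measurable borel"
    using open_upper_half_plane by (intro borel_measurable_continuous_on_indicator assms) auto
  have "g \<in> borel_measurable ?S"
  proof (subst measurable_cong)
    show "(\<lambda>c. indicator ?H (\<phi> c) *\<^sub>R (g \<circ> \<Psi>) (\<phi> c)) \<in> borel_measurable ?S"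
      by (rule measurable_compose[OF \<phi>_measurable k])
    show "g c = indicator ?H (\<phi> c) *\<^sub>R (g \<circ> \<Psi>) (\<phi> c)" if "c \<in> space ?S" for c
      using that opens_subset by (simp add: space_measure_of)
  qed
  hence "(\<integral>c. g c \<partial>orbit_volume) = (\<integral>z. g (\<Psi> z) \<partial>restrict_space ?N ?H)"
    unfolding orbit_volume_def by (intro integral_distr \<Psi>_measurable) auto
  also have "\<dots> = (\<integral>z. indicator ?H z *\<^sub>R (g \<circ> \<Psi>) z \<partial>?N)"
    using open_upper_half_plane by (subst integral_restrict_space) auto
  also have "\<dots> = (\<integral>z. (1 / (Im z)\<^sup>2) *\<^sub>R indicator ?H z *\<^sub>R (g \<circ> \<Psi>) z \<partial>lborel)"
    using k by (intro integral_density) auto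
  finally show ?thesis by simp
qed

lemma compact_supportD:
  assumes "compact_support A f"
  obtains K where "compact K" "K \<subseteq> upper_half_plane" "\<And>z. z \<in> upper_half_plane - K \<Longrightarrow> f (\<Psi> z) = 0"
proof -
  obtain K where K: "compactin (surface_topology A) K" "\<And>c. c \<in> Q - K \<Longrightarrow> f c = 0"
    using assms unfolding compact_support_def points_atlas by blast
  have KQ: "K \<subseteq> Q" using compactin_subset_topspace[OF K(1)] by (simp add: topspace_Q)
  have "continuous_map (surface_topology A) (top_of_set upper_half_plane) \<phi>"
    using homeomorphic_half_plane by (simp add: homeomorphic_maps_def)
  from image_compactin[OF K(1) this] have "compact (\<phi> ` K)" "\<phi> ` K \<subseteq> upper_half_plane"
    by (simp_all add: compactin_subtopology)
  moreover have "f (\<Psi> z) = 0" if "z \<in> upper_half_plane - \<phi> ` K" for z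
    using that mem_\<phi>_image_iff[OF KQ, of z] by (intro K(2)) auto
  ultimately show ?thesis using that by blast
qed

lemma compact_supportI:
  assumes "compact K" "K \<subseteq> upper_half_plane" "\<And>z. z \<in> upper_half_plane - K \<Longrightarrow> f (\<Psi> z) = 0"
  shows "compact_support A f"
proof -
  have "continuous_map (top_of_set upper_half_plane) (surface_topology A) \<Psi>"
    using homeomorphic_half_plane by (simp add: homeomorphic_maps_def)
  moreover have "compactin (top_of_set upper_half_plane) K"
    using assms(1,2) by (simp add: compactin_subtopology)
  ultimately have "compactin (surface_topology A) (\<Psi> ` K)" by (rule image_compactin[rotated])
  moreover have "f c = 0" if "c \<in> Q - \<Psi> ` K" for c
  proof -
    have "\<phi> c \<notin> K" using that by (metis DiffE \<Psi>_\<phi> imageI)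
    thus ?thesis using assms(3)[of "\<phi> c"] that by simp
  qed
  ultimately show ?thesis unfolding compact_support_def points_atlas by blast
qed


section \<open>The formal adjoint\<close>

lemma adjoint_integrand_identity:
  fixes y :: real and u u1 u2 w w1 w2 :: complex
  assumes "y \<noteq> 0"
  shows "(1 / y\<^sup>2) *\<^sub>R ((y *\<^sub>R u1 + \<i> * (y *\<^sub>R u2)) * cnj w)
     = (1 / y\<^sup>2) *\<^sub>R (u * cnj (- (y *\<^sub>R w1) + \<i> * (y *\<^sub>R w2) - \<i> * w))
       + (inverse y *\<^sub>R (u * cnj w1 + u1 * cnj w)
          + \<i> * (inverse y *\<^sub>R (u * cnj w2 + u2 * cnj w) + (- (inverse y * inverse y)) *\<^sub>R (u * cnj w)))"
  using assms by (simp add: scaleR_conv_of_real field_simps power2_eq_square)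

text \<open>For \<open>F = f \<cdot> cnj h / y\<close>, continued by 0 outside the half plane, the integrands of \<open>\<langle>(X + \<i> Y) f, h\<rangle>\<close> and of
  \<open>\<langle>f, -X h + \<i> Y h - \<i> h\<rangle>\<close> differ by \<open>\<partial>\<^sub>x F + \<i> \<partial>\<^sub>y F\<close>, which has integral 0. The term \<open>-\<i> h\<close> comes from
  differentiating \<open>1 / y\<close>.\<close>

lemma dbar_integration_by_parts:
  assumes f: "smooth_fun A Q f" "compact_support A f" and h: "smooth_fun A Q h"
  shows "(\<integral>c. dbar_op f c * cnj (h c) \<partial>orbit_volume) = (\<integral>c. f c * cnj (dbar_adjoint h c) \<partial>orbit_volume)"
proof -
  let ?H = upper_half_plane
  obtain K where K: "compact K" "K \<subseteq> ?H" and K0: "\<And>z. z \<in> ?H - K \<Longrightarrow> f (\<Psi> z) = 0"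
    using compact_supportD[OF f(2)] by blast
  define F where "F z = (if z \<in> ?H then inverse (Im z) *\<^sub>R (f (\<Psi> z) * cnj (h (\<Psi> z))) else 0)" for z
  have F0: "F z = 0" if "z \<notin> K" for z using K0 that by (auto simp: F_def)
  have smF: "smooth_on F UNIV"
  proof (rule smooth_on_local)
    fix z
    show "\<exists>U. open U \<and> z \<in> U \<and> smooth_on F U"
    proof (cases "z \<in> ?H")
      case True
      have "smooth_on (\<lambda>z. inverse (Im z) *\<^sub>R ((f \<circ> \<Psi>) z * cnj ((h \<circ> \<Psi>) z))) ?H"
        using f(1) h unfolding smooth_fun_Q_iff
        by (intro smooth_on_scaleR smooth_on_inverse_Im smooth_on_mult open_upper_half_plane
            smooth_on_bounded_linear[OF bounded_linear_cnj])
      hence "smooth_on F ?H" by (rule smooth_on_cong[OF open_upper_half_plane]) (simp add: F_def)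
      thus ?thesis using True open_upper_half_plane by blast
    next
      case False
      have op: "open (- K)" using K(1) compact_imp_closed by blast
      have "smooth_on F (- K)"
        by (rule smooth_on_cong[OF op smooth_on_const[OF op, of 0]]) (simp add: F0)
      thus ?thesis using False K(2) op by blast
    qed
  qed
  let ?DF = "\<lambda>z. frechet_derivative F (at z)"
  have DF: "?DF z v = inverse (Im z) *\<^sub>R (f (\<Psi> z) * cnj (coord_deriv h v z) + coord_deriv f v z * cnj (h (\<Psi> z)))
      + (- (inverse (Im z) * Im v * inverse (Im z))) *\<^sub>R (f (\<Psi> z) * cnj (h (\<Psi> z)))" if z: "z \<in> ?H" for z v
  proof -
    have inv: "((\<lambda>z. inverse (Im z)) has_derivative (\<lambda>v. - (inverse (Im z) * Im v * inverse (Im z)))) (at z)"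
      by (rule Deriv.has_derivative_inverse)
         (use z bounded_linear_imp_has_derivative[OF bounded_linear_Im] in \<open>auto simp: upper_half_plane_def\<close>)
    have "((\<lambda>z. inverse (Im z) *\<^sub>R ((f \<circ> \<Psi>) z * cnj ((h \<circ> \<Psi>) z))) has_derivative
      (\<lambda>v. inverse (Im z) *\<^sub>R ((f \<circ> \<Psi>) z * cnj (coord_deriv h v z) + coord_deriv f v z * cnj ((h \<circ> \<Psi>) z))
      + (- (inverse (Im z) * Im v * inverse (Im z))) *\<^sub>R ((f \<circ> \<Psi>) z * cnj ((h \<circ> \<Psi>) z)))) (at z)"
      by (rule has_derivative_scaleR[OF inv
          has_derivative_mult[OF coord_deriv_has_derivative[OF f(1) z]
            bounded_linear.has_derivative[OF bounded_linear_cnj coord_deriv_has_derivative[OF h z]]]])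
    hence "(F has_derivative
      (\<lambda>v. inverse (Im z) *\<^sub>R ((f \<circ> \<Psi>) z * cnj (coord_deriv h v z) + coord_deriv f v z * cnj ((h \<circ> \<Psi>) z))
      + (- (inverse (Im z) * Im v * inverse (Im z))) *\<^sub>R ((f \<circ> \<Psi>) z * cnj ((h \<circ> \<Psi>) z)))) (at z)"
      by (rule has_derivative_transform_within_open[OF _ open_upper_half_plane z]) (simp add: F_def)
    from fun_cong[OF frechet_derivative_at[OF this], of v] show ?thesis by (simp only: o_apply)
  qed
  let ?w = "\<lambda>z. indicator ?H z / (Im z)\<^sup>2 :: real"
  let ?L = "\<lambda>z. ?w z *\<^sub>R (dbar_op f (\<Psi> z) * cnj (h (\<Psi> z)))"
  let ?R = "\<lambda>z. ?w z *\<^sub>R (f (\<Psi> z) * cnj (dbar_adjoint h (\<Psi> z)))"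
  have LR: "?L z = ?R z + (?DF z 1 + \<i> * ?DF z \<i>)" for z
  proof (cases "z \<in> ?H")
    case True
    hence "Im z \<noteq> 0" by (simp add: upper_half_plane_def)
    from adjoint_integrand_identity[OF this] show ?thesis
      using True by (simp add: DF dbar_op_def dbar_adjoint_def X_Y_op_coord[OF f(1)] X_Y_op_coord[OF h])
  next
    case False
    hence "z \<notin> K" using K(2) by blast
    thus ?thesis using False frechet_derivative_eq_0_outside[OF K(1) F0] by simp
  qed
  have cont: "continuous_on ?H (g \<circ> \<Psi>)" if "smooth_fun A Q g" for g :: "adele_class \<Rightarrow> complex"
    using that smooth_on_imp_continuous_on unfolding smooth_fun_Q_iff by blast
  have cR: "continuous_on ?H (\<lambda>z. f (\<Psi> z) * cnj (dbar_adjoint h (\<Psi> z)))"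
    using cont[OF f(1)] cont[OF smooth_fun_dbar_adjoint[OF h]]
    by (intro continuous_intros) (simp_all add: o_def)
  have cL: "continuous_on ?H (\<lambda>z. dbar_op f (\<Psi> z) * cnj (h (\<Psi> z)))"
    using cont[OF smooth_fun_dbar_op[OF f(1)]] cont[OF h]
    by (intro continuous_intros) (simp_all add: o_def)
  have intR: "integrable lborel ?R"
    by (rule integrable_hyperbolic_compact_support[OF cR K]) (use K0 in auto)
  have intD: "integrable lborel (\<lambda>z. ?DF z v)" "(\<integral>z. ?DF z v \<partial>lborel) = 0" for v
    by (rule integrable_directional_derivative[OF smF K(1) F0], assumption)
       (rule integral_directional_derivative_eq_0[OF smF K(1) F0])
  have "(\<integral>z. ?L z \<partial>lborel) = (\<integral>z. ?R z \<partial>lborel)"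
    unfolding LR using intR intD by simp
  thus ?thesis
    using cL cR by (simp add: integral_orbit_volume o_def)
qed

lemma formal_adjoint_dbar_adjoint: "formal_adjoint A orbit_volume dbar_op dbar_adjoint"
  unfolding formal_adjoint_def points_atlas
  using smooth_fun_dbar_adjoint dbar_integration_by_parts by blast

text \<open>Two adjoints differ on \<open>h\<close> by a smooth function \<open>q\<close> orthogonal to all test functions. Testing with a bump
  function times \<open>q\<close> shows that \<open>q\<close> vanishes at the centre of the bump.\<close>

lemma formal_adjoint_unique:
  assumes D': "formal_adjoint A orbit_volume dbar_op D'" and h: "smooth_fun A Q h" and c: "c \<in> Q"
  shows "D' h c = dbar_adjoint h c"
proof -
  let ?H = upper_half_plane
  have smD: "smooth_fun A Q (D' h)" using D' h unfolding formal_adjoint_def points_atlas by blast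
  define q where "q c = 1 * D' h c + (- 1) * dbar_adjoint h c" for c
  have smq: "smooth_fun A Q q"
    unfolding q_def[abs_def] by (intro smooth_fun_linear smD smooth_fun_dbar_adjoint h)
  have z: "\<phi> c \<in> ?H" using c by simp
  obtain r where r: "r > 0" "cball (\<phi> c) r \<subseteq> ?H"
    using open_contains_cball open_upper_half_plane z by blast
  obtain \<beta> :: "complex \<Rightarrow> real" where \<beta>: "smooth_on \<beta> UNIV" "\<And>z. \<beta> z \<ge> 0" "\<beta> (\<phi> c) > 0"
    "\<And>z. z \<notin> cball (\<phi> c) r \<Longrightarrow> \<beta> z = 0"
    using ex_smooth_bump[OF r(1), of "\<phi> c"] by blast
  define f where "f d = \<beta> (\<phi> d) *\<^sub>R q d" for d
  have "smooth_on (\<lambda>z. \<beta> z *\<^sub>R (q \<circ> \<Psi>) z) ?H"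
    using smq unfolding smooth_fun_Q_iff o_def
    by (intro smooth_on_scaleR open_upper_half_plane smooth_on_subset[OF \<beta>(1)]) auto
  hence "smooth_on (f \<circ> \<Psi>) ?H"
    by (rule smooth_on_cong[OF open_upper_half_plane]) (simp add: f_def)
  hence smf: "smooth_fun A Q f" by (simp add: smooth_fun_Q_iff)
  have f0: "f (\<Psi> z) = 0" if "z \<in> ?H - cball (\<phi> c) r" for z
    using that \<beta>(4)[of z] by (simp add: f_def)
  have csf: "compact_support A f"
    by (rule compact_supportI[where K = "cball (\<phi> c) r"]) (use r(2) f0 in auto)
  have cont: "continuous_on ?H (\<lambda>z. g (\<Psi> z))" if "smooth_fun A Q g" for g :: "adele_class \<Rightarrow> complex"
    using that smooth_on_imp_continuous_on unfolding smooth_fun_Q_iff o_def by blast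
  let ?w = "\<lambda>z. indicator ?H z / (Im z)\<^sup>2 :: real"
  have cg: "continuous_on ?H (\<lambda>z. f (\<Psi> z) * cnj (g (\<Psi> z)))"
    and ig: "integrable lborel (\<lambda>z. ?w z *\<^sub>R (f (\<Psi> z) * cnj (g (\<Psi> z))))"
    if "smooth_fun A Q g" for g :: "adele_class \<Rightarrow> complex"
  proof -
    show cg: "continuous_on ?H (\<lambda>z. f (\<Psi> z) * cnj (g (\<Psi> z)))"
      by (intro continuous_intros cont smf that)
    show "integrable lborel (\<lambda>z. ?w z *\<^sub>R (f (\<Psi> z) * cnj (g (\<Psi> z))))"
      by (rule integrable_hyperbolic_compact_support[OF cg compact_cball r(2)]) (use f0 in auto)
  qed
  have adj: "(\<integral>c. dbar_op f c * cnj (h c) \<partial>orbit_volume) = (\<integral>c. f c * cnj (D h c) \<partial>orbit_volume)"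
    if "formal_adjoint A orbit_volume dbar_op D" for D
    using that smf csf h unfolding formal_adjoint_def points_atlas by blast
  have "(\<integral>c. f c * cnj (D' h c) \<partial>orbit_volume) = (\<integral>c. f c * cnj (dbar_adjoint h c) \<partial>orbit_volume)"
    by (rule trans[OF adj[OF D', symmetric] adj[OF formal_adjoint_dbar_adjoint]])
  hence eq: "(\<integral>z. ?w z *\<^sub>R (f (\<Psi> z) * cnj (D' h (\<Psi> z))) \<partial>lborel)
      = (\<integral>z. ?w z *\<^sub>R (f (\<Psi> z) * cnj (dbar_adjoint h (\<Psi> z))) \<partial>lborel)"
    using cg[OF smD] cg[OF smooth_fun_dbar_adjoint[OF h]] by (simp add: integral_orbit_volume o_def)
  define G where "G z = ?w z * (\<beta> z * (cmod (q (\<Psi> z)))\<^sup>2)" for z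
  have "?w z *\<^sub>R (f (\<Psi> z) * cnj (D' h (\<Psi> z))) - ?w z *\<^sub>R (f (\<Psi> z) * cnj (dbar_adjoint h (\<Psi> z)))
      = complex_of_real (G z)" for z
  proof (cases "z \<in> ?H")
    case True
    have "f (\<Psi> z) * cnj (D' h (\<Psi> z)) - f (\<Psi> z) * cnj (dbar_adjoint h (\<Psi> z)) = \<beta> z *\<^sub>R (q (\<Psi> z) * cnj (q (\<Psi> z)))"
      using True by (simp add: f_def q_def algebra_simps)
    also have "\<dots> = complex_of_real (\<beta> z * (cmod (q (\<Psi> z)))\<^sup>2)"
      by (simp only: complex_norm_square[symmetric] scaleR_conv_of_real of_real_mult)
    finally show ?thesis
      unfolding G_def scaleR_diff_right[symmetric] by (simp only: scaleR_conv_of_real of_real_mult)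
  qed (simp add: G_def)
  hence G': "(\<integral>z. complex_of_real (G z) \<partial>lborel) = 0" "integrable lborel (\<lambda>z. complex_of_real (G z))"
    using Bochner_Integration.integral_diff[OF ig[OF smD] ig[OF smooth_fun_dbar_adjoint[OF h]]]
      Bochner_Integration.integrable_diff[OF ig[OF smD] ig[OF smooth_fun_dbar_adjoint[OF h]]] eq
    by simp_all
  have G: "integrable lborel G" "integral\<^sup>L lborel G = 0"
    using integrable_Re[OF G'(2)] G'(1) by simp_all
  have "continuous_on ?H (\<lambda>z. (1 / (Im z)\<^sup>2) * (\<beta> z * (cmod (q (\<Psi> z)))\<^sup>2))"
    using cont[OF smq] continuous_on_subset[OF smooth_on_imp_continuous_on[OF \<beta>(1)]]
    by (intro continuous_intros) (auto simp: upper_half_plane_def)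
  hence "continuous_on ?H G"
    by (subst continuous_on_cong[OF refl, of _ _ "\<lambda>z. (1 / (Im z)\<^sup>2) * (\<beta> z * (cmod (q (\<Psi> z)))\<^sup>2)"])
       (simp_all add: G_def)
  moreover have "G z \<ge> 0" for z using \<beta>(2) by (simp add: G_def)
  ultimately have "G (\<phi> c) = 0"
    using continuous_nonneg_integral_0_imp_0[OF G(1) _ G(2) _ open_upper_half_plane z] by blast
  moreover have "Im (\<phi> c) \<noteq> 0" using Im_\<phi>_pos[OF c] by linarith
  ultimately have "q c = 0" using \<beta>(3) z c by (auto simp: G_def)
  thus ?thesis by (simp add: q_def)
qed


section \<open>The geometry of the orbits\<close>

lemma ex_half_plane_isomorphism:
  assumes "orbit_metric Q g" "orbit_complex_structure Q C"
  shows "\<exists>\<Phi>. surface_iso smooth_on A half_plane_atlas \<Phi> \<and>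
     surface_iso (holomorphic_on) C half_plane_atlas \<Phi> \<and>
     (\<forall>c\<in>Q. \<forall>u\<in>tangent_space A c. \<forall>v\<in>tangent_space A c.
        poincare_metric (\<Phi> c) (pushforward \<Phi> u) (pushforward \<Phi> v) = g c u v)"
  by (intro exI[of _ \<phi>] conjI ballI half_plane_isomorphism[OF assms])

lemma ex1_structures:
  shows "\<exists>!g. orbit_metric Q g" "\<exists>!C. orbit_complex_structure Q C"
proof -
  show "\<exists>!g. orbit_metric Q g"
    using orbit_half_plane_metric orbit_metric_unique by (rule ex1I)
  show "\<exists>!C. orbit_complex_structure Q C"
    using orbit_complex_structure_holo_atlas orbit_complex_structure_unique by (rule ex1I)
qed

lemma volume_and_adjoint:
  assumes "orbit_metric Q g"
  shows "\<exists>!\<mu>. riemannian_volume A g \<mu>"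
    "riemannian_volume A g \<mu> \<Longrightarrow> \<exists>D'. formal_adjoint A \<mu> dbar_op D'"
proof -
  have g: "g = half_plane_metric" by (rule orbit_metric_unique[OF assms])
  show "\<exists>!\<mu>. riemannian_volume A g \<mu>"
    unfolding g using riemannian_volume_orbit_volume riemannian_volume_unique by (rule ex1I)
  assume "riemannian_volume A g \<mu>"
  hence \<mu>: "\<mu> = orbit_volume" unfolding g by (rule riemannian_volume_unique)
  show "\<exists>D'. formal_adjoint A \<mu> dbar_op D'"
    unfolding \<mu> using formal_adjoint_dbar_adjoint by blast
qed

text \<open>The parametrization is arbitrary, so applying this with every point of the orbit as base point covers all charts.\<close>

lemma orbit_laplacian:
  assumes "orbit_metric Q g" "riemannian_volume A g \<mu>" "formal_adjoint A \<mu> dbar_op D'"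
    and f: "smooth_fun A Q f" and c: "c \<in> Q"
  shows "- D' (dbar_op f) c = X_op (X_op f) c + Y_half (Y_half f) c - f c / 4"
    "laplace_beltrami A g (Q, restrict \<phi> Q) f c = X_op (X_op f) c + Y_half (Y_half f) c - f c / 4"
proof -
  have g: "g = half_plane_metric" by (rule orbit_metric_unique[OF assms(1)])
  have \<mu>: "\<mu> = orbit_volume" using assms(2) unfolding g by (rule riemannian_volume_unique)
  have "D' (dbar_op f) c = dbar_adjoint (dbar_op f) c"
    by (rule formal_adjoint_unique[OF assms(3)[unfolded \<mu>] smooth_fun_dbar_op[OF f] c])
  thus "- D' (dbar_op f) c = X_op (X_op f) c + Y_half (Y_half f) c - f c / 4"
    using dbar_adjoint_dbar(1)[OF f c] by simp
  show "laplace_beltrami A g (Q, restrict \<phi> Q) f c = X_op (X_op f) c + Y_half (Y_half f) c - f c / 4"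
    unfolding g by (rule laplace_beltrami_base_chart[OF f c])
qed

end

theorem proposition5p1:
  shows
   "openin class_topology V_space \<and> free_right_action P_plus V_space right_act \<and>
    (\<forall>Q \<in> orbit_of ` V_space.
       smooth_surface (orbit_atlas Q) \<and> points (orbit_atlas Q) = Q \<and>
       (\<exists>!g. orbit_metric Q g) \<and>
       (\<exists>!C. orbit_complex_structure Q C) \<and>
       (\<forall>g C. orbit_metric Q g \<and> orbit_complex_structure Q C \<longrightarrow>
          (\<exists>\<Phi>. surface_iso smooth_on (orbit_atlas Q) half_plane_atlas \<Phi> \<and>
               surface_iso (holomorphic_on) C half_plane_atlas \<Phi> \<and>
               (\<forall>c\<in>Q. \<forall>u\<in>tangent_space (orbit_atlas Q) c. \<forall>v\<in>tangent_space (orbit_atlas Q) c.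
                  poincare_metric (\<Phi> c) (pushforward \<Phi> u) (pushforward \<Phi> v) = g c u v))) \<and>
       (\<forall>g. orbit_metric Q g \<longrightarrow>
          (\<exists>!\<mu>. riemannian_volume (orbit_atlas Q) g \<mu>) \<and>
          (\<forall>\<mu>. riemannian_volume (orbit_atlas Q) g \<mu> \<longrightarrow>
             (\<exists>D'. formal_adjoint (orbit_atlas Q) \<mu> dbar_op D') \<and>
             (\<forall>D'. formal_adjoint (orbit_atlas Q) \<mu> dbar_op D' \<longrightarrow>
                (\<forall>f. smooth_fun (orbit_atlas Q) Q f \<longrightarrow>
                   (\<forall>c\<in>Q.
                      - D' (dbar_op f) c = X_op (X_op f) c + Y_half (Y_half f) c - f c / 4 \<and>
                      (\<forall>ch\<in>orbit_atlas Q.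
                         laplace_beltrami (orbit_atlas Q) g ch f c = - D' (dbar_op f) c)))))))"
proof (intro conjI ballI openin_V_space free_right_action_V_space)
  fix Q assume Q: "Q \<in> orbit_of ` V_space"
  then obtain c where "Q = orbit_of c" by blast
  hence base: "orbit_map c \<i> \<in> Q" by (simp add: orbit_of_eq upper_half_plane_def)
  note param = parametrized_orbit_orbit_map[OF Q]
  note orbit = param[OF base]
  show "smooth_surface (orbit_atlas Q)" by (rule parametrized_orbit.smooth_surface_orbit[OF orbit])
  show "points (orbit_atlas Q) = Q" by (rule parametrized_orbit.points_atlas[OF orbit])
  show "\<exists>!g. orbit_metric Q g" "\<exists>!C. orbit_complex_structure Q C"
    by (rule parametrized_orbit.ex1_structures[OF orbit])+
  show "\<forall>g C. orbit_metric Q g \<and> orbit_complex_structure Q C \<longrightarrow>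
      (\<exists>\<Phi>. surface_iso smooth_on (orbit_atlas Q) half_plane_atlas \<Phi> \<and>
           surface_iso (holomorphic_on) C half_plane_atlas \<Phi> \<and>
           (\<forall>c\<in>Q. \<forall>u\<in>tangent_space (orbit_atlas Q) c. \<forall>v\<in>tangent_space (orbit_atlas Q) c.
              poincare_metric (\<Phi> c) (pushforward \<Phi> u) (pushforward \<Phi> v) = g c u v))"
    using parametrized_orbit.ex_half_plane_isomorphism[OF orbit] by (intro allI impI) (elim conjE)
  show "\<forall>g. orbit_metric Q g \<longrightarrow>
      (\<exists>!\<mu>. riemannian_volume (orbit_atlas Q) g \<mu>) \<and>
      (\<forall>\<mu>. riemannian_volume (orbit_atlas Q) g \<mu> \<longrightarrow>
         (\<exists>D'. formal_adjoint (orbit_atlas Q) \<mu> dbar_op D') \<and>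
         (\<forall>D'. formal_adjoint (orbit_atlas Q) \<mu> dbar_op D' \<longrightarrow>
            (\<forall>f. smooth_fun (orbit_atlas Q) Q f \<longrightarrow>
               (\<forall>c\<in>Q. - D' (dbar_op f) c = X_op (X_op f) c + Y_half (Y_half f) c - f c / 4 \<and>
                  (\<forall>ch\<in>orbit_atlas Q. laplace_beltrami (orbit_atlas Q) g ch f c = - D' (dbar_op f) c)))))"
  proof (intro allI impI conjI ballI)
    fix g assume g: "orbit_metric Q g"
    show "\<exists>!\<mu>. riemannian_volume (orbit_atlas Q) g \<mu>"
      by (rule parametrized_orbit.volume_and_adjoint(1)[OF orbit g])
    fix \<mu> assume \<mu>: "riemannian_volume (orbit_atlas Q) g \<mu>"
    show "\<exists>D'. formal_adjoint (orbit_atlas Q) \<mu> dbar_op D'"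
      by (rule parametrized_orbit.volume_and_adjoint(2)[OF orbit g \<mu>])
    fix D' and f :: "adele_class \<Rightarrow> complex" and c
    assume D': "formal_adjoint (orbit_atlas Q) \<mu> dbar_op D'" and f: "smooth_fun (orbit_atlas Q) Q f"
      and c: "c \<in> Q"
    note laplacian = parametrized_orbit.orbit_laplacian[OF param g \<mu> D' f c]
    show adj: "- D' (dbar_op f) c = X_op (X_op f) c + Y_half (Y_half f) c - f c / 4"
      by (rule laplacian(1)[OF base])
    (* A chart of the orbit is the base chart of the parametrization at some point c1. *)
    fix ch assume "ch \<in> orbit_atlas Q"
    then obtain c1 where c1: "c1 \<in> Q" "ch = (Q, restrict (inv_into upper_half_plane (orbit_map c1)) Q)"
      unfolding orbit_atlas_def orbit_map_def[abs_def] by blast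
    show "laplace_beltrami (orbit_atlas Q) g ch f c = - D' (dbar_op f) c"
      unfolding c1(2) adj by (rule laplacian(2)[OF c1(1)])
  qed
qed

end
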